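(* Let $r\in\mathbb{N}$ and $p\in P^{Log}$. For every $k\in\{0,1,\dots,r\}$ there exists a constant $C>0$ depending only on $k$, $r$ and $p(\cdot)$ such that for every $\sigma>0$ and every $f\in W_r^{p(\cdot)}$, $$\big\|f^{(k)}-(g_\sigma^* )^{(k)}\big\|_{p(\cdot)}\le\frac{C}{\sigma^{r-k}}\,A_\sigma\big(f^{(r)}\big)_{p(\cdot)}$$ holds for any $g_\sigma^*\in\mathcal{G}_{\sigma,p(\cdot)}$ satisfying $A_\sigma(f)_{p(\cdot)}=\|f-g_\sigma^*\|_{p(\cdot)}$.
   Context: $P$ is the class of measurable functions $p:\mathbb{R}\to[1,\infty)$ with $1\le \operatorname{ess\,inf}_{x\in\mathbb{R}}p(x)$ and $\operatorname{ess\,sup}_{x\in\mathbb{R}}p(x)<\infty$. $P^{Log}$ is the class of $p\in P$ for which there exist constants $c_1,c_2>0$ and $c_3\in\mathbb{R}$ with $|p(x)-p(y)|\ln(e+1/|x-y|)\le c_1$ for all $x,y\in\mathbb{R}$ and $|p(x)-c_3|\ln(e+|x|)\le c_2$ for all $x\in\mathbb{R}$. For $p\in P$, $L^{p(\cdot)}=L^{p(\cdot)}(\mathbb{R})$ is the Banach space of measurable $f:\mathbb{R}\to\mathbb{C}$ with $I_{p(\cdot)}(f/\lambda):=\int_{\mathbb{R}}|f(y)/\lambda|^{p(y)}dy<\infty$ for some $\lambda>0$, with norm $\|f\|_{p(\cdot)}=\inf\{\eta>0: I_{p(\cdot)}(f/\eta)<1\}$. For $r\in\mathbb{N}=\{1,2,\dots\}$,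 $W_r^{p(\cdot)}$ is the class of $f\in L^{p(\cdot)}$ such that $f^{(r-1)}$ is absolutely continuous and $f^{(r)}\in L^{p(\cdot)}$. For $\sigma>0$, $\mathcal{G}_{\sigma,p(\cdot)}$ is the class of entire functions of exponential type $\le\sigma$ (whose restrictions to $\mathbb{R}$ are) belonging to $L^{p(\cdot)}$, and $A_\sigma(f)_{p(\cdot)}:=\inf\{\|f-g\|_{p(\cdot)}: g\in\mathcal{G}_{\sigma,p(\cdot)}\}$. *)

theory Defs
  imports "HOL-Analysis.Analysis" "HOL-Probability.Essential_Supremum"
begin

(* The ess-inf condition uses Liminf along the a.e. filter, dual to the library's esssup. *)
definition exponents :: "(real \<Rightarrow> real) set" where
  "exponents = {p. p \<in> borel_measurable lebesgue \<and> (\<forall>x. 1 \<le> p x) \<and>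
     1 \<le> Liminf (ae_filter lebesgue) (\<lambda>x. ereal (p x)) \<and>
     esssup lebesgue (\<lambda>x. ereal (p x)) < \<infinity>}"

(* For x = y the first inequality is trivial, both in the usual reading and
   with the convention 1 / 0 = 0. *)
definition log_exponents :: "(real \<Rightarrow> real) set" where
  "log_exponents = {p \<in> exponents. \<exists>c1 c2 c3. c1 > 0 \<and> c2 > 0 \<and>
     (\<forall>x y. \<bar>p x - p y\<bar> * ln (exp 1 + 1 / \<bar>x - y\<bar>) \<le> c1) \<and>
     (\<forall>x. \<bar>p x - c3\<bar> * ln (exp 1 + \<bar>x\<bar>) \<le> c2)}"

definition modular :: "(real \<Rightarrow> real) \<Rightarrow> (real \<Rightarrow> complex) \<Rightarrow> ennreal" where
  "modular p f = (\<integral>\<^sup>+ y. ennreal (cmod (f y) powr p y) \<partial>lebesgue)"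

definition Lvar :: "(real \<Rightarrow> real) \<Rightarrow> (real \<Rightarrow> complex) set" where
  "Lvar p = {f \<in> borel_measurable lebesgue.
     \<exists>lam::real. lam > 0 \<and> modular p (\<lambda>y. f y / of_real lam) < \<infinity>}"

(* The Luxemburg norm is extended-valued, with the infimum of the empty set equal to \<infinity>,
   so that a finite bound on the norm of a measurable function entails membership in Lvar p. *)
definition Lnorm :: "(real \<Rightarrow> real) \<Rightarrow> (real \<Rightarrow> complex) \<Rightarrow> ennreal" where
  "Lnorm p f = (INF \<eta>\<in>{\<eta>::real. \<eta> > 0 \<and> modular p (\<lambda>y. f y / of_real \<eta>) < 1}. ennreal \<eta>)"

(* Iterated derivative of a function on the real line. Where a derivative does not exist its value
   is a fixed but unspecified number; below this concerns only null sets. *)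
definition rderiv :: "nat \<Rightarrow> (real \<Rightarrow> complex) \<Rightarrow> real \<Rightarrow> complex" where
  "rderiv k = (\<lambda>h x. vector_derivative h (at x)) ^^ k"

(* D is a finite family of non-overlapping intervals, coded by their endpoints. *)
definition abs_cont_on :: "real \<Rightarrow> real \<Rightarrow> (real \<Rightarrow> complex) \<Rightarrow> bool" where
  "abs_cont_on a b h \<longleftrightarrow> (\<forall>\<epsilon>>0. \<exists>\<delta>>0. \<forall>D. finite D \<longrightarrow>
     (\<forall>(u, v)\<in>D. a \<le> u \<and> u \<le> v \<and> v \<le> b) \<longrightarrow>
     disjoint_family_on (\<lambda>(u, v). {u<..<v}) D \<longrightarrow>
     (\<Sum>(u, v)\<in>D. v - u) < \<delta> \<longrightarrow> (\<Sum>(u, v)\<in>D. cmod (h v - h u)) < \<epsilon>)"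

(* Absolute continuity on the line is meant on every compact interval. The epsilon-delta
   condition on the whole line gives the same class, because the derivative of order r is
   required to lie in Lvar p, hence in L^1 + L^q with q = esssup p. *)
definition Wvar :: "nat \<Rightarrow> (real \<Rightarrow> real) \<Rightarrow> (real \<Rightarrow> complex) set" where
  "Wvar r p = {f \<in> Lvar p.
     (\<forall>j x. Suc j < r \<longrightarrow> rderiv j f differentiable (at x)) \<and>
     (\<forall>a b. abs_cont_on a b (rderiv (r - 1) f)) \<and>
     rderiv r f \<in> Lvar p}"

definition exp_type_le :: "real \<Rightarrow> (complex \<Rightarrow> complex) \<Rightarrow> bool" where
  "exp_type_le \<sigma> g \<longleftrightarrow> g holomorphic_on UNIV \<and>
     (\<forall>\<epsilon>>0. \<exists>A. \<forall>z. cmod (g z) \<le> A * exp ((\<sigma> + \<epsilon>) * cmod z))"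

definition Gvar :: "real \<Rightarrow> (real \<Rightarrow> real) \<Rightarrow> (complex \<Rightarrow> complex) set" where
  "Gvar \<sigma> p = {g. exp_type_le \<sigma> g \<and> (\<lambda>x. g (of_real x)) \<in> Lvar p}"

definition best_approx :: "real \<Rightarrow> (real \<Rightarrow> real) \<Rightarrow> (real \<Rightarrow> complex) \<Rightarrow> ennreal" where
  "best_approx \<sigma> p f = (INF g\<in>Gvar \<sigma> p. Lnorm p (\<lambda>x. f x - g (of_real x)))"

end

theory Submission
  imports Defs "HOL-Complex_Analysis.Complex_Analysis" "HOL-Probability.Sinc_Integral"
begin

text \<open>The best approximant \<open>g\<close> of \<open>f\<close> is compared with \<open>f\<close> one derivative at a time, by means of
  convolutions with the dilations \<open>K\<^sub>l t = l \<phi> (l t)\<close> (\<open>scaled_kernel\<close>) of one kernel \<open>\<phi>\<close>, the normalised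
  product \<open>sinc (9 t) sinc(t)\<^sup>3\<close>. It is entire of exponential type 12, decays on the line like
  \<open>|t|\<^bsup>-4\<^esup>\<close>, and \<open>K\<^sub>l * w = w\<close> for every entire \<open>w\<close> with \<open>|w z| \<le> B (1 + |z|) e\<^bsup>6 l |Im z|\<^esup>\<close>
  (\<open>scaled_kernel_reproduces\<close>). Let \<open>\<Psi>\<^sub>l\<close> be the tail integral of \<open>K\<^sub>l\<close>.

  \<^emph>\<open>Uniform boundedness.\<close> The kernels \<open>K\<^sub>l\<close>, \<open>K\<^sub>l' / l\<close> and \<open>l \<Psi>\<^sub>l\<close> lie below a fixed multiple of the Poisson
  kernel of width \<open>1 / l\<close> (\<open>scaled_kernel_poisson_bounds\<close>), and convolution with such kernels is bounded on
  \<open>L\<^bsup>p(\<cdot>)\<^esup>\<close> uniformly in \<open>l\<close> (\<open>Lnorm_conv_le\<close>). This is where the two logarithmic conditions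
  on \<open>p\<close> enter: they make \<open>s\<^bsup>p x - p y\<^esup>\<close> bounded for the relevant \<open>s\<close>, \<open>x\<close> and \<open>y\<close>, and then
  \<open>a \<le> s + a\<^bsup>p y\<^esup> s\<^bsup>1 - p y\<^esup>\<close> bounds the \<open>p x\<close>-th power of the Poisson integral of \<open>|f|\<close> at \<open>x\<close> by a multiple
  of the Poisson integral of \<open>|f|\<^bsup>p(\<cdot>)\<^esup>\<close>, up to an integrable remainder.

  \<^emph>\<open>Jackson's step.\<close> Let \<open>F\<close> be a primitive of \<open>F'\<close>, let \<open>v\<close> be of type \<open>\<sigma>\<close> with primitive \<open>Q\<close>, and put
  \<open>D = F - Q\<close>. Integration by parts gives \<open>D - K\<^sub>l * D = \<Psi>\<^sub>l * D'\<close>. For \<open>l = \<sigma> / 12\<close> the function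
  \<open>Q + K\<^sub>l * D\<close> is of type \<open>\<sigma>\<close> and differs from \<open>F\<close> by \<open>\<Psi>\<^sub>l * (F' - v)\<close>, whence
  \<open>A\<^sub>\<sigma>(F) \<le> (C / \<sigma>) A\<^sub>\<sigma>(F')\<close> (\<open>jackson_step\<close>).

  \<^emph>\<open>Derivative step.\<close> Let \<open>u\<close> and \<open>v\<close> be of type \<open>\<sigma>\<close> and \<open>l = \<sigma>\<close>. Reproduction and integration by parts give
  \<open>u' - v = K\<^sub>l * (u' - v) = K\<^sub>l * (F' - v) - K\<^sub>l' * (F - u)\<close>, whence
  \<open>\<parallel>F' - u'\<parallel> \<le> C (\<sigma> \<parallel>F - u\<parallel> + A\<^sub>\<sigma>(F'))\<close> (\<open>derivative_step\<close>).

  The theorem follows by induction on \<open>k\<close>: with \<open>E\<^sub>k = \<parallel>f\<^bsup>(k)\<^esup> - g\<^bsup>(k)\<^esup>\<parallel>\<close>, the start \<open>E\<^sub>0 = A\<^sub>\<sigma>(f)\<close> is bounded by \<open>r\<close>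
  Jackson steps, and \<open>E\<^bsub>k+1\<^esub> \<le> C (\<sigma> E\<^sub>k + A\<^sub>\<sigma>(f\<^bsup>(k+1)\<^esup>))\<close> (\<open>simultaneous_approximation\<close>).

  Three facts make these steps legitimate. Members of \<open>G\<^sub>\<sigma>\<close> satisfy the growth bound needed for
  reproduction; it comes from the principle of Phragmen and Lindelof (\<open>plane_growth\<close>, \<open>Gvar_primitive\<close>).
  A function that is absolutely continuous in the sense of \<open>\<epsilon>\<close> and \<open>\<delta>\<close> is a primitive of its
  derivative; this is proved through the total variation, the Radon-Nikodym theorem and Vitali's covering
  theorem (\<open>abs_cont_primitive_of_derivative\<close>). The derivatives of order strictly between 0 and \<open>r\<close>
  belong to \<open>L\<^bsup>p(\<cdot>)\<^esup>\<close>, because they are controlled by finite differences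
  (\<open>intermediate_derivative_in_Lvar\<close>).\<close>

section \<open>Lebesgue measure on the line\<close>

lemma sigma_finite_lebesgue: "sigma_finite_measure (lebesgue :: 'a::euclidean_space measure)"
proof -
  obtain A :: "'a set set" where A: "countable A" "A \<subseteq> sets lborel" "\<Union>A = space lborel"
    "\<forall>a\<in>A. emeasure lborel a \<noteq> \<infinity>"
    using lborel.sigma_finite_countable by blast
  then have "emeasure lebesgue a \<noteq> \<infinity>" if "a \<in> A" for a
    using that by (auto simp: emeasure_completion subset_iff)
  with A show ?thesis
    by (intro sigma_finite_measure.intro exI[of _ A]) auto
qed

interpretation lebesgue: sigma_finite_measure "lebesgue :: real measure"
  by (rule sigma_finite_lebesgue)

interpretation lebesgue_pair: pair_sigma_finite "lebesgue :: real measure" "lebesgue :: real measure"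
  by unfold_locales

lemma borel_measurable_lebesgue_ident: "(\<lambda>y::real. y) \<in> borel_measurable lebesgue"
  by (intro measurable_completion measurable_ident_sets sets_lborel)

lemma lebesgue_pair_fst_snd:
  "fst \<in> borel_measurable ((lebesgue :: real measure) \<Otimes>\<^sub>M (lebesgue :: real measure))"
  "snd \<in> borel_measurable ((lebesgue :: real measure) \<Otimes>\<^sub>M (lebesgue :: real measure))"
  by (rule measurable_compose[OF measurable_fst borel_measurable_lebesgue_ident])
     (rule measurable_compose[OF measurable_snd borel_measurable_lebesgue_ident])

lemma borel_measurable_lebesgue_diff:
  fixes g :: "real \<Rightarrow> 'b::topological_space"
  assumes "g \<in> borel_measurable borel"
  shows "(\<lambda>y. g (x - y)) \<in> borel_measurable lebesgue" "(\<lambda>y. g (y - x)) \<in> borel_measurable lebesgue"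
    "(\<lambda>(x, y). g (x - y)) \<in> borel_measurable (lebesgue \<Otimes>\<^sub>M lebesgue)"
proof -
  note m = borel_measurable_lebesgue_ident
  show "(\<lambda>y. g (x - y)) \<in> borel_measurable lebesgue"
    by (intro measurable_compose[OF _ assms] borel_measurable_diff borel_measurable_const m)
  show "(\<lambda>y. g (y - x)) \<in> borel_measurable lebesgue"
    by (intro measurable_compose[OF _ assms] borel_measurable_diff borel_measurable_const m)
  show "(\<lambda>(x, y). g (x - y)) \<in> borel_measurable (lebesgue \<Otimes>\<^sub>M lebesgue)"
    unfolding split_beta by (intro measurable_compose[OF _ assms] borel_measurable_diff lebesgue_pair_fst_snd)
qed

lemma nn_integral_lebesgue_eq_lborel:
  "f \<in> borel_measurable borel \<Longrightarrow> (\<integral>\<^sup>+x. f x \<partial>lebesgue) = (\<integral>\<^sup>+x. f x \<partial>lborel)"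
  by (rule nn_integral_completion)

section \<open>The Luxemburg norm\<close>

text \<open>Convexity of \<open>x\<^bsup>q\<^esup>\<close> is available on the open half-line; the end point 0 needs the separate
  inequality \<open>(t c)\<^bsup>q\<^esup> \<le> t c\<^bsup>q\<^esup>\<close> for \<open>t \<le> 1\<close>.\<close>

lemma convex_powr_combination:
  fixes a b s q :: real
  assumes "0 \<le> a" "0 \<le> b" "0 \<le> s" "s \<le> 1" "1 \<le> q"
  shows "(s * a + (1 - s) * b) powr q \<le> s * a powr q + (1 - s) * b powr q"
proof -
  have sc: "(t * c) powr q \<le> t * c powr q" if "0 \<le> t" "t \<le> 1" "0 \<le> c" for t c :: real
  proof -
    have "t powr q \<le> t"
      using that assms powr_mono'[of 1 q t] by (cases "t = 0") auto
    then show ?thesis using that by (simp add: powr_mult mult_right_mono)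
  qed
  consider "a = 0" | "b = 0" | "a > 0" "b > 0" using assms by linarith
  then show ?thesis
  proof cases
    case 1 then show ?thesis using sc[of "1 - s" b] assms by simp
  next
    case 2 then show ?thesis using sc[of s a] assms by simp
  next
    case 3
    have "convex_on {0<..} (\<lambda>x::real. x powr q)" by (rule powr_convex) fact
    from convex_onD[OF this, of "1 - s" a b] show ?thesis using 3 assms by simp
  qed
qed

lemma modular_mono:
  assumes "\<And>y. 0 \<le> p y" "\<And>y. cmod (f y) \<le> cmod (g y)"
  shows "modular p f \<le> modular p g"
  unfolding modular_def using assms by (intro nn_integral_mono ennreal_leI powr_mono2) auto

lemma modular_scale:
  assumes p: "\<And>y. 1 \<le> p y" "p \<in> borel_measurable lebesgue" and f: "f \<in> borel_measurable lebesgue"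
    and c: "0 \<le> c" "c \<le> 1"
  shows "modular p (\<lambda>y. of_real c * f y) \<le> ennreal c * modular p f"
proof -
  have "(c * cmod (f y)) powr p y \<le> c * cmod (f y) powr p y" for y
    using convex_powr_combination[of "cmod (f y)" 0 c "p y"] c p(1)[of y] by simp
  then have "modular p (\<lambda>y. of_real c * f y) \<le> (\<integral>\<^sup>+ y. ennreal c * ennreal (cmod (f y) powr p y) \<partial>lebesgue)"
    unfolding modular_def using c
    by (intro nn_integral_mono) (simp add: norm_mult ennreal_mult[symmetric] ennreal_leI)
  also have "\<dots> = ennreal c * modular p f"
    unfolding modular_def using p f by (intro nn_integral_cmult) measurable
  finally show ?thesis .
qed

lemma Lnorm_le: "\<eta> > 0 \<Longrightarrow> modular p (\<lambda>y. f y / of_real \<eta>) < 1 \<Longrightarrow> Lnorm p f \<le> ennreal \<eta>"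
  unfolding Lnorm_def by (rule INF_lower) simp

lemma Lnorm_lessE:
  assumes "Lnorm p f < c"
  obtains \<eta> where "\<eta> > 0" "modular p (\<lambda>y. f y / of_real \<eta>) < 1" "ennreal \<eta> < c"
  using assms unfolding Lnorm_def INF_less_iff by auto

text \<open>By convexity, division by \<open>2 C\<close> reduces a modular of at most \<open>C\<close> to at most \<open>1/2\<close>; the factor 2 makes
  it strictly smaller than 1, as the norm demands.\<close>

lemma Lnorm_le_of_modular:
  assumes p: "\<And>y. 1 \<le> p y" "p \<in> borel_measurable lebesgue" and f: "f \<in> borel_measurable lebesgue"
    and "\<eta> > 0" "C \<ge> 1" "modular p (\<lambda>y. f y / of_real \<eta>) \<le> ennreal C"
  shows "Lnorm p f \<le> ennreal (2 * C * \<eta>)"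
proof (rule Lnorm_le)
  have "modular p (\<lambda>y. f y / of_real (2 * C * \<eta>)) = modular p (\<lambda>y. of_real (1 / (2*C)) * (f y / of_real \<eta>))"
    by simp
  also have "\<dots> \<le> ennreal (1 / (2*C)) * modular p (\<lambda>y. f y / of_real \<eta>)"
    using assms by (intro modular_scale) auto
  also have "\<dots> \<le> ennreal (1 / (2*C)) * ennreal C" using assms by (intro mult_left_mono) auto
  also have "\<dots> = ennreal (1/2)" using assms by (simp add: ennreal_mult[symmetric])
  also have "\<dots> < 1" by (subst ennreal_less_one_iff) simp
  finally show "modular p (\<lambda>y. f y / of_real (2 * C * \<eta>)) < 1" .
qed (use assms in auto)

lemma Lnorm_finite_iff:
  assumes p: "\<And>y. 1 \<le> p y" "p \<in> borel_measurable lebesgue" and f: "f \<in> borel_measurable lebesgue"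
  shows "Lnorm p f < \<infinity> \<longleftrightarrow> f \<in> Lvar p"
proof
  assume "Lnorm p f < \<infinity>"
  then obtain \<eta> where "\<eta> > 0" "modular p (\<lambda>y. f y / of_real \<eta>) < 1" by (rule Lnorm_lessE)
  then show "f \<in> Lvar p" using f unfolding Lvar_def by (auto intro!: exI[of _ \<eta>] elim: order.strict_trans)
next
  assume "f \<in> Lvar p"
  then obtain \<eta> where \<eta>: "\<eta> > 0" "modular p (\<lambda>y. f y / of_real \<eta>) < \<infinity>" unfolding Lvar_def by auto
  then obtain C where C: "modular p (\<lambda>y. f y / of_real \<eta>) = ennreal C" "C \<ge> 0"
    by (cases "modular p (\<lambda>y. f y / of_real \<eta>)") auto
  have "Lnorm p f \<le> ennreal (2 * max 1 C * \<eta>)"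
    using \<eta> C by (intro Lnorm_le_of_modular p f) (auto intro: ennreal_leI)
  also have "\<dots> < \<infinity>" by simp
  finally show "Lnorm p f < \<infinity>" .
qed

lemma Lnorm_mono_scale:
  assumes p: "\<And>y. 0 \<le> p y" and c: "c > 0" and le: "\<And>x. cmod (f x) \<le> c * cmod (g x)"
  shows "Lnorm p f \<le> ennreal c * Lnorm p g"
proof (rule ennreal_le_epsilon)
  fix e :: real assume fin: "ennreal c * Lnorm p g < top" and e: "e > 0"
  from fin c have "Lnorm p g < top" by (auto simp: ennreal_mult_eq_top_iff less_top[symmetric])
  then have "Lnorm p g < Lnorm p g + ennreal (e / c)"
    using e c by (cases "Lnorm p g") (auto simp: ennreal_plus[symmetric] ennreal_less_iff simp del: ennreal_plus)
  then obtain \<eta> where \<eta>: "\<eta> > 0" "modular p (\<lambda>y. g y / of_real \<eta>) < 1" "ennreal \<eta> < Lnorm p g + ennreal (e / c)"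
    by (rule Lnorm_lessE)
  have "modular p (\<lambda>y. f y / of_real (c * \<eta>)) \<le> modular p (\<lambda>y. g y / of_real \<eta>)"
    using p le c \<eta> by (intro modular_mono) (auto simp: norm_divide norm_mult divide_simps mult_ac)
  then have "Lnorm p f \<le> ennreal (c * \<eta>)" using \<eta> c by (intro Lnorm_le) auto
  also have "\<dots> = ennreal c * ennreal \<eta>" using c \<eta> by (simp add: ennreal_mult)
  also have "\<dots> \<le> ennreal c * (Lnorm p g + ennreal (e / c))" using \<eta> by (intro mult_left_mono) auto
  also have "\<dots> = ennreal c * Lnorm p g + ennreal e"
    using c e by (simp add: distrib_left ennreal_mult[symmetric])
  finally show "Lnorm p f \<le> ennreal c * Lnorm p g + ennreal e" .
qed

lemma Lnorm_mono:
  assumes p: "\<And>y. 0 \<le> p y" and le: "\<And>x. cmod (f x) \<le> cmod (g x)"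
  shows "Lnorm p f \<le> Lnorm p g"
  using Lnorm_mono_scale[of p 1 f g] assms by simp

text \<open>If \<open>f / a\<close> and \<open>g / b\<close> have modular below 1, then \<open>(f + g) / (a + b)\<close> is their convex combination with
  weights \<open>a / (a + b)\<close> and \<open>b / (a + b)\<close>.\<close>

lemma Lnorm_triangle:
  assumes p: "\<And>y. 1 \<le> p y" "p \<in> borel_measurable lebesgue"
    and f: "f \<in> borel_measurable lebesgue" and g: "g \<in> borel_measurable lebesgue"
  shows "Lnorm p (\<lambda>x. f x + g x) \<le> Lnorm p f + Lnorm p g"
proof (rule ennreal_le_epsilon)
  fix e :: real assume fin: "Lnorm p f + Lnorm p g < top" and e: "e > 0"
  have lt: "a < a + ennreal (e/2)" if "a < top" for a
    using that e by (cases a) (auto simp: ennreal_plus[symmetric] ennreal_less_iff simp del: ennreal_plus)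
  from fin have "Lnorm p f < top" "Lnorm p g < top" by auto
  note lt[OF this(1)] lt[OF this(2)]
  then obtain a b where a: "a > 0" "modular p (\<lambda>y. f y / of_real a) < 1" "ennreal a < Lnorm p f + ennreal (e/2)"
    and b: "b > 0" "modular p (\<lambda>y. g y / of_real b) < 1" "ennreal b < Lnorm p g + ennreal (e/2)"
    by (metis Lnorm_lessE)
  define s where "s = a / (a + b)"
  have s: "0 < s" "s < 1" "1 - s = b / (a + b)" using a b by (auto simp: s_def field_simps)
  have nrm: "cmod (of_real s * F + of_real (1 - s) * G) \<le> s * cmod F + (1 - s) * cmod G" for F G
    using norm_triangle_ineq[of "of_real s * F" "of_real (1 - s) * G"] s(1,2)
    by (simp only: norm_mult norm_of_real abs_of_pos diff_gt_0_iff_gt)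
  have pw: "cmod ((f y + g y) / of_real (a + b)) powr p y
      \<le> s * (cmod (f y / of_real a) powr p y) + (1 - s) * (cmod (g y / of_real b) powr p y)" for y
  proof -
    have "(f y + g y) / of_real (a + b) = of_real s * (f y / of_real a) + of_real (1 - s) * (g y / of_real b)"
      unfolding s(3) unfolding s_def using a b by (simp add: add_divide_distrib)
    also have "cmod \<dots> \<le> s * cmod (f y / of_real a) + (1 - s) * cmod (g y / of_real b)"
      by (rule nrm)
    finally have "cmod ((f y + g y) / of_real (a + b)) powr p y \<le> (s * cmod (f y / of_real a) + (1 - s) * cmod (g y / of_real b)) powr p y"
      using p(1)[of y] by (intro powr_mono2) auto
    also have "\<dots> \<le> s * (cmod (f y / of_real a) powr p y) + (1 - s) * (cmod (g y / of_real b) powr p y)"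
      using s p by (intro convex_powr_combination) auto
    finally show ?thesis .
  qed
  have "modular p (\<lambda>y. (f y + g y) / of_real (a + b))
     \<le> (\<integral>\<^sup>+y. ennreal s * ennreal (cmod (f y / of_real a) powr p y) + ennreal (1 - s) * ennreal (cmod (g y / of_real b) powr p y) \<partial>lebesgue)"
    unfolding modular_def using s(1,2)
    by (intro nn_integral_mono order_trans[OF ennreal_leI[OF pw]])
       (simp add: ennreal_mult ennreal_plus del: of_real_add)
  also have "\<dots> = ennreal s * modular p (\<lambda>y. f y / of_real a) + ennreal (1 - s) * modular p (\<lambda>y. g y / of_real b)"
    unfolding modular_def using p f g
    by (subst nn_integral_add, measurable, subst nn_integral_cmult, measurable, subst nn_integral_cmult, measurable)
  also have "\<dots> < 1"
  proof -
    obtain A where A: "modular p (\<lambda>y. f y / of_real a) = ennreal A" "A \<ge> 0"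
      using a(2) by (cases "modular p (\<lambda>y. f y / of_real a)") auto
    obtain B where B: "modular p (\<lambda>y. g y / of_real b) = ennreal B" "B \<ge> 0"
      using b(2) by (cases "modular p (\<lambda>y. g y / of_real b)") auto
    have "A < 1" "B < 1" using a(2) b(2) A B by (auto simp: ennreal_less_one_iff)
    then have "s * A + (1 - s) * B < s * 1 + (1 - s) * 1"
      using s by (intro add_strict_mono mult_strict_left_mono) auto
    then show ?thesis unfolding A B using s(1,2) A B
      by (simp only: ennreal_mult[symmetric] ennreal_plus[symmetric] mult_nonneg_nonneg less_imp_le
          diff_ge_0_iff_ge) (subst ennreal_less_one_iff, simp)
  qed
  finally have "Lnorm p (\<lambda>x. f x + g x) \<le> ennreal (a + b)" using a b by (intro Lnorm_le) auto
  also have "\<dots> \<le> (Lnorm p f + ennreal (e/2)) + (Lnorm p g + ennreal (e/2))"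
    using a b by (auto intro!: add_mono)
  also have "\<dots> = Lnorm p f + Lnorm p g + ennreal e"
  proof -
    have "ennreal e = ennreal (e/2) + ennreal (e/2)" using e by (subst ennreal_plus[symmetric]) auto
    then show ?thesis by (simp only: add_ac)
  qed
  finally show "Lnorm p (\<lambda>x. f x + g x) \<le> Lnorm p f + Lnorm p g + ennreal e" .
qed

section \<open>Convolution with Poisson-type kernels\<close>

definition poisson_kernel :: "real \<Rightarrow> real \<Rightarrow> real" where
  "poisson_kernel \<tau> w = \<tau> / (pi * (\<tau>\<^sup>2 + w\<^sup>2))"

lemma poisson_kernel_measurable [measurable]: "poisson_kernel \<tau> \<in> borel_measurable borel"
  unfolding poisson_kernel_def by measurable

lemma poisson_kernel_nonneg: "\<tau> > 0 \<Longrightarrow> 0 \<le> poisson_kernel \<tau> w"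
  unfolding poisson_kernel_def by simp

lemma poisson_kernel_commute: "poisson_kernel \<tau> (x - y) = poisson_kernel \<tau> (y - x)"
  unfolding poisson_kernel_def by (simp add: power2_commute)

lemma poisson_kernel_le:
  assumes "\<tau> > 0" shows "poisson_kernel \<tau> w \<le> 1 / (pi * \<tau>)"
proof -
  have "0 < pi * \<tau>\<^sup>2" "pi * \<tau>\<^sup>2 \<le> pi * (\<tau>\<^sup>2 + w\<^sup>2)" using assms by simp_all
  then have "poisson_kernel \<tau> w \<le> \<tau> / (pi * \<tau>\<^sup>2)"
    unfolding poisson_kernel_def using assms by (intro frac_le) linarith+
  then show ?thesis using assms by (simp add: power2_eq_square)
qed

lemma nn_integral_poisson_lborel:
  assumes "\<tau> > 0"
  shows "(\<integral>\<^sup>+y. ennreal (poisson_kernel \<tau> (x - y)) \<partial>lborel) = 1"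
proof -
  have int: "integrable lborel (\<lambda>x::real. inverse (1 + x\<^sup>2))" and val: "(\<integral>x. inverse (1 + x\<^sup>2) \<partial>lborel) = pi"
    using integrable_inverse_1_plus_square LBINT_inverse_1_plus_square
    by (auto simp: set_integrable_def interval_lebesgue_integral_def set_lebesgue_integral_def einterval_def)
  have eq: "\<tau> * poisson_kernel \<tau> (x - (x + \<tau> * u)) = inverse (1 + u\<^sup>2) / pi" for u
  proof -
    have "\<tau>\<^sup>2 + (x - (x + \<tau> * u))\<^sup>2 = \<tau>\<^sup>2 * (1 + u\<^sup>2)" by (simp add: algebra_simps power2_eq_square)
    then show ?thesis using assms by (simp add: poisson_kernel_def power2_eq_square divide_simps)
  qed
  have "(\<integral>\<^sup>+y. ennreal (poisson_kernel \<tau> (x - y)) \<partial>lborel) =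
    ennreal \<bar>\<tau>\<bar> * (\<integral>\<^sup>+u. ennreal (poisson_kernel \<tau> (x - (x + \<tau> * u))) \<partial>lborel)"
    using assms by (intro nn_integral_real_affine) auto
  also have "\<dots> = (\<integral>\<^sup>+u. ennreal (\<tau> * poisson_kernel \<tau> (x - (x + \<tau> * u))) \<partial>lborel)"
    using assms by (subst nn_integral_cmult[symmetric]) (auto simp: ennreal_mult poisson_kernel_nonneg)
  also have "\<dots> = (\<integral>\<^sup>+u. ennreal (inverse (1 + u\<^sup>2) / pi) \<partial>lborel)"
    unfolding eq ..
  also have "\<dots> = ennreal (\<integral>u. inverse (1 + u\<^sup>2) / pi \<partial>lborel)"
    using int by (intro nn_integral_eq_integral) auto
  also have "\<dots> = 1" using val by simp
  finally show ?thesis .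
qed

lemma nn_integral_poisson:
  assumes "\<tau> > 0"
  shows "(\<integral>\<^sup>+y. ennreal (poisson_kernel \<tau> (x - y)) \<partial>lebesgue) = 1"
  using nn_integral_poisson_lborel[OF assms, of x]
  by (subst nn_integral_lebesgue_eq_lborel) measurable

lemma nn_integral_poisson':
  assumes "\<tau> > 0"
  shows "(\<integral>\<^sup>+x. ennreal (poisson_kernel \<tau> (x - y)) \<partial>lebesgue) = 1"
  using nn_integral_poisson[OF assms, of y] by (simp add: poisson_kernel_commute)

text \<open>Tonelli: the kernel has integral 1 in each of its two variables.\<close>

lemma nn_integral_poisson_conv:
  assumes "\<tau> > 0" and [measurable]: "g \<in> borel_measurable lebesgue"
  shows "(\<integral>\<^sup>+x. (\<integral>\<^sup>+y. ennreal (poisson_kernel \<tau> (x - y)) * g y \<partial>lebesgue) \<partial>lebesgue) = (\<integral>\<^sup>+y. g y \<partial>lebesgue)"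
proof -
  have [measurable]: "(\<lambda>(x, y). poisson_kernel \<tau> (x - y)) \<in> borel_measurable (lebesgue \<Otimes>\<^sub>M lebesgue)"
    by (rule borel_measurable_lebesgue_diff) simp
  have [measurable]: "(\<lambda>x. poisson_kernel \<tau> (x - y)) \<in> borel_measurable lebesgue" for y
    by (rule borel_measurable_lebesgue_diff) simp
  have "(\<integral>\<^sup>+x. (\<integral>\<^sup>+y. ennreal (poisson_kernel \<tau> (x - y)) * g y \<partial>lebesgue) \<partial>lebesgue)
      = (\<integral>\<^sup>+y. (\<integral>\<^sup>+x. ennreal (poisson_kernel \<tau> (x - y)) * g y \<partial>lebesgue) \<partial>lebesgue)"
    by (rule lebesgue_pair.Fubini'[symmetric]) measurable
  also have "\<dots> = (\<integral>\<^sup>+y. g y \<partial>lebesgue)"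
    by (subst nn_integral_multc) (auto simp: nn_integral_poisson'[OF assms(1)])
  finally show ?thesis .
qed

text \<open>With the constants as parameters, the bounds for convolutions are terms in them, which visibly do not
  depend on \<open>\<sigma>\<close> or \<open>f\<close>.\<close>

locale log_exponent =
  fixes p :: "real \<Rightarrow> real" and c1 c2 c3 P :: real
  assumes p_measurable [measurable]: "p \<in> borel_measurable lebesgue"
    and p_ge: "\<And>x. 1 \<le> p x" and p_le: "\<And>x. p x \<le> P"
    and c_pos: "0 < c1" "0 < c2"
    and local_log: "\<And>x y. \<bar>p x - p y\<bar> * ln (exp 1 + 1 / \<bar>x - y\<bar>) \<le> c1"
    and decay_log: "\<And>x. \<bar>p x - c3\<bar> * ln (exp 1 + \<bar>x\<bar>) \<le> c2"

lemma log_exponents_locale: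
  assumes "p \<in> log_exponents"
  obtains c1 c2 c3 P where "log_exponent p c1 c2 c3 P"
proof -
  obtain c1 c2 c3 where c: "c1 > 0" "c2 > 0" "\<And>x y. \<bar>p x - p y\<bar> * ln (exp 1 + 1 / \<bar>x - y\<bar>) \<le> c1"
    "\<And>x. \<bar>p x - c3\<bar> * ln (exp 1 + \<bar>x\<bar>) \<le> c2"
    using assms unfolding log_exponents_def by auto
  have p: "p \<in> borel_measurable lebesgue" "\<And>x. 1 \<le> p x"
    using assms unfolding log_exponents_def exponents_def by auto
  have "p x \<le> c3 + c2" for x
  proof -
    have "ln (exp 1) \<le> ln (exp 1 + \<bar>x\<bar>)" by (subst ln_le_cancel_iff) (auto intro: add_pos_nonneg)
    then have "\<bar>p x - c3\<bar> * 1 \<le> \<bar>p x - c3\<bar> * ln (exp 1 + \<bar>x\<bar>)" by (intro mult_left_mono) auto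
    with c(4)[of x] have "\<bar>p x - c3\<bar> \<le> c2" by simp
    then show ?thesis by linarith
  qed
  with c p have "log_exponent p c1 c2 c3 (c3 + c2)" by unfold_locales auto
  then show thesis by (rule that)
qed

context log_exponent
begin

text \<open>Since \<open>s \<le> 1 / \<tau> \<le> 1 / |x - y|\<^sup>2\<close>, the logarithm of \<open>s\<close> is at most \<open>2 ln (e + 1 / |x - y|)\<close>, which the
  local condition on the exponent compensates.\<close>

lemma powr_exponent_local:
  assumes s: "1 \<le> s" "s \<le> 1 / \<tau>" and "\<tau> > 0" and near: "(x - y)\<^sup>2 < \<tau>"
  shows "s powr (p x - p y) \<le> exp (2 * c1)"
proof (cases "x = y")
  case True then show ?thesis using s c_pos by simp
next
  case False
  define d where "d = \<bar>x - y\<bar>"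
  have d: "d > 0" "d\<^sup>2 < \<tau>" using False near by (auto simp: d_def)
  have "1 / \<tau> \<le> (1 / d)\<^sup>2" using d assms by (simp add: power_divide frac_le)
  then have "ln (1 / \<tau>) \<le> ln ((1 / d)\<^sup>2)" using assms d by (subst ln_le_cancel_iff) auto
  also have "\<dots> = 2 * ln (1 / d)" using d by (subst ln_realpow) auto
  also have "ln (1 / d) \<le> ln (exp 1 + 1 / d)" using d by (subst ln_le_cancel_iff) (auto intro: add_pos_pos)
  finally have "ln (1 / \<tau>) \<le> 2 * ln (exp 1 + 1 / d)" by simp
  then have l: "ln s \<le> 2 * ln (exp 1 + 1 / d)"
  proof -
    have "ln s \<le> ln (1 / \<tau>)" using s assms by (subst ln_le_cancel_iff) auto
    with \<open>ln (1 / \<tau>) \<le> 2 * ln (exp 1 + 1 / d)\<close> show ?thesis by linarith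
  qed
  have "s powr (p x - p y) = exp ((p x - p y) * ln s)" using s by (simp add: powr_def)
  also have "\<dots> \<le> exp (\<bar>p x - p y\<bar> * ln s)" using s by (auto intro!: mult_right_mono)
  also have "\<bar>p x - p y\<bar> * ln s \<le> \<bar>p x - p y\<bar> * (2 * ln (exp 1 + 1 / d))" using l by (intro mult_left_mono) auto
  also have "\<dots> \<le> 2 * c1" using local_log[of x y] by (simp add: d_def)
  finally show ?thesis by simp
qed

text \<open>Compare \<open>p x\<close> and \<open>p y\<close> with the value \<open>c3\<close> at infinity: \<open>1 / s\<close> is at most
  \<open>1 + z\<^sup>2 \<le> (e + |z|)\<^sup>2\<close> for both points \<open>z\<close>, so the decay condition compensates \<open>ln (1 / s)\<close>.\<close>

lemma powr_exponent_decay: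
  assumes s: "s \<le> 1" "1 / (1 + x\<^sup>2) \<le> s" "1 / (1 + y\<^sup>2) \<le> s"
  shows "s powr (p x - p y) \<le> exp (4 * c2)"
proof -
  have s0: "s > 0" using s(2) by (rule less_le_trans[rotated]) (auto intro: add_pos_nonneg)
  have l: "\<bar>p z - c3\<bar> * (- ln s) \<le> 2 * c2" if "1 / (1 + z\<^sup>2) \<le> s" for z
  proof -
    have "1 / s \<le> 1 + z\<^sup>2" using that s0 by (simp add: field_simps add_pos_nonneg)
    also have "\<dots> \<le> (exp 1 + \<bar>z\<bar>)\<^sup>2"
    proof -
      have "(1::real) \<le> exp 1" by simp
      then have "1 \<le> (exp (1::real))\<^sup>2" by (rule one_le_power)
      moreover have "0 \<le> 2 * exp 1 * \<bar>z\<bar>" by simp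
      ultimately show ?thesis unfolding power2_sum power2_abs by linarith
    qed
    finally have "ln (1 / s) \<le> ln ((exp 1 + \<bar>z\<bar>)\<^sup>2)"
      using s0 by (subst ln_le_cancel_iff) (auto intro!: zero_less_power add_pos_nonneg)
    then have "- ln s \<le> 2 * ln (exp 1 + \<bar>z\<bar>)" using s0 by (simp add: ln_div ln_realpow add_pos_nonneg)
    then have "\<bar>p z - c3\<bar> * (- ln s) \<le> \<bar>p z - c3\<bar> * (2 * ln (exp 1 + \<bar>z\<bar>))" by (intro mult_left_mono) auto
    then show ?thesis using decay_log[of z] by simp
  qed
  have "s powr (p x - p y) = exp ((p x - p y) * ln s)" using s0 by (simp add: powr_def)
  also have "(p x - p y) * ln s = (p y - p x) * (- ln s)" by (simp add: algebra_simps)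
  also have "\<dots> \<le> (\<bar>p x - c3\<bar> + \<bar>p y - c3\<bar>) * (- ln s)" using s0 s(1) by (intro mult_right_mono) auto
  also have "\<dots> \<le> 4 * c2" using l[OF s(2)] l[OF s(3)] by (simp add: distrib_right)
  finally show ?thesis by simp
qed

end

text \<open>Either \<open>a \<le> s\<close>, or \<open>a = a\<^bsup>q\<^esup> a\<^bsup>1 - q\<^esup>\<close> and the decreasing power \<open>a\<^bsup>1 - q\<^esup>\<close> is at most \<open>s\<^bsup>1 - q\<^esup>\<close>. The parameter
  \<open>s\<close> serves to trade linear quantities for powers with the exponent of another point.\<close>

lemma le_add_powr:
  fixes a s q :: real
  assumes "0 \<le> a" "0 < s" "1 \<le> q"
  shows "a \<le> s + a powr q * s powr (1 - q)"
proof (cases "a \<le> s")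
  case True then show ?thesis by (simp add: add_increasing2)
next
  case False
  then have "a = a powr q * a powr (1 - q)" using assms by (simp add: powr_add[symmetric])
  also have "\<dots> \<le> a powr q * s powr (1 - q)" using False assms by (intro mult_left_mono powr_mono2') auto
  finally show ?thesis using assms by linarith
qed

lemma integrable_square_weight:
  "integrable lebesgue (\<lambda>y::real. 1 / (1 + y\<^sup>2))" "(\<integral>\<^sup>+y. ennreal (1 / (1 + y\<^sup>2)) \<partial>lebesgue) = ennreal pi"
proof -
  have eq: "1 / (1 + y\<^sup>2) = pi * poisson_kernel 1 (0 - y)" for y :: real
    by (simp add: poisson_kernel_def)
  have [measurable]: "(\<lambda>y. poisson_kernel 1 (0 - y)) \<in> borel_measurable lebesgue"
    by (rule borel_measurable_lebesgue_diff) simp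
  have "(\<integral>\<^sup>+y. ennreal (1 / (1 + y\<^sup>2)) \<partial>lebesgue) = (\<integral>\<^sup>+y. ennreal pi * ennreal (poisson_kernel 1 (0 - y)) \<partial>lebesgue)"
    unfolding eq by (intro nn_integral_cong) (simp add: ennreal_mult poisson_kernel_nonneg del: diff_0)
  also have "\<dots> = ennreal pi * (\<integral>\<^sup>+y. ennreal (poisson_kernel 1 (0 - y)) \<partial>lebesgue)"
    by (rule nn_integral_cmult) measurable
  also have "\<dots> = ennreal pi" by (subst nn_integral_poisson) auto
  finally show nn: "(\<integral>\<^sup>+y. ennreal (1 / (1 + y\<^sup>2)) \<partial>lebesgue) = ennreal pi" .
  have "(\<lambda>y::real. 1 / (1 + y\<^sup>2)) \<in> borel_measurable lebesgue" unfolding eq by measurable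
  then show "integrable lebesgue (\<lambda>y::real. 1 / (1 + y\<^sup>2))"
    using nn by (intro integrableI_nonneg) auto
qed

context log_exponent
begin

text \<open>The pointwise estimate behind the boundedness of convolutions. Let \<open>a\<close> be the Poisson integral of \<open>f\<close> at \<open>x\<close>
  and \<open>s = a / 4\<close>. Multiply \<open>f y \<le> s + f(y)\<^bsup>p y\<^esup> s\<^bsup>1 - p y\<^esup>\<close> by \<open>s\<^bsup>p x - 1\<^esup>\<close> and by the kernel, and integrate: the left
  side becomes \<open>4 s\<^bsup>p x\<^esup>\<close>, so that up to three terms \<open>s\<^bsup>p x\<^esup>\<close> on the right can be absorbed, and the last
  factor becomes \<open>s\<^bsup>p x - p y\<^esup>\<close>, which the logarithmic conditions bound.

  If \<open>s \<le> w x\<close> there is nothing to do, since \<open>s\<^bsup>p x\<^esup> \<le> s\<close>. If \<open>w x < s \<le> 1\<close> the decay condition applies, but only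
  for a base that is also at least \<open>w y\<close>; hence the base \<open>max s (w y)\<close>, at the cost of the integral of
  \<open>w\<close>. If \<open>s > 1\<close> then \<open>s \<le> 1 / \<tau>\<close>, because \<open>f \<le> 1 + f\<^bsup>p\<^esup>\<close> and the kernel is at most \<open>1 / (\<pi> \<tau>)\<close>; the
  local condition serves for \<open>|x - y|\<^sup>2 < \<tau>\<close>, while for other \<open>y\<close> the kernel is at most 1 and the
  normalisation of the modular suffices.\<close>

lemma poisson_conv_pointwise:
  assumes \<tau>: "\<tau> > 0" and f [measurable]: "f \<in> borel_measurable lebesgue" and f0: "\<And>y. 0 \<le> f y"
    and f1: "(\<integral>\<^sup>+y. ennreal (f y powr p y) \<partial>lebesgue) \<le> 1"
  defines "k \<equiv> \<lambda>x y. poisson_kernel \<tau> (x - y)" and "w \<equiv> \<lambda>y. 1 / (1 + y\<^sup>2)"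
  shows "integrable lebesgue (\<lambda>y. k x y * f y)"
    and "(\<integral>y. k x y * f y \<partial>lebesgue) powr p x \<le> 4 powr P * (1 + exp (4 * c2) + exp (2 * c1)) *
          ((\<integral>y. k x y * f y powr p y \<partial>lebesgue) + (\<integral>y. k x y * w y \<partial>lebesgue) + w x)"
    and "integrable lebesgue (\<lambda>y. k x y * f y powr p y)" "integrable lebesgue (\<lambda>y. k x y * w y)"
proof -
  define fp where "fp y = f y powr p y" for y
  have fp0: "0 \<le> fp y" for y by (simp add: fp_def)
  have [measurable]: "k x \<in> borel_measurable lebesgue" for x
    unfolding k_def by (rule borel_measurable_lebesgue_diff) simp
  have [measurable]: "fp \<in> borel_measurable lebesgue" unfolding fp_def by measurable
  have k0: "0 \<le> k x y" for y using \<tau> by (simp add: k_def poisson_kernel_nonneg)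
  have kle: "k x y \<le> 1 / (pi * \<tau>)" for y using \<tau> by (simp add: k_def poisson_kernel_le)
  have w01: "0 < w y" "w y \<le> 1" for y
  proof -
    have "0 < 1 + y\<^sup>2" by (simp add: add_pos_nonneg)
    then show "0 < w y" "w y \<le> 1" by (simp_all add: w_def)
  qed
  have int_w: "integrable lebesgue w" unfolding w_def by (rule integrable_square_weight)
  then have [measurable]: "w \<in> borel_measurable lebesgue" by simp
  have int_fp: "integrable lebesgue fp"
    using f1 by (intro integrableI_nonneg) (auto simp: fp_def intro: le_less_trans)
  have I_fp: "(\<integral>y. fp y \<partial>lebesgue) \<le> 1"
    using f1 nn_integral_eq_integral[OF int_fp] fp0 by (simp flip: fp_def)
  have int_k: "integrable lebesgue (k x)"
    using nn_integral_poisson[OF \<tau>, of x] k0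
    by (intro integrableI_nonneg) (auto simp: k_def intro!: borel_measurable_lebesgue_diff)
  have I_k: "(\<integral>y. k x y \<partial>lebesgue) = 1"
    using nn_integral_poisson[OF \<tau>, of x] nn_integral_eq_integral[OF int_k] k0 by (simp add: k_def)
  have int_kfp: "integrable lebesgue (\<lambda>y. k x y * fp y)"
  proof (rule Bochner_Integration.integrable_bound[of _ "\<lambda>y. 1 / (pi * \<tau>) * fp y"])
    have "norm (k x y * fp y) \<le> norm (1 / (pi * \<tau>) * fp y)" for y
      using mult_right_mono[OF kle[of y] fp0[of y]] k0[of y] fp0[of y] \<tau> by (simp add: abs_mult)
    then show "AE y in lebesgue. norm (k x y * fp y) \<le> norm (1 / (pi * \<tau>) * fp y)" by simp
  qed (use int_fp in auto)
  have I_kfp: "(\<integral>y. k x y * fp y \<partial>lebesgue) \<le> 1 / (pi * \<tau>)"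
  proof -
    have "(\<integral>y. k x y * fp y \<partial>lebesgue) \<le> (\<integral>y. 1 / (pi * \<tau>) * fp y \<partial>lebesgue)"
      using kle fp0 int_fp int_kfp by (intro integral_mono integrable_mult_right mult_right_mono) auto
    also have "\<dots> = 1 / (pi * \<tau>) * (\<integral>y. fp y \<partial>lebesgue)" by simp
    also have "\<dots> \<le> 1 / (pi * \<tau>) * 1" using I_fp \<tau> by (intro mult_left_mono) auto
    finally show ?thesis by simp
  qed
  have int_kw: "integrable lebesgue (\<lambda>y. k x y * w y)"
    by (rule Bochner_Integration.integrable_bound[OF int_k])
       (use k0 w01 in \<open>auto simp: abs_mult abs_of_nonneg less_imp_le intro!: mult_left_le\<close>)
  have f_le: "f y \<le> 1 + fp y" for y
    using le_add_powr[of "f y" 1 "p y"] f0 p_ge by (simp add: fp_def)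
  have int_kf: "integrable lebesgue (\<lambda>y. k x y * f y)"
  proof (rule Bochner_Integration.integrable_bound[of _ "\<lambda>y. k x y + k x y * fp y"])
    have "k x y * f y \<le> k x y + k x y * fp y" for y
      using mult_left_mono[OF f_le[of y] k0[of y]] by (simp add: distrib_left)
    then show "AE y in lebesgue. norm (k x y * f y) \<le> norm (k x y + k x y * fp y)"
      using k0 f0 fp0 by (simp add: abs_mult abs_of_nonneg)
  qed (use int_k int_kfp in auto)
  show "integrable lebesgue (\<lambda>y. k x y * f y)" by (rule int_kf)
  show "integrable lebesgue (\<lambda>y. k x y * f y powr p y)" using int_kfp by (simp add: fp_def)
  show "integrable lebesgue (\<lambda>y. k x y * w y)" by (rule int_kw)

  define a m b where "a = (\<integral>y. k x y * f y \<partial>lebesgue)" and "m = (\<integral>y. k x y * fp y \<partial>lebesgue)"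
    and "b = (\<integral>y. k x y * w y \<partial>lebesgue)"
  have abm: "0 \<le> a" "0 \<le> m" "0 \<le> b"
    unfolding a_def m_def b_def using k0 f0 fp0 w01 by (auto intro!: integral_nonneg_AE simp: less_imp_le)
  define C1 C2 where "C1 = exp (4 * c2)" and "C2 = exp (2 * c1)"
  have C: "C1 > 0" "C2 > 0" by (auto simp: C1_def C2_def)
  define s where "s = a / 4"
  have sa: "s powr (p x - 1) * a = 4 * (s * s powr (p x - 1))" by (simp add: s_def)
  have s_bound: "s powr p x \<le> (1 + C1 + C2) * (m + b + w x)"
  proof -
    consider "s \<le> w x" | "w x < s" "s \<le> 1" | "s > 1" by linarith
    then show ?thesis
    proof cases
      case 1
      have "s powr p x \<le> s"
      proof (cases "s = 0")
        case False
        have "s \<le> 1" using 1 w01(2)[of x] by linarith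
        then have "s powr p x \<le> s powr 1" using False abm p_ge by (intro powr_mono') (auto simp: s_def)
        then show ?thesis using False abm by (simp add: s_def)
      qed simp
      also have "\<dots> \<le> 1 * (m + b + w x)" using 1 abm by simp
      also have "\<dots> \<le> (1 + C1 + C2) * (m + b + w x)" using C abm w01 by (intro mult_right_mono) (auto simp: less_imp_le)
      finally show ?thesis .
    next
      case 2
      then have s0: "s > 0" using w01(1)[of x] by linarith
      have sp: "s powr p x = s * s powr (p x - 1)" using s0 by (simp add: powr_mult_base)
      have sp1: "s powr (p x - 1) \<le> 1" using s0 2 p_ge[of x] by (intro powr_le1) auto
      have "s powr (p x - 1) * f y \<le> s powr p x + w y + C1 * fp y" for y
      proof -
        \<comment> \<open>The least base to which the decay condition applies at both points.\<close>
        define t where "t = max s (w y)"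
        have t: "t > 0" "t \<le> 1" "s \<le> t" "w y \<le> t" "t \<le> s + w y" using s0 2 w01[of y] by (auto simp: t_def)
        have "s powr (p x - 1) * t powr (1 - p y) \<le> t powr (p x - 1) * t powr (1 - p y)"
          using t s0 p_ge by (intro mult_right_mono powr_mono2) auto
        also have "\<dots> = t powr (p x - p y)" by (simp add: powr_add[symmetric])
        also have "\<dots> \<le> C1" unfolding C1_def
          using t 2 by (intro powr_exponent_decay) (auto simp: w_def)
        finally have c: "s powr (p x - 1) * t powr (1 - p y) \<le> C1" .
        have "s powr (p x - 1) * t \<le> s powr (p x - 1) * s + s powr (p x - 1) * w y"
          using t by (simp add: distrib_left[symmetric] mult_left_mono)
        also have "\<dots> \<le> s powr p x + w y"
          using sp1 w01[of y] by (simp add: sp mult.commute mult_left_le less_imp_le)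
        finally have d: "s powr (p x - 1) * t \<le> s powr p x + w y" .
        have "s powr (p x - 1) * f y \<le> s powr (p x - 1) * (t + fp y * t powr (1 - p y))"
          unfolding fp_def using f0 t p_ge by (intro mult_left_mono le_add_powr) auto
        also have "\<dots> = s powr (p x - 1) * t + (s powr (p x - 1) * t powr (1 - p y)) * fp y" by (simp add: algebra_simps)
        also have "\<dots> \<le> (s powr p x + w y) + C1 * fp y"
          using c d fp0 by (intro add_mono mult_right_mono) auto
        finally show ?thesis .
      qed
      note pt = this
      have "s powr (p x - 1) * a = (\<integral>y. k x y * (s powr (p x - 1) * f y) \<partial>lebesgue)"
        unfolding a_def by (subst integral_mult_right_zero[symmetric]) (simp add: mult_ac)
      also have "\<dots> \<le> (\<integral>y. k x y * s powr p x + k x y * w y + C1 * (k x y * fp y) \<partial>lebesgue)"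
      proof (rule integral_mono)
        show "integrable lebesgue (\<lambda>y. k x y * (s powr (p x - 1) * f y))"
          using integrable_mult_right[OF int_kf, of "s powr (p x - 1)"] by (simp add: mult.left_commute)
        show "k x y * (s powr (p x - 1) * f y) \<le> k x y * s powr p x + k x y * w y + C1 * (k x y * fp y)" for y
          using mult_left_mono[OF pt[of y] k0[of y]] by (simp add: algebra_simps)
      qed (use int_k int_kw int_kfp in auto)
      also have "\<dots> = s powr p x + b + C1 * m"
        using int_k int_kw int_kfp I_k by (simp add: b_def m_def)
      finally have "3 * s powr p x \<le> b + C1 * m" using sa sp by linarith
      moreover have "0 \<le> s powr p x" by simp
      ultimately have "s powr p x \<le> b + C1 * m" by linarith
      also have "\<dots> \<le> (1 + C1 + C2) * (m + b + w x)"
        using abm C w01[of x] by (simp add: distrib_left distrib_right add_increasing add_increasing2)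
      finally show ?thesis .
    next
      case 3
      have sp: "s powr p x = s * s powr (p x - 1)" using 3 by (simp add: powr_mult_base)
      have "a \<le> (\<integral>y. k x y + k x y * fp y \<partial>lebesgue)"
        unfolding a_def using int_kf int_k int_kfp mult_left_mono[OF f_le k0]
        by (intro integral_mono) (auto simp: distrib_left)
      also have "\<dots> = 1 + m" using int_k int_kfp I_k by (simp add: m_def)
      finally have "4 * s \<le> 1 + 1 / (pi * \<tau>)" using I_kfp by (simp add: m_def s_def)
      moreover have "1 / (pi * \<tau>) \<le> 1 / \<tau>" using \<tau> pi_ge_two by (intro divide_left_mono) auto
      ultimately have s\<tau>: "s \<le> 1 / \<tau>" using 3 by linarith
      have pt: "k x y * (s powr (p x - 1) * f y) \<le> k x y * s powr p x + C2 * (k x y * fp y) + s powr (p x - 1) * fp y"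
        for y
      proof -
        have "s powr (p x - 1) * f y \<le> s powr (p x - 1) * (s + fp y * s powr (1 - p y))"
          unfolding fp_def using f0 3 p_ge by (intro mult_left_mono le_add_powr) auto
        then have *: "k x y * (s powr (p x - 1) * f y) \<le> k x y * (s powr (p x - 1) * (s + fp y * s powr (1 - p y)))"
          using k0[of y] by (rule mult_left_mono)
        show ?thesis
        proof (cases "(x - y)\<^sup>2 < \<tau>")
          case True
          have "s powr (p x - 1) * s powr (1 - p y) = s powr (p x - p y)" by (simp add: powr_add[symmetric])
          also have "\<dots> \<le> C2" unfolding C2_def using 3 s\<tau> \<tau> True by (intro powr_exponent_local) auto
          finally have "(k x y * fp y) * (s powr (p x - 1) * s powr (1 - p y)) \<le> (k x y * fp y) * C2"
            using k0 fp0 by (intro mult_left_mono) auto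
          moreover have "0 \<le> s powr (p x - 1) * fp y" using fp0 by simp
          ultimately show ?thesis using * by (simp add: sp algebra_simps)
        next
          case False
          have "k x y \<le> \<tau> / (pi * \<tau>)"
            unfolding k_def poisson_kernel_def using \<tau> False
            by (intro divide_left_mono mult_left_mono mult_pos_pos) (auto intro: add_pos_nonneg add_increasing)
          also have "\<dots> \<le> 1" using \<tau> pi_ge_two by simp
          finally have k1: "k x y \<le> 1" .
          have s1: "s powr (1 - p y) \<le> 1" using 3 p_ge[of y] powr_mono[of "1 - p y" 0 s] by simp
          have "k x y * s powr (1 - p y) \<le> 1 * 1" using k0 k1 s1 by (intro mult_mono) auto
          then have "(s powr (p x - 1) * fp y) * (k x y * s powr (1 - p y)) \<le> (s powr (p x - 1) * fp y) * 1"
            using fp0 by (intro mult_left_mono) auto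
          moreover have "0 \<le> C2 * (k x y * fp y)" using C k0 fp0 by simp
          ultimately show ?thesis using * by (simp add: sp algebra_simps)
        qed
      qed
      have "s powr (p x - 1) * a = (\<integral>y. k x y * (s powr (p x - 1) * f y) \<partial>lebesgue)"
        unfolding a_def by (subst integral_mult_right_zero[symmetric]) (simp add: mult_ac)
      also have "\<dots> \<le> (\<integral>y. k x y * s powr p x + C2 * (k x y * fp y) + s powr (p x - 1) * fp y \<partial>lebesgue)"
      proof (rule integral_mono)
        show "integrable lebesgue (\<lambda>y. k x y * (s powr (p x - 1) * f y))"
          using integrable_mult_right[OF int_kf, of "s powr (p x - 1)"] by (simp add: mult.left_commute)
      qed (use int_k int_fp int_kfp pt in auto)
      also have "\<dots> = s powr p x + C2 * m + s powr (p x - 1) * (\<integral>y. fp y \<partial>lebesgue)"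
        using int_k int_fp int_kfp I_k by (simp add: m_def)
      also have "\<dots> \<le> s powr p x + C2 * m + s powr (p x - 1) * s"
        using I_fp 3 by (intro add_left_mono mult_left_mono) auto
      finally have "2 * s powr p x \<le> C2 * m" using sa sp mult.commute[of s "s powr (p x - 1)"] by linarith
      moreover have "0 \<le> s powr p x" by simp
      ultimately have "s powr p x \<le> C2 * m" by linarith
      also have "\<dots> \<le> (1 + C1 + C2) * (m + b + w x)"
        using abm C w01[of x] by (simp add: distrib_left distrib_right add_increasing add_increasing2)
      finally show ?thesis .
    qed
  qed
  have "a powr p x = 4 powr p x * s powr p x" unfolding s_def using abm by (simp add: powr_mult[symmetric])
  also have "\<dots> \<le> 4 powr P * ((1 + C1 + C2) * (m + b + w x))"
    using s_bound p_le by (intro mult_mono powr_mono) auto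
  finally show "(\<integral>y. k x y * f y \<partial>lebesgue) powr p x \<le> 4 powr P * (1 + exp (4 * c2) + exp (2 * c1)) *
          ((\<integral>y. k x y * f y powr p y \<partial>lebesgue) + (\<integral>y. k x y * w y \<partial>lebesgue) + w x)"
    unfolding a_def m_def b_def fp_def C1_def C2_def by (simp add: mult.assoc)
qed

definition conv_modular_bound :: real where
  "conv_modular_bound = 4 powr P * (1 + exp (4 * c2) + exp (2 * c1)) * (1 + 2 * pi)"

lemma conv_modular_bound_ge: "1 \<le> conv_modular_bound"
proof -
  have "1 \<le> P" using p_ge[of 0] p_le[of 0] by linarith
  then have "1 \<le> (4::real) powr P" by (intro ge_one_powr_ge_zero) auto
  moreover have "1 \<le> 1 + exp (4 * c2) + exp (2 * c1)" by (simp add: add_nonneg_nonneg)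
  moreover have "1 \<le> 1 + 2 * pi" using pi_ge_zero by simp
  ultimately show ?thesis
    unfolding conv_modular_bound_def
    using mult_mono[of 1 "4 powr P" 1 "1 + exp (4 * c2) + exp (2 * c1)"] mult_mono[of 1 "4 powr P * (1 + exp (4 * c2) + exp (2 * c1))" 1 "1 + 2 * pi"]
    by simp
qed

text \<open>Integrate the pointwise estimate. The Poisson kernel preserves integrals, so its three terms contribute at
  most 1, \<open>\<pi>\<close> and \<open>\<pi>\<close>.\<close>

lemma poisson_conv_modular:
  assumes \<tau>: "\<tau> > 0" and f [measurable]: "f \<in> borel_measurable lebesgue" and f0: "\<And>y. 0 \<le> f y"
    and f1: "(\<integral>\<^sup>+y. ennreal (f y powr p y) \<partial>lebesgue) \<le> 1"
  shows "(\<integral>\<^sup>+x. ennreal ((\<integral>y. poisson_kernel \<tau> (x - y) * f y \<partial>lebesgue) powr p x) \<partial>lebesgue) \<le> ennreal conv_modular_bound"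
proof -
  define K where "K = 4 powr P * (1 + exp (4 * c2) + exp (2 * c1))"
  have K: "K \<ge> 0" by (simp add: K_def add_nonneg_nonneg)
  define k where "k x y = poisson_kernel \<tau> (x - y)" for x y
  define w where "w y = 1 / (1 + y\<^sup>2)" for y :: real
  have w0: "0 \<le> w y" for y by (simp add: w_def)
  have k0: "0 \<le> k x y" for x y using \<tau> by (simp add: k_def poisson_kernel_nonneg)
  have wm [measurable]: "w \<in> borel_measurable lebesgue" using integrable_square_weight(1) by (auto simp: w_def[abs_def])
  have I: "ennreal (\<integral>y. k x y * g y \<partial>lebesgue) = (\<integral>\<^sup>+y. ennreal (poisson_kernel \<tau> (x - y)) * ennreal (g y) \<partial>lebesgue)"
    if "integrable lebesgue (\<lambda>y. k x y * g y)" "\<And>y. 0 \<le> g y" for g x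
    using nn_integral_eq_integral[OF that(1)] that(2) k0 \<tau> by (simp add: ennreal_mult k_def poisson_kernel_nonneg)
  define M B where "M x = (\<integral>\<^sup>+y. ennreal (poisson_kernel \<tau> (x - y)) * ennreal (f y powr p y) \<partial>lebesgue)"
    and "B x = (\<integral>\<^sup>+y. ennreal (poisson_kernel \<tau> (x - y)) * ennreal (w y) \<partial>lebesgue)" for x
  have pm: "(\<lambda>(x, y). poisson_kernel \<tau> (x - y)) \<in> borel_measurable (lebesgue \<Otimes>\<^sub>M lebesgue)"
    by (rule borel_measurable_lebesgue_diff) simp
  have [measurable]: "M \<in> borel_measurable lebesgue" "B \<in> borel_measurable lebesgue"
    unfolding M_def B_def using pm by measurable
  have "(\<integral>\<^sup>+x. ennreal ((\<integral>y. poisson_kernel \<tau> (x - y) * f y \<partial>lebesgue) powr p x) \<partial>lebesgue)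
     \<le> (\<integral>\<^sup>+x. ennreal K * (M x + B x + ennreal (w x)) \<partial>lebesgue)"
  proof (rule nn_integral_mono)
    fix x
    note pt = poisson_conv_pointwise[OF \<tau> f f0 f1, where x = x]
    have "ennreal ((\<integral>y. poisson_kernel \<tau> (x - y) * f y \<partial>lebesgue) powr p x)
      \<le> ennreal (K * ((\<integral>y. k x y * f y powr p y \<partial>lebesgue) + (\<integral>y. k x y * w y \<partial>lebesgue) + w x))"
      using pt(2) by (intro ennreal_leI) (simp add: k_def w_def K_def)
    also have "\<dots> = ennreal K * (ennreal (\<integral>y. k x y * f y powr p y \<partial>lebesgue) + ennreal (\<integral>y. k x y * w y \<partial>lebesgue) + ennreal (w x))"
      using K k0 w0 by (simp add: ennreal_mult ennreal_plus integral_nonneg_AE add_nonneg_nonneg)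
    also have "\<dots> = ennreal K * (M x + B x + ennreal (w x))"
      using pt(3,4) w0 by (subst I, simp add: k_def, simp, subst I, simp add: k_def w_def, simp) (simp add: M_def B_def)
    finally show "ennreal ((\<integral>y. poisson_kernel \<tau> (x - y) * f y \<partial>lebesgue) powr p x) \<le> ennreal K * (M x + B x + ennreal (w x))" .
  qed
  also have "\<dots> = ennreal K * ((\<integral>\<^sup>+x. M x \<partial>lebesgue) + (\<integral>\<^sup>+x. B x \<partial>lebesgue) + (\<integral>\<^sup>+x. ennreal (w x) \<partial>lebesgue))"
    by (simp add: nn_integral_cmult nn_integral_add)
  also have "(\<integral>\<^sup>+x. M x \<partial>lebesgue) = (\<integral>\<^sup>+y. ennreal (f y powr p y) \<partial>lebesgue)"
    unfolding M_def by (rule nn_integral_poisson_conv[OF \<tau>]) measurable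
  also have "(\<integral>\<^sup>+x. B x \<partial>lebesgue) = (\<integral>\<^sup>+y. ennreal (w y) \<partial>lebesgue)"
    unfolding B_def by (rule nn_integral_poisson_conv[OF \<tau>]) measurable
  also have "(\<integral>\<^sup>+y. ennreal (w y) \<partial>lebesgue) = ennreal pi"
    unfolding w_def by (rule integrable_square_weight)
  also have "ennreal K * ((\<integral>\<^sup>+y. ennreal (f y powr p y) \<partial>lebesgue) + ennreal pi + ennreal pi) \<le> ennreal K * (ennreal 1 + ennreal pi + ennreal pi)"
    using f1 by (intro mult_left_mono add_mono) auto
  also have "\<dots> = ennreal conv_modular_bound"
    using K by (subst ennreal_plus[symmetric], simp, simp, subst ennreal_plus[symmetric], simp, simp, subst ennreal_mult[symmetric])
      (auto simp: conv_modular_bound_def K_def algebra_simps)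
  finally show ?thesis .
qed

definition conv_norm_bound :: real where "conv_norm_bound = 2 * conv_modular_bound"

lemma conv_norm_bound_pos: "0 < conv_norm_bound"
  using conv_modular_bound_ge by (simp add: conv_norm_bound_def)

end

definition conv :: "(real \<Rightarrow> complex) \<Rightarrow> (real \<Rightarrow> complex) \<Rightarrow> real \<Rightarrow> complex" where
  "conv K h x = (\<integral>t. K (x - t) * h t \<partial>lebesgue)"

lemma measurable_conv:
  assumes K: "K \<in> borel_measurable borel" and [measurable]: "h \<in> borel_measurable lebesgue"
  shows "conv K h \<in> borel_measurable lebesgue"
proof -
  have [measurable]: "(\<lambda>(x, y). K (x - y)) \<in> borel_measurable (lebesgue \<Otimes>\<^sub>M lebesgue)"
    by (rule borel_measurable_lebesgue_diff) fact
  show ?thesis unfolding conv_def[abs_def] by measurable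
qed

context log_exponent
begin

lemma LvarE:
  assumes "h \<in> Lvar p"
  obtains \<eta> where "\<eta> > 0" "modular p (\<lambda>y. h y / of_real \<eta>) < 1" "h \<in> borel_measurable lebesgue"
proof -
  have h: "h \<in> borel_measurable lebesgue" using assms by (simp add: Lvar_def)
  have "Lnorm p h < \<infinity>" using Lnorm_finite_iff[OF p_ge p_measurable h] assms by simp
  then show thesis using h that by (auto elim!: Lnorm_lessE)
qed

lemma poisson_conv_integrable:
  assumes \<tau>: "\<tau> > 0" and h: "h \<in> Lvar p"
  shows "integrable lebesgue (\<lambda>t. poisson_kernel \<tau> (x - t) * cmod (h t))"
proof -
  obtain \<eta> where \<eta>: "\<eta> > 0" "modular p (\<lambda>y. h y / of_real \<eta>) < 1" "h \<in> borel_measurable lebesgue"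
    using h by (rule LvarE)
  have "integrable lebesgue (\<lambda>t. poisson_kernel \<tau> (x - t) * cmod (h t / of_real \<eta>))"
    using \<eta> by (intro poisson_conv_pointwise(1)[OF \<tau>]) (auto simp: modular_def less_imp_le)
  then have "integrable lebesgue (\<lambda>t. \<eta> * (poisson_kernel \<tau> (x - t) * cmod (h t / of_real \<eta>)))"
    by (rule integrable_mult_right)
  then show ?thesis using \<eta> by (simp add: norm_divide)
qed

text \<open>After division by nearly its norm, \<open>h\<close> has modular at most 1; then \<open>|K * h|\<close> lies below a multiple of the
  Poisson integral of \<open>|h|\<close>, whose modular is bounded independently of \<open>\<tau>\<close>.\<close>

lemma Lnorm_conv_le:
  assumes \<tau>: "\<tau> > 0" and A: "A > 0" and K [measurable]: "K \<in> borel_measurable borel"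
    and K_le: "\<And>w. cmod (K w) \<le> A * poisson_kernel \<tau> w" and h [measurable]: "h \<in> borel_measurable lebesgue"
  shows "Lnorm p (conv K h) \<le> ennreal (conv_norm_bound * A) * Lnorm p h"
proof (rule ennreal_le_epsilon)
  fix e :: real assume fin: "ennreal (conv_norm_bound * A) * Lnorm p h < top" and e: "e > 0"
  define c where "c = conv_norm_bound * A"
  have c: "c > 0" using A conv_norm_bound_pos by (simp add: c_def)
  from fin c have "Lnorm p h < top" by (auto simp: ennreal_mult_eq_top_iff less_top[symmetric] c_def)
  then have "Lnorm p h < Lnorm p h + ennreal (e / c)"
    using e c by (cases "Lnorm p h") (auto simp: ennreal_plus[symmetric] ennreal_less_iff simp del: ennreal_plus)
  then obtain \<eta> where \<eta>: "\<eta> > 0" "modular p (\<lambda>y. h y / of_real \<eta>) < 1" "ennreal \<eta> < Lnorm p h + ennreal (e / c)"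
    by (rule Lnorm_lessE)
  have f1: "(\<integral>\<^sup>+y. ennreal (cmod (h y / of_real \<eta>) powr p y) \<partial>lebesgue) \<le> 1"
    using \<eta> by (simp add: modular_def less_imp_le)
  have fm: "(\<lambda>y. cmod (h y / of_real \<eta>)) \<in> borel_measurable lebesgue" by measurable
  define a where "a x = (\<integral>y. poisson_kernel \<tau> (x - y) * cmod (h y / of_real \<eta>) \<partial>lebesgue)" for x
  have pt: "cmod (conv K h x / of_real (A * \<eta>)) \<le> a x" for x
  proof -
    have int: "integrable lebesgue (\<lambda>y. poisson_kernel \<tau> (x - y) * cmod (h y / of_real \<eta>))"
      by (rule poisson_conv_pointwise(1)[OF \<tau> fm _ f1]) simp
    have "cmod (conv K h x) \<le> (\<integral>t. cmod (K (x - t) * h t) \<partial>lebesgue)" unfolding conv_def by (rule integral_norm_bound)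
    also have "\<dots> \<le> (\<integral>y. (A * \<eta>) * (poisson_kernel \<tau> (x - y) * cmod (h y / of_real \<eta>)) \<partial>lebesgue)"
    proof (rule integral_mono')
      show "cmod (K (x - t) * h t) \<le> (A * \<eta>) * (poisson_kernel \<tau> (x - t) * cmod (h t / of_real \<eta>))" for t
        using mult_right_mono[OF K_le[of "x - t"], of "cmod (h t)"] \<eta> by (simp add: norm_mult norm_divide mult.assoc)
    qed (use int \<eta> A \<tau> in \<open>auto simp: poisson_kernel_nonneg\<close>)
    also have "\<dots> = (A * \<eta>) * a x" by (simp add: a_def)
    finally show ?thesis using A \<eta> by (simp add: norm_divide norm_mult divide_simps mult_ac)
  qed
  have "modular p (\<lambda>x. conv K h x / of_real (A * \<eta>)) \<le> (\<integral>\<^sup>+x. ennreal (a x powr p x) \<partial>lebesgue)"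
    unfolding modular_def
      using pt p_ge by (intro nn_integral_mono ennreal_leI powr_mono2) (auto intro: order_trans[OF zero_le_one])
  also have "\<dots> \<le> ennreal conv_modular_bound"
    unfolding a_def by (rule poisson_conv_modular[OF \<tau> fm _ f1]) simp
  finally have "Lnorm p (conv K h) \<le> ennreal (2 * conv_modular_bound * (A * \<eta>))"
    using A \<eta> conv_modular_bound_ge by (intro Lnorm_le_of_modular p_ge p_measurable measurable_conv K h) auto
  also have "\<dots> = ennreal c * ennreal \<eta>" using c \<eta> A conv_norm_bound_pos
    by (simp add: ennreal_mult[symmetric] c_def conv_norm_bound_def mult_ac)
  also have "\<dots> \<le> ennreal c * (Lnorm p h + ennreal (e / c))" using \<eta> by (intro mult_left_mono) auto
  also have "\<dots> = ennreal c * Lnorm p h + ennreal e"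
    using c e by (simp add: distrib_left ennreal_mult[symmetric])
  finally show "Lnorm p (conv K h) \<le> ennreal (conv_norm_bound * A) * Lnorm p h + ennreal e" unfolding c_def .
qed

end

section \<open>Entire functions and the Fourier integral\<close>

lemma integrable_square_weight_lborel: "integrable lborel (\<lambda>y::real. 1 / (1 + y\<^sup>2))"
  using integrable_square_weight(1) by (subst (asm) integrable_completion) simp_all

lemma square_weight_dominates:
  fixes t :: real
  assumes "2 \<le> n" shows "1 / (1 + \<bar>t\<bar>) ^ n \<le> 1 / (1 + t\<^sup>2)"
proof -
  have "1 + t\<^sup>2 \<le> (1 + \<bar>t\<bar>)\<^sup>2" by (simp add: power2_sum)
  also have "\<dots> \<le> (1 + \<bar>t\<bar>) ^ n" using assms by (intro power_increasing) auto
  finally show ?thesis by (intro frac_le) (auto simp: add_pos_nonneg)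
qed

lemma integrable_lborel_decay:
  fixes f :: "real \<Rightarrow> complex"
  assumes "f \<in> borel_measurable borel" "\<And>t. cmod (f t) \<le> C / (1 + \<bar>t\<bar>) ^ n" "2 \<le> n"
  shows "integrable lborel f"
proof (rule Bochner_Integration.integrable_bound[of _ "\<lambda>y. \<bar>C\<bar> * (1 / (1 + y\<^sup>2))"])
  have "cmod (f t) \<le> norm (\<bar>C\<bar> * (1 / (1 + t\<^sup>2)))" for t
  proof -
    have "cmod (f t) \<le> \<bar>C\<bar> * (1 / (1 + \<bar>t\<bar>) ^ n)"
      using assms(2)[of t] by (rule order_trans) (auto intro!: divide_right_mono)
    also have "\<dots> \<le> \<bar>C\<bar> * (1 / (1 + t\<^sup>2))"
      using square_weight_dominates[OF assms(3), of t] by (intro mult_left_mono) auto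
    finally show ?thesis by (simp add: abs_mult)
  qed
  then show "AE t in lborel. norm (f t) \<le> norm (\<bar>C\<bar> * (1 / (1 + t\<^sup>2)))" by simp
  show "integrable lborel (\<lambda>y::real. \<bar>C\<bar> * (1 / (1 + y\<^sup>2)))"
    by (intro integrable_mult_right integrable_square_weight_lborel)
qed (use assms in auto)

lemma holomorphic_on_UNIV_measurable:
  assumes "q holomorphic_on UNIV" shows "(\<lambda>t::real. q (of_real t)) \<in> borel_measurable borel"
  using holomorphic_on_imp_continuous_on[OF assms]
  by (intro borel_measurable_continuous_onI continuous_on_compose2[of UNIV q UNIV of_real] continuous_intros) auto

lemma has_vector_derivative_of_real_comp:
  assumes "(f has_field_derivative d) (at (of_real x))"
  shows "((\<lambda>t. f (of_real t)) has_vector_derivative d) (at x)"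
  using field_vector_diff_chain_at[of of_real 1 x f d] assms
    bounded_linear.has_vector_derivative[OF bounded_linear_of_real has_vector_derivative_id, of "at x"]
  by (simp add: o_def)

lemma has_vector_derivative_of_entire:
  assumes "f holomorphic_on UNIV"
  shows "((\<lambda>t. f (of_real t)) has_vector_derivative deriv f (of_real x)) (at x)"
  using holomorphic_derivI[OF assms, of "of_real x"] by (intro has_vector_derivative_of_real_comp) simp

text \<open>The factor \<open>e\<^bsup>i b z\<^esup>\<close> cancels the growth of \<open>q\<close> in the upper half-plane, so the integrand is \<open>O(|z|\<^bsup>-2\<^esup>)\<close> there and the
  path of integration can be pushed to infinity. In terms of a primitive \<open>P\<close>: the increment of \<open>P\<close> over
  \<open>[-n, n]\<close> is also its increment along the other three sides of a rectangle, each at distance at least \<open>n\<close>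
  from the origin.\<close>

lemma entire_fourier_integral_zero:
  assumes hol: "q holomorphic_on UNIV" and b: "0 \<le> b"
    and bd: "\<And>z. cmod (q z) \<le> C * exp (b * \<bar>Im z\<bar>) / (1 + cmod z)\<^sup>2"
  shows "integrable lborel (\<lambda>t::real. q (of_real t) * exp (\<i> * of_real (b * t)))"
    and "(\<integral>t. q (of_real t) * exp (\<i> * of_real (b * t)) \<partial>lborel) = 0"
proof -
  define F where "F t = q (of_real t) * exp (\<i> * of_real (b * t))" for t :: real
  define G where "G z = q z * exp (\<i> * of_real b * z)" for z
  have holG: "G holomorphic_on UNIV" unfolding G_def using hol by (intro holomorphic_intros)
  have FG: "F t = G (of_real t)" for t by (simp add: F_def G_def mult.assoc)
  have C: "C \<ge> 0" using order_trans[OF norm_ge_zero bd[of 0]] by simp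
  have bF: "cmod (F t) \<le> C / (1 + \<bar>t\<bar>) ^ 2" for t
    using bd[of "of_real t"] by (simp add: F_def norm_mult)
  have Fm: "F \<in> borel_measurable borel" unfolding FG[abs_def] by (rule holomorphic_on_UNIV_measurable[OF holG])
  have int: "integrable lborel F" by (rule integrable_lborel_decay[OF Fm bF]) simp
  obtain P where P: "\<And>z. (P has_field_derivative G z) (at z)"
    using holomorphic_convex_primitive'[of UNIV G] holG by auto
  have contG: "continuous_on UNIV G" using holG by (rule holomorphic_on_imp_continuous_on)
  have val: "(\<integral>t. indicator {-real n..real n} t *\<^sub>R F t \<partial>lborel) = P (of_nat n) - P (- of_nat n)" for n
  proof -
    have "(\<integral>t. indicator {-real n..real n} t *\<^sub>R F t \<partial>lborel) = P (of_real (real n)) - P (of_real (- real n))"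
    proof (rule integral_FTC_atLeastAtMost)
      show "((\<lambda>t. P (of_real t)) has_vector_derivative F x) (at x within {-real n..real n})" for x
        unfolding FG by (rule has_vector_derivative_at_within[OF has_vector_derivative_of_real_comp[OF P]])
      show "continuous_on {-real n..real n} F"
        unfolding FG[abs_def] by (intro continuous_on_compose2[OF contG] continuous_intros) auto
    qed simp
    then show ?thesis by simp
  qed
  have seg: "cmod (P u - P v) \<le> C / (1 + real n)\<^sup>2 * cmod (u - v)"
    if "\<And>z. z \<in> closed_segment u v \<Longrightarrow> real n \<le> cmod z \<and> 0 \<le> Im z" for u v n
  proof (rule field_differentiable_bound[of "closed_segment u v" P G])
    fix z assume z: "z \<in> closed_segment u v"
    show "(P has_field_derivative G z) (at z within closed_segment u v)"
      by (rule has_field_derivative_at_within[OF P])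
    have "cmod (G z) = cmod (q z) * exp (- (b * Im z))" by (simp add: G_def norm_mult)
    also have "\<dots> \<le> (C * exp (b * \<bar>Im z\<bar>) / (1 + cmod z)\<^sup>2) * exp (- (b * Im z))"
      by (intro mult_right_mono bd) simp
    also have "\<dots> = C / (1 + cmod z)\<^sup>2" using that[OF z] by (simp add: exp_minus field_simps)
    also have "\<dots> \<le> C / (1 + real n)\<^sup>2"
      using that[OF z] C by (intro divide_left_mono power_mono mult_pos_pos zero_less_power) (auto simp: add_pos_nonneg)
    finally show "cmod (G z) \<le> C / (1 + real n)\<^sup>2" .
  qed auto
  have far: "real n \<le> cmod z \<and> 0 \<le> Im z"
    if "(Re z = real n \<or> Re z = - real n \<or> Im z = real n) \<and> 0 \<le> Im z" for z n
    using that abs_Re_le_cmod[of z] abs_Im_le_cmod[of z] by auto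
  have small: "cmod (P (of_nat n) - P (- of_nat n)) \<le> 4 * C / (1 + real n)" for n
  proof -
    define u v where "u = Complex (real n) (real n)" and "v = Complex (- real n) (real n)"
    have n: "of_nat n = Complex (real n) 0" "- of_nat n = Complex (- real n) 0" by (auto simp: complex_eq_iff)
    have 1: "cmod (P (of_nat n) - P u) \<le> C / (1 + real n)\<^sup>2 * cmod (of_nat n - u)"
    proof (rule seg, rule far)
      fix z assume "z \<in> closed_segment (of_nat n) u"
      then obtain c where c: "0 \<le> c" "c \<le> 1" "z = (1 - c) *\<^sub>R of_nat n + c *\<^sub>R u" by (auto simp: closed_segment_def)
      have "Re z = real n" "Im z = c * real n" unfolding c(3) by (simp_all add: n u_def left_diff_distrib)
      then show "(Re z = real n \<or> Re z = - real n \<or> Im z = real n) \<and> 0 \<le> Im z" using c(1,2) by simp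
    qed
    have 2: "cmod (P u - P v) \<le> C / (1 + real n)\<^sup>2 * cmod (u - v)"
    proof (rule seg, rule far)
      fix z assume "z \<in> closed_segment u v"
      then obtain c where c: "0 \<le> c" "c \<le> 1" "z = (1 - c) *\<^sub>R u + c *\<^sub>R v" by (auto simp: closed_segment_def)
      have "Im z = real n" unfolding c(3) by (simp_all add: u_def v_def left_diff_distrib)
      then show "(Re z = real n \<or> Re z = - real n \<or> Im z = real n) \<and> 0 \<le> Im z" using c(1,2) by simp
    qed
    have 3: "cmod (P v - P (- of_nat n)) \<le> C / (1 + real n)\<^sup>2 * cmod (v - (- of_nat n))"
    proof (rule seg, rule far)
      fix z assume "z \<in> closed_segment v (- of_nat n)"
      then obtain c where c: "0 \<le> c" "c \<le> 1" "z = (1 - c) *\<^sub>R v + c *\<^sub>R (- of_nat n)" by (auto simp: closed_segment_def)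
      have "Re z = - real n" "Im z = (1 - c) * real n" unfolding c(3) by (simp_all add: n v_def left_diff_distrib)
      then show "(Re z = real n \<or> Re z = - real n \<or> Im z = real n) \<and> 0 \<le> Im z" using c(1,2) by simp
    qed
    have l: "cmod (of_nat n - u) = real n" "cmod (u - v) = 2 * real n" "cmod (v - (- of_nat n)) = real n"
    proof -
      have "of_nat n - u = - \<i> * of_real (real n)" "u - v = of_real (2 * real n)" "v - (- of_nat n) = \<i> * of_real (real n)"
        by (auto simp: n u_def v_def complex_eq_iff)
      then show "cmod (of_nat n - u) = real n" "cmod (u - v) = 2 * real n" "cmod (v - (- of_nat n)) = real n"
        by (simp_all add: norm_mult)
    qed
    have "cmod (P (of_nat n) - P (- of_nat n)) \<le> cmod (P (of_nat n) - P u) + cmod (P u - P v) + cmod (P v - P (- of_nat n))"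
      using norm_triangle_ineq[of "P (of_nat n) - P u + (P u - P v)" "P v - P (- of_nat n)"]
        norm_triangle_ineq[of "P (of_nat n) - P u" "P u - P v"] by simp
    also have "\<dots> \<le> C / (1 + real n)\<^sup>2 * (4 * real n)"
    proof -
      define D where "D = C / (1 + real n)\<^sup>2 * real n"
      have "C / (1 + real n)\<^sup>2 * (2 * real n) = 2 * D" "C / (1 + real n)\<^sup>2 * (4 * real n) = 4 * D"
        by (simp_all add: D_def)
      with 1 2 3 show ?thesis unfolding l D_def[symmetric] by linarith
    qed
    also have "\<dots> \<le> C / (1 + real n)\<^sup>2 * (4 * (1 + real n))" using C by (intro mult_left_mono) auto
    also have "\<dots> = 4 * C / (1 + real n)" by (simp add: power2_eq_square divide_simps)
    finally show ?thesis .
  qed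
  have lim1: "(\<lambda>n. \<integral>t. indicator {-real n..real n} t *\<^sub>R F t \<partial>lborel) \<longlonglongrightarrow> (\<integral>t. F t \<partial>lborel)"
  proof (rule integral_dominated_convergence[where w = "\<lambda>t. cmod (F t)"])
    show "AE t in lborel. (\<lambda>n. indicator {-real n..real n} t *\<^sub>R F t) \<longlonglongrightarrow> F t"
    proof (intro AE_I2 tendsto_eventually)
      fix t :: real
      obtain N where "\<bar>t\<bar> \<le> real N" using real_arch_simple by blast
      then show "\<forall>\<^sub>F n in sequentially. indicator {-real n..real n} t *\<^sub>R F t = F t"
        by (intro eventually_sequentiallyI[of N]) (auto simp: indicator_def)
    qed
  qed (use int Fm in \<open>auto simp: indicator_def\<close>)
  have "(\<lambda>n. 4 * C / (1 + real n)) \<longlonglongrightarrow> 0" by real_asymp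
  then have "(\<lambda>n. P (of_nat n) - P (- of_nat n)) \<longlonglongrightarrow> 0"
    by (rule Lim_null_comparison[rotated]) (use small in auto)
  with lim1 have "(\<integral>t. F t \<partial>lborel) = 0" unfolding val by (rule LIMSEQ_unique)
  with int show "integrable lborel (\<lambda>t::real. q (of_real t) * exp (\<i> * of_real (b * t)))"
    "(\<integral>t. q (of_real t) * exp (\<i> * of_real (b * t)) \<partial>lborel) = 0"
    by (simp_all add: F_def[abs_def])
qed

subsection \<open>The cardinal sine\<close>

definition csinc :: "complex \<Rightarrow> complex" where
  "csinc z = (if z = 0 then 1 else sin z / z)"

lemma csinc_holomorphic [holomorphic_intros]: "f holomorphic_on A \<Longrightarrow> (\<lambda>z. csinc (f z)) holomorphic_on A"
proof -
  have "deriv sin (0::complex) = 1" by (rule DERIV_imp_deriv) (auto intro!: derivative_eq_intros)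
  then have "csinc = (\<lambda>z. if z = 0 then deriv sin 0 else (sin z - sin 0) / (z - 0))"
    by (auto simp: csinc_def)
  then have "csinc holomorphic_on UNIV" using pole_lemma[of sin UNIV 0] by (simp add: holomorphic_on_sin)
  then show "f holomorphic_on A \<Longrightarrow> (\<lambda>z. csinc (f z)) holomorphic_on A"
    by (rule holomorphic_on_compose_gen[unfolded o_def, rotated]) auto
qed

lemma cmod_sin_le: "cmod (sin z) \<le> exp \<bar>Im z\<bar>"
proof -
  have "cmod (sin z) = cmod (exp (\<i> * z) - exp (- (\<i> * z))) / 2" by (simp add: sin_exp_eq norm_divide norm_mult)
  also have "\<dots> \<le> (cmod (exp (\<i> * z)) + cmod (exp (- (\<i> * z)))) / 2"
    by (intro divide_right_mono norm_triangle_ineq4) auto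
  also have "\<dots> = (exp (- Im z) + exp (Im z)) / 2" by simp
  also have "\<dots> \<le> exp \<bar>Im z\<bar>"
  proof -
    have "exp (- Im z) \<le> exp \<bar>Im z\<bar>" "exp (Im z) \<le> exp \<bar>Im z\<bar>" by simp_all
    then have "exp (- Im z) + exp (Im z) \<le> exp \<bar>Im z\<bar> + exp \<bar>Im z\<bar>" by (rule add_mono)
    then show ?thesis by simp
  qed
  finally show ?thesis .
qed

text \<open>By compactness of the unit disc the bound away from the origin extends to the whole plane.\<close>

lemma entire_bound_near_zero:
  assumes hol: "f holomorphic_on UNIV" and b: "0 \<le> b"
    and bd: "\<And>z. 1 \<le> cmod z \<Longrightarrow> cmod (f z) \<le> C * exp (b * \<bar>Im z\<bar>) / (1 + cmod z) ^ n"
  obtains C' where "C' > 0" "\<And>z. cmod (f z) \<le> C' * exp (b * \<bar>Im z\<bar>) / (1 + cmod z) ^ n"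
proof -
  have "compact (f ` cball 0 1)"
    using hol by (intro compact_continuous_image holomorphic_on_imp_continuous_on holomorphic_on_subset[OF hol]) auto
  then obtain B where B: "B > 0" "\<And>z. z \<in> cball 0 1 \<Longrightarrow> cmod (f z) \<le> B"
    by (auto dest!: compact_imp_bounded simp: bounded_pos)
  define C' where "C' = max (B * 2 ^ n) \<bar>C\<bar>"
  have "C' > 0" using B by (simp add: C'_def less_max_iff_disj)
  moreover have "cmod (f z) \<le> C' * exp (b * \<bar>Im z\<bar>) / (1 + cmod z) ^ n" for z
  proof (cases "1 \<le> cmod z")
    case True
    have "C * exp (b * \<bar>Im z\<bar>) / (1 + cmod z) ^ n \<le> C' * exp (b * \<bar>Im z\<bar>) / (1 + cmod z) ^ n"
      by (intro divide_right_mono mult_right_mono) (auto simp: C'_def)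
    with bd[OF True] show ?thesis by linarith
  next
    case False
    then have "cmod (f z) \<le> B" by (intro B) auto
    also have "\<dots> = B * 2 ^ n / 2 ^ n" by simp
    also have "\<dots> \<le> (C' * exp (b * \<bar>Im z\<bar>)) / (1 + cmod z) ^ n"
    proof (intro frac_le)
      have "B * 2 ^ n \<le> C' * 1" by (simp add: C'_def)
      also have "\<dots> \<le> C' * exp (b * \<bar>Im z\<bar>)" using \<open>C' > 0\<close> b by (intro mult_left_mono) auto
      finally show "B * 2 ^ n \<le> C' * exp (b * \<bar>Im z\<bar>)" .
      show "(1 + cmod z) ^ n \<le> 2 ^ n" using False by (intro power_mono) auto
      show "0 \<le> C' * exp (b * \<bar>Im z\<bar>)" using \<open>C' > 0\<close> by simp
      show "0 < (1 + cmod z) ^ n" by (intro zero_less_power) (simp add: add_pos_nonneg)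
    qed
    finally show ?thesis .
  qed
  ultimately show thesis by (rule that)
qed

lemma csinc_bound:
  obtains C where "C > 0" "\<And>z. cmod (csinc z) \<le> C * exp \<bar>Im z\<bar> / (1 + cmod z)"
proof -
  have "csinc holomorphic_on UNIV" using csinc_holomorphic[OF holomorphic_on_ident] .
  moreover have "cmod (csinc z) \<le> 2 * exp (1 * \<bar>Im z\<bar>) / (1 + cmod z) ^ 1" if "1 \<le> cmod z" for z
  proof -
    have "cmod (csinc z) = cmod (sin z) / cmod z" using that by (auto simp: csinc_def norm_divide)
    also have "\<dots> \<le> exp \<bar>Im z\<bar> / ((1 + cmod z) / 2)" using that by (intro frac_le cmod_sin_le) auto
    finally show ?thesis by (simp add: mult.commute)
  qed
  ultimately obtain C' where "C' > 0" "\<And>z. cmod (csinc z) \<le> C' * exp (1 * \<bar>Im z\<bar>) / (1 + cmod z) ^ 1"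
    using entire_bound_near_zero[of csinc 1 2 1] by auto
  then show thesis using that[of C'] by simp
qed

text \<open>The convolution with \<open>sin (b t) / (\<pi> t)\<close> reproduces functions of exponential type at most \<open>b\<close>; the
  lemma states this for functions that vanish at the point of evaluation. Then \<open>q z / z\<close> is entire and
  decays on the line like \<open>|t|\<^bsup>-2\<^esup>\<close>, and the two exponentials that make up the sine give Fourier integrals that
  vanish by shifting the path upwards and downwards.\<close>

lemma csinc_pairing_zero:
  assumes hol: "q holomorphic_on UNIV" and b: "0 < b" and q0: "q 0 = 0"
    and bd: "\<And>z. cmod (q z) \<le> C * exp (b * \<bar>Im z\<bar>) / (1 + cmod z)"
  shows "(\<integral>t. q (of_real t) * csinc (of_real (b * t)) \<partial>lborel) = 0"
proof -
  define q1 where "q1 z = (if z = 0 then deriv q 0 else q z / z)" for z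
  have hol1: "q1 holomorphic_on UNIV"
    using pole_lemma[OF hol, of 0] q0 unfolding q1_def by (simp cong: if_cong)
  have C: "C \<ge> 0" using order_trans[OF norm_ge_zero bd[of 0]] by simp
  have "cmod (q1 z) \<le> (2 * C) * exp (b * \<bar>Im z\<bar>) / (1 + cmod z) ^ 2" if "1 \<le> cmod z" for z
  proof -
    have "cmod (q1 z) = cmod (q z) / cmod z" using that by (auto simp: q1_def norm_divide)
    also have "\<dots> \<le> (C * exp (b * \<bar>Im z\<bar>) / (1 + cmod z)) / ((1 + cmod z) / 2)" using that C by (intro frac_le bd) auto
    finally show ?thesis by (simp add: power2_eq_square mult_ac)
  qed
  then obtain C' where C': "C' > 0" "\<And>z. cmod (q1 z) \<le> C' * exp (b * \<bar>Im z\<bar>) / (1 + cmod z) ^ 2"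
    using entire_bound_near_zero[OF hol1, of b "2 * C" 2] b by auto
  have up: "integrable lborel (\<lambda>t::real. q1 (of_real t) * exp (\<i> * of_real (b * t)))"
    "(\<integral>t. q1 (of_real t) * exp (\<i> * of_real (b * t)) \<partial>lborel) = 0"
    using entire_fourier_integral_zero[OF hol1 _ C'(2)] b by auto
  have hol2: "(\<lambda>z. q1 (- z)) holomorphic_on UNIV"
    using hol1 by (intro holomorphic_on_compose_gen[OF _ hol1, unfolded o_def] holomorphic_intros) auto
  have dn0: "integrable lborel (\<lambda>t::real. q1 (- of_real t) * exp (\<i> * of_real (b * t)))"
    "(\<integral>t. q1 (- of_real t) * exp (\<i> * of_real (b * t)) \<partial>lborel) = 0"
    using entire_fourier_integral_zero[OF hol2, of b C'] C'(2)[of "- _"] b by auto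
  have dn: "integrable lborel (\<lambda>t::real. q1 (of_real t) * exp (- (\<i> * of_real (b * t))))"
    "(\<integral>t. q1 (of_real t) * exp (- (\<i> * of_real (b * t))) \<partial>lborel) = 0"
    using lborel_integrable_real_affine[OF dn0(1), of "-1" 0] dn0(2)
      lborel_integral_real_affine[of "-1" "\<lambda>t::real. q1 (- of_real t) * exp (\<i> * of_real (b * t))" 0] by auto
  have "q (of_real t) * csinc (of_real (b * t))
      = (q1 (of_real t) * exp (\<i> * of_real (b * t)) - q1 (of_real t) * exp (- (\<i> * of_real (b * t)))) / (2 * \<i> * of_real b)" for t :: real
  proof (cases "t = 0")
    case True then show ?thesis using q0 by simp
  next
    case False
    then have "csinc (of_real (b * t)) = (exp (\<i> * of_real (b * t)) - exp (- (\<i> * of_real (b * t)))) / (2 * \<i>) / of_real (b * t)"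
      (is "_ = ?E")
      using b unfolding csinc_def by (simp only: sin_exp_eq) simp
    moreover have "q (of_real t) = q1 (of_real t) * of_real t" using False by (simp add: q1_def)
    ultimately have "q (of_real t) * csinc (of_real (b * t)) = q1 (of_real t) * of_real t * ?E" by (simp only:)
    also have "\<dots> = (q1 (of_real t) * exp (\<i> * of_real (b * t)) - q1 (of_real t) * exp (- (\<i> * of_real (b * t)))) / (2 * \<i> * of_real b)"
    proof -
      have "Q * T * ((E1 - E2) / I / (B * T)) = (Q * E1 - Q * E2) / (I * B)" if "T \<noteq> 0" "B \<noteq> 0" "I \<noteq> 0"
        for Q T E1 E2 I B :: complex
        using that by (simp add: field_simps)
      from this[of "of_real t" "of_real b" "2 * \<i>"] show ?thesis using False b by simp
    qed
    finally show ?thesis .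
  qed
  then have "(\<integral>t. q (of_real t) * csinc (of_real (b * t)) \<partial>lborel)
     = (\<integral>t. (q1 (of_real t) * exp (\<i> * of_real (b * t)) - q1 (of_real t) * exp (- (\<i> * of_real (b * t)))) / (2 * \<i> * of_real b) \<partial>lborel)"
    by simp
  also have "\<dots> = 0" using up dn by (simp add: Bochner_Integration.integral_diff)
  finally show ?thesis .
qed

subsection \<open>A reproducing kernel\<close>

lemma csinc_of_real: "\<exists>s. csinc (of_real t) = of_real s"
  unfolding csinc_def by (auto simp: sin_of_real[symmetric] intro: exI[of _ 1] exI[of _ "sin t / t"])

definition rep_const :: complex where
  "rep_const = (\<integral>t. csinc (of_real (9 * t)) * csinc (of_real (9 * t)) \<partial>lborel)"

lemma csinc_real_bound:
  "\<exists>C>0. (\<forall>z. cmod (csinc z) \<le> C * exp \<bar>Im z\<bar> / (1 + cmod z)) \<and>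
    (\<forall>z. cmod (csinc (9 * z)) \<le> C * exp (9 * \<bar>Im z\<bar>) / (1 + cmod z))"
proof -
  obtain C where C: "C > 0" "\<And>z. cmod (csinc z) \<le> C * exp \<bar>Im z\<bar> / (1 + cmod z)" using csinc_bound by blast
  have "cmod (csinc (9 * z)) \<le> C * exp (9 * \<bar>Im z\<bar>) / (1 + cmod z)" for z
  proof -
    have "cmod (csinc (9 * z)) \<le> C * exp \<bar>Im (9 * z)\<bar> / (1 + cmod (9 * z))" by (rule C)
    also have "\<dots> \<le> C * exp (9 * \<bar>Im z\<bar>) / (1 + cmod z)"
      using C(1) by (intro frac_le) (auto simp: norm_mult abs_mult add_pos_nonneg)
    finally show ?thesis .
  qed
  with C show ?thesis by blast
qed

lemma csinc_measurable [measurable]: "(\<lambda>t::real. csinc (of_real (c * t))) \<in> borel_measurable borel"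
proof -
  have "(\<lambda>z. csinc (of_real c * z)) holomorphic_on UNIV" by (intro holomorphic_intros)
  from holomorphic_on_UNIV_measurable[OF this] show ?thesis by simp
qed

lemma integrable_csinc_square: "integrable lborel (\<lambda>t. csinc (of_real (9 * t)) * csinc (of_real (9 * t)))"
proof -
  obtain C where C: "C > 0" "\<And>z. cmod (csinc (9 * z)) \<le> C * exp (9 * \<bar>Im z\<bar>) / (1 + cmod z)"
    using csinc_real_bound by metis
  have "cmod (csinc (of_real (9 * t)) * csinc (of_real (9 * t))) \<le> C * C / (1 + \<bar>t\<bar>) ^ 2" for t
  proof -
    have b: "cmod (csinc (of_real (9 * t))) \<le> C / (1 + \<bar>t\<bar>)" using C(2)[of "of_real t"] by simp
    have "cmod (csinc (of_real (9 * t)) * csinc (of_real (9 * t))) \<le> (C / (1 + \<bar>t\<bar>)) * (C / (1 + \<bar>t\<bar>))"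
      unfolding norm_mult by (intro mult_mono b) (use C in auto)
    then show ?thesis by (simp add: power2_eq_square)
  qed
  then show ?thesis by (rule integrable_lborel_decay[rotated]) (simp, measurable)
qed

text \<open>On the line the cardinal sine is real, so the constant is the integral of a square that is positive near 0.\<close>

lemma rep_const_nonzero: "rep_const \<noteq> 0"
proof
  assume 0: "rep_const = 0"
  define g where "g t = (cmod (csinc (of_real (9 * t))))\<^sup>2" for t :: real
  have g: "csinc (of_real (9 * t)) * csinc (of_real (9 * t)) = of_real (g t)" for t
    using csinc_of_real[of "9 * t"] by (auto simp: g_def power2_eq_square abs_mult_self_eq simp flip: of_real_mult)
  have int: "integrable lborel g"
    using integrable_csinc_square unfolding g by (simp only: complex_of_real_integrable_eq)
  have "complex_of_real (\<integral>t. g t \<partial>lborel) = 0"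
    using 0 unfolding rep_const_def g by simp
  then have "(\<integral>t. g t \<partial>lborel) = 0" by (simp only: of_real_eq_0_iff)
  moreover have "AE t in lborel. 0 \<le> g t" by (simp add: g_def)
  ultimately have "AE t in lborel. g t = 0" using integral_nonneg_eq_0_iff_AE[OF int] by blast
  moreover have "g t \<noteq> 0" if "0 < t" "t < 1/9" for t
  proof -
    have "sin (9 * t) > 0" using that pi_gt3 by (intro sin_gt_zero) auto
    moreover have "csinc (of_real (9 * t)) = of_real (sin (9 * t) / (9 * t))"
      using that unfolding csinc_def by (simp add: sin_of_real[symmetric])
    ultimately show ?thesis using that by (simp add: g_def)
  qed
  ultimately have "AE t in lborel. t \<notin> {0<..<1/9::real}" by (auto elim!: eventually_mono)
  then have "emeasure lborel {0<..<1/9::real} = 0"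
    by (subst (asm) AE_iff_measurable[of "{0<..<1/9}"]) auto
  then show False by simp
qed

text \<open>The factor \<open>csinc (9 z)\<close> reproduces type 9. The cube has type 3, takes the value 1 at the origin, and
  provides the decay that compensates linear growth; it reduces the reproduced type to \<open>9 - 3 = 6\<close>.\<close>

definition rep_kernel :: "complex \<Rightarrow> complex" where
  "rep_kernel z = csinc (9 * z) * csinc z ^ 3 / rep_const"

lemma rep_kernel_holomorphic: "rep_kernel holomorphic_on A"
  unfolding rep_kernel_def[abs_def] using rep_const_nonzero by (intro holomorphic_intros) auto

lemma rep_kernel_bound:
  obtains C where "C > 0" "\<And>z. cmod (rep_kernel z) \<le> C * exp (12 * \<bar>Im z\<bar>) / (1 + cmod z) ^ 4"
proof -
  obtain C where C: "C > 0" "\<And>z. cmod (csinc z) \<le> C * exp \<bar>Im z\<bar> / (1 + cmod z)"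
    "\<And>z. cmod (csinc (9 * z)) \<le> C * exp (9 * \<bar>Im z\<bar>) / (1 + cmod z)"
    using csinc_real_bound by metis
  have "cmod (rep_kernel z) \<le> C ^ 4 / cmod rep_const * exp (12 * \<bar>Im z\<bar>) / (1 + cmod z) ^ 4" for z
  proof -
    define N where "N = 1 + cmod z"
    have N: "N > 0" by (simp add: N_def add_pos_nonneg)
    have e: "exp (12 * \<bar>Im z\<bar>) = exp (9 * \<bar>Im z\<bar>) * exp \<bar>Im z\<bar> ^ 3"
      by (simp add: exp_of_nat_mult[symmetric] exp_add[symmetric])
    have "cmod (csinc (9 * z) * csinc z ^ 3) \<le> (C * exp (9 * \<bar>Im z\<bar>) / N) * (C * exp \<bar>Im z\<bar> / N) ^ 3"
      unfolding norm_mult norm_power N_def using C by (intro mult_mono power_mono) auto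
    also have "\<dots> = C ^ 4 * exp (12 * \<bar>Im z\<bar>) / N ^ 4"
      unfolding e by (simp add: power_divide power_mult_distrib eval_nat_numeral)
    finally have "cmod (csinc (9 * z) * csinc z ^ 3) / cmod rep_const \<le> C ^ 4 * exp (12 * \<bar>Im z\<bar>) / N ^ 4 / cmod rep_const"
      by (rule divide_right_mono) simp
    then show ?thesis unfolding rep_kernel_def norm_divide N_def by (simp add: field_simps)
  qed
  moreover have "C ^ 4 / cmod rep_const > 0" using C rep_const_nonzero by simp
  ultimately show thesis by (rule that[rotated])
qed

lemma one_plus_cmod_shift:
  assumes "cmod (z - w) = 1"
  shows "1 + cmod z \<le> 2 * (1 + cmod w)" "1 + cmod w \<le> 2 * (1 + cmod z)" "\<bar>Im w\<bar> \<le> \<bar>Im z\<bar> + 1"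
proof -
  have c: "cmod z \<le> cmod w + 1" "cmod w \<le> cmod z + 1"
    using assms norm_triangle_ineq2[of z w] norm_triangle_ineq2[of w z] by (auto simp: norm_minus_commute)
  show "1 + cmod z \<le> 2 * (1 + cmod w)" using c(1) norm_ge_zero[of w] unfolding distrib_left by linarith
  show "1 + cmod w \<le> 2 * (1 + cmod z)" using c(2) norm_ge_zero[of z] unfolding distrib_left by linarith
  have "\<bar>Im (z - w)\<bar> \<le> 1" using abs_Im_le_cmod[of "z - w"] assms by simp
  then show "\<bar>Im w\<bar> \<le> \<bar>Im z\<bar> + 1" by (simp add: abs_if split: if_splits)
qed

lemma deriv_bound_unit_circle:
  assumes hol: "f holomorphic_on UNIV" and B: "\<And>w. cmod (z - w) = 1 \<Longrightarrow> cmod (f w) \<le> B"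
  shows "cmod (deriv f z) \<le> B"
  using Cauchy_inequality[of f z 1 B 1] B
    holomorphic_on_subset[OF hol] holomorphic_on_imp_continuous_on[OF holomorphic_on_subset[OF hol]] by auto

text \<open>Cauchy's estimate on the unit circle around \<open>z\<close>, on which \<open>1 + |w|\<close> changes at most by the factor 2 and
  \<open>|Im w|\<close> by at most 1.\<close>

lemma deriv_decay:
  assumes hol: "f holomorphic_on UNIV" and b: "0 \<le> b" and C: "0 \<le> C"
    and bd: "\<And>z. cmod (f z) \<le> C * exp (b * \<bar>Im z\<bar>) / (1 + cmod z) ^ n"
  shows "cmod (deriv f z) \<le> (C * exp b * 2 ^ n) * exp (b * \<bar>Im z\<bar>) / (1 + cmod z) ^ n"
proof (rule deriv_bound_unit_circle[OF hol])
  fix w assume w: "cmod (z - w) = 1"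
  note s = one_plus_cmod_shift[OF w]
  have pos: "1 + cmod z > 0" by (simp add: add_pos_nonneg)
  have "cmod (f w) \<le> C * exp (b * \<bar>Im w\<bar>) / (1 + cmod w) ^ n" by (rule bd)
  also have "\<dots> \<le> (C * exp (b * (\<bar>Im z\<bar> + 1))) / ((1 + cmod z) / 2) ^ n"
    using s b C pos by (intro frac_le mult_left_mono power_mono zero_less_power) (auto intro!: mult_left_mono)
  also have "\<dots> = (C * exp b * 2 ^ n) * exp (b * \<bar>Im z\<bar>) / (1 + cmod z) ^ n"
    by (simp add: power_divide distrib_left exp_add field_simps)
  finally show "cmod (f w) \<le> (C * exp b * 2 ^ n) * exp (b * \<bar>Im z\<bar>) / (1 + cmod z) ^ n" .
qed

lemma deriv_growth:
  assumes hol: "f holomorphic_on UNIV" and b: "0 \<le> b" and C: "0 \<le> C"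
    and bd: "\<And>z. cmod (f z) \<le> C * (1 + cmod z) * exp (b * \<bar>Im z\<bar>)"
  shows "cmod (deriv f z) \<le> (2 * C * exp b) * (1 + cmod z) * exp (b * \<bar>Im z\<bar>)"
proof (rule deriv_bound_unit_circle[OF hol])
  fix w assume w: "cmod (z - w) = 1"
  note s = one_plus_cmod_shift[OF w]
  have "cmod (f w) \<le> C * (1 + cmod w) * exp (b * \<bar>Im w\<bar>)" by (rule bd)
  also have "\<dots> \<le> (C * (2 * (1 + cmod z))) * exp (b * (\<bar>Im z\<bar> + 1))"
    using s b C by (intro mult_mono mult_left_mono) (auto intro!: mult_left_mono mult_nonneg_nonneg)
  also have "\<dots> = (2 * C * exp b) * (1 + cmod z) * exp (b * \<bar>Im z\<bar>)"
    by (simp add: exp_add algebra_simps)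
  finally show "cmod (f w) \<le> (2 * C * exp b) * (1 + cmod z) * exp (b * \<bar>Im z\<bar>)" .
qed

text \<open>For fixed \<open>x\<close> the function \<open>q z = w (x - z) csinc(z)\<^sup>3 - w x csinc (9 z)\<close> has type \<open>9 = 6 + 3\<close> and vanishes at the
  origin, so its pairing with \<open>csinc (9 t)\<close> is zero. This is the reproduction formula multiplied by the
  normalising constant.\<close>

lemma rep_kernel_reproduces_unscaled:
  assumes hol: "w holomorphic_on UNIV" and bd: "\<And>z. cmod (w z) \<le> B * (1 + cmod z) * exp (6 * \<bar>Im z\<bar>)"
  shows "(\<integral>t. rep_kernel (of_real (x - t)) * w (of_real t) \<partial>lborel) = w (of_real x)"
proof -
  obtain C where C: "C > 0" "\<And>z. cmod (csinc z) \<le> C * exp \<bar>Im z\<bar> / (1 + cmod z)"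
    "\<And>z. cmod (csinc (9 * z)) \<le> C * exp (9 * \<bar>Im z\<bar>) / (1 + cmod z)"
    using csinc_real_bound by metis
  have B: "B \<ge> 0" using order_trans[OF norm_ge_zero bd[of 0]] by simp
  define q0 where "q0 z = w (of_real x - z) * csinc z ^ 3" for z
  define q where "q z = q0 z - w (of_real x) * csinc (9 * z)" for z
  have hol_w: "(\<lambda>z. w (of_real x - z)) holomorphic_on UNIV"
    by (intro holomorphic_on_compose_gen[OF _ hol, unfolded o_def] holomorphic_intros) auto
  have hol_q0: "q0 holomorphic_on UNIV" unfolding q0_def using hol_w by (intro holomorphic_intros)
  have hol_q: "q holomorphic_on UNIV" unfolding q_def using hol_q0 by (intro holomorphic_intros)
  define C0 where "C0 = B * (1 + \<bar>x\<bar>) * C ^ 3"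
  have C0: "C0 \<ge> 0" using B C by (simp add: C0_def)
  have b0: "cmod (q0 z) \<le> C0 * exp (9 * \<bar>Im z\<bar>) / (1 + cmod z) ^ 2" for z
  proof -
    define N where "N = 1 + cmod z"
    have N: "N > 0" by (simp add: N_def add_pos_nonneg)
    have e: "exp (9 * \<bar>Im z\<bar>) = exp (6 * \<bar>Im z\<bar>) * exp \<bar>Im z\<bar> ^ 3"
      by (simp add: exp_of_nat_mult[symmetric] exp_add[symmetric])
    have "cmod (w (of_real x - z)) \<le> B * (1 + cmod (of_real x - z)) * exp (6 * \<bar>Im (of_real x - z)\<bar>)" by (rule bd)
    also have "\<dots> \<le> B * ((1 + \<bar>x\<bar>) * N) * exp (6 * \<bar>Im z\<bar>)"
    proof -
      have "cmod (of_real x - z) \<le> \<bar>x\<bar> + cmod z" using norm_triangle_ineq4[of "of_real x" z] by simp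
      moreover have "(1 + \<bar>x\<bar>) * N = 1 + \<bar>x\<bar> + cmod z + \<bar>x\<bar> * cmod z" by (simp add: N_def algebra_simps)
      moreover have "0 \<le> \<bar>x\<bar> * cmod z" by simp
      ultimately have "1 + cmod (of_real x - z) \<le> (1 + \<bar>x\<bar>) * N" by linarith
      then show ?thesis using B N by (intro mult_mono mult_left_mono mult_nonneg_nonneg) auto
    qed
    finally have "cmod (q0 z) \<le> (B * ((1 + \<bar>x\<bar>) * N) * exp (6 * \<bar>Im z\<bar>)) * (C * exp \<bar>Im z\<bar> / N) ^ 3"
      unfolding q0_def norm_mult norm_power N_def using C B by (intro mult_mono power_mono) auto
    also have "\<dots> = C0 * exp (9 * \<bar>Im z\<bar>) / N ^ 2"
      unfolding e C0_def using N by (simp add: power_divide power_mult_distrib eval_nat_numeral)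
    finally show ?thesis unfolding N_def .
  qed
  have "(\<integral>t. q (of_real t) * csinc (of_real (9 * t)) \<partial>lborel) = 0"
  proof (rule csinc_pairing_zero[OF hol_q])
    show "q 0 = 0" by (simp add: q_def q0_def csinc_def)
    fix z
    have "C0 * exp (9 * \<bar>Im z\<bar>) / (1 + cmod z) ^ 2 \<le> C0 * exp (9 * \<bar>Im z\<bar>) / (1 + cmod z) ^ 1"
      using C0 by (intro divide_left_mono power_increasing mult_pos_pos zero_less_power) (auto simp: add_pos_nonneg)
    moreover have "cmod (w (of_real x) * csinc (9 * z)) \<le> cmod (w (of_real x)) * (C * exp (9 * \<bar>Im z\<bar>) / (1 + cmod z))"
      unfolding norm_mult by (intro mult_left_mono C) auto
    ultimately have "cmod (q z) \<le> C0 * exp (9 * \<bar>Im z\<bar>) / (1 + cmod z) + cmod (w (of_real x)) * (C * exp (9 * \<bar>Im z\<bar>) / (1 + cmod z))"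
      using b0[of z] norm_triangle_ineq4[of "q0 z" "w (of_real x) * csinc (9 * z)"]
        unfolding q_def power_one_right by linarith
    then show "cmod (q z) \<le> (C0 + cmod (w (of_real x)) * C) * exp (9 * \<bar>Im z\<bar>) / (1 + cmod z)"
      by (simp add: algebra_simps add_divide_distrib)
  qed simp
  moreover have "q (of_real t) * csinc (of_real (9 * t))
      = q0 (of_real t) * csinc (of_real (9 * t)) - w (of_real x) * (csinc (of_real (9 * t)) * csinc (of_real (9 * t)))" for t
    by (simp add: q_def algebra_simps)
  moreover have int0: "integrable lborel (\<lambda>t. q0 (of_real t) * csinc (of_real (9 * t)))"
  proof (rule integrable_lborel_decay[where C = "C0 * C" and n = 2])
    show "(\<lambda>t. q0 (of_real t) * csinc (of_real (9 * t))) \<in> borel_measurable borel"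
      using holomorphic_on_UNIV_measurable[OF hol_q0] by measurable
    fix t :: real
    have "cmod (csinc (of_real (9 * t))) \<le> C / (1 + \<bar>t\<bar>)" using C(3)[of "of_real t"] by simp
    also have "\<dots> \<le> C / 1" using C by (intro divide_left_mono) auto
    finally have "cmod (q0 (of_real t) * csinc (of_real (9 * t))) \<le> (C0 / (1 + \<bar>t\<bar>) ^ 2) * C"
      unfolding norm_mult using b0[of "of_real t"] C0 by (intro mult_mono) auto
    then show "cmod (q0 (of_real t) * csinc (of_real (9 * t))) \<le> C0 * C / (1 + \<bar>t\<bar>) ^ 2" by simp
  qed simp
  ultimately have eq: "(\<integral>t. q0 (of_real t) * csinc (of_real (9 * t)) \<partial>lborel) = w (of_real x) * rep_const"
    using integrable_csinc_square unfolding rep_const_def by (simp add: Bochner_Integration.integral_diff)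
  have "(\<integral>t. rep_kernel (of_real (x - t)) * w (of_real t) \<partial>lborel)
      = (\<integral>t. rep_kernel (of_real (x - (x + (-1) * t))) * w (of_real (x + (-1) * t)) \<partial>lborel)"
    by (subst lborel_integral_real_affine[of "-1" _ x]) simp_all
  also have "\<dots> = (\<integral>t. q0 (of_real t) * csinc (of_real (9 * t)) / rep_const \<partial>lborel)"
    by (intro Bochner_Integration.integral_cong) (auto simp: q0_def rep_kernel_def)
  also have "\<dots> = w (of_real x)" using eq rep_const_nonzero by simp
  finally show ?thesis .
qed

definition scaled_kernel :: "real \<Rightarrow> complex \<Rightarrow> complex" where
  "scaled_kernel l z = of_real l * rep_kernel (of_real l * z)"

lemma scaled_kernel_holomorphic: "scaled_kernel l holomorphic_on A"
proof -
  have "(\<lambda>z. rep_kernel (of_real l * z)) holomorphic_on UNIV"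
    by (rule holomorphic_on_compose_gen[OF _ rep_kernel_holomorphic, of _ _ UNIV, unfolded o_def])
       (auto intro!: holomorphic_intros)
  then show ?thesis unfolding scaled_kernel_def[abs_def]
    by (intro holomorphic_intros) (rule holomorphic_on_subset, auto)
qed

lemma scaled_kernel_reproduces:
  assumes l: "l > 0" and hol: "w holomorphic_on UNIV"
    and bd: "\<And>z. cmod (w z) \<le> B * (1 + cmod z) * exp (6 * l * \<bar>Im z\<bar>)"
  shows "conv (\<lambda>t. scaled_kernel l (of_real t)) (\<lambda>t. w (of_real t)) x = w (of_real x)"
proof -
  define W where "W z = w (z / of_real l)" for z
  have holW: "W holomorphic_on UNIV" unfolding W_def using l
    by (intro holomorphic_on_compose_gen[OF _ hol, unfolded o_def] holomorphic_intros) auto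
  have B: "B \<ge> 0" using order_trans[OF norm_ge_zero bd[of 0]] by simp
  have bW: "cmod (W z) \<le> (B * (1 + 1 / l)) * (1 + cmod z) * exp (6 * \<bar>Im z\<bar>)" for z
  proof -
    have "cmod (W z) \<le> B * (1 + cmod (z / of_real l)) * exp (6 * l * \<bar>Im (z / of_real l)\<bar>)" unfolding W_def by (rule bd)
    also have "6 * l * \<bar>Im (z / of_real l)\<bar> = 6 * \<bar>Im z\<bar>" using l by (simp add: abs_divide)
    also have "B * (1 + cmod (z / of_real l)) * exp (6 * \<bar>Im z\<bar>) \<le> B * ((1 + 1 / l) * (1 + cmod z)) * exp (6 * \<bar>Im z\<bar>)"
    proof -
      have "0 \<le> cmod z" "0 \<le> 1 / l" using l by auto
      then have "1 + cmod (z / of_real l) \<le> (1 + 1 / l) * (1 + cmod z)"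
        using l unfolding distrib_left distrib_right by (simp add: norm_divide)
      then show ?thesis using B l by (intro mult_mono mult_left_mono mult_nonneg_nonneg add_nonneg_nonneg) auto
    qed
    finally show ?thesis by (simp add: mult.assoc)
  qed
  have m: "(\<lambda>t. scaled_kernel l (of_real (x - t)) * w (of_real t)) \<in> borel_measurable lborel"
  proof -
    have "(\<lambda>z. scaled_kernel l (of_real x - z) * w z) holomorphic_on UNIV"
      using hol by (intro holomorphic_intros holomorphic_on_compose_gen[OF _ scaled_kernel_holomorphic, of _ _ UNIV, unfolded o_def]) auto
    from holomorphic_on_UNIV_measurable[OF this] show ?thesis by simp
  qed
  have "w (of_real x) = W (of_real (l * x))" using l by (simp add: W_def)
  also have "\<dots> = (\<integral>t. rep_kernel (of_real (l * x - t)) * W (of_real t) \<partial>lborel)"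
    by (rule rep_kernel_reproduces_unscaled[OF holW bW, symmetric])
  also have "\<dots> = \<bar>l\<bar> *\<^sub>R (\<integral>t. rep_kernel (of_real (l * x - (0 + l * t))) * W (of_real (0 + l * t)) \<partial>lborel)"
    by (rule lborel_integral_real_affine) (use l in auto)
  also have "\<dots> = (\<integral>t. \<bar>l\<bar> *\<^sub>R (rep_kernel (of_real (l * x - (0 + l * t))) * W (of_real (0 + l * t))) \<partial>lborel)"
    by simp
  also have "\<dots> = (\<integral>t. scaled_kernel l (of_real (x - t)) * w (of_real t) \<partial>lborel)"
    using l by (intro Bochner_Integration.integral_cong) (auto simp: W_def scaled_kernel_def scaleR_conv_of_real algebra_simps)
  also have "\<dots> = conv (\<lambda>t. scaled_kernel l (of_real t)) (\<lambda>t. w (of_real t)) x"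
    unfolding conv_def by (rule integral_completion[OF m, symmetric])
  finally show ?thesis ..
qed

section \<open>Growth of functions of exponential type\<close>

lemma one_plus_le_exp:
  fixes x d :: real
  assumes "0 \<le> x" "0 < d"
  shows "1 + x \<le> max 1 (1 / d) * exp (d * x)"
proof -
  have "1 + x \<le> max 1 (1 / d) * (1 + d * x)"
  proof -
    have "1 * 1 \<le> max 1 (1 / d) * (1::real)" by (intro mult_right_mono) auto
    moreover have "(1 / d) * (d * x) \<le> max 1 (1 / d) * (d * x)" using assms by (intro mult_right_mono) auto
    ultimately show ?thesis using assms by (simp add: distrib_left)
  qed
  also have "\<dots> \<le> max 1 (1 / d) * exp (d * x)" by (intro mult_left_mono exp_ge_add_one_self) auto
  finally show ?thesis .
qed

text \<open>The principle of Phragmen and Lindelof in a narrow sector. On the upper edge, where \<open>Im z = Re z / 2\<close>, we have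
  \<open>|z| \<le> 3 Im z\<close>, so the factor \<open>e\<^bsup>3 i a z\<^esup>\<close> compensates the growth \<open>e\<^bsup>a |z|\<^esup>\<close>; the division by \<open>1 + z\<close> takes care
  of the linear growth on the lower edge. The factor \<open>e\<^bsup>- d z\<^sup>2\<^esup>\<close> decays in the sector, which closes it at
  infinity, and \<open>d\<close> tends to 0 at the end.\<close>

lemma sector_growth:
  assumes hol: "f holomorphic_on UNIV" and a: "0 \<le> a"
    and exp_bd: "\<And>z. cmod (f z) \<le> A * exp (a * cmod z)"
    and real_bd: "\<And>x. 0 \<le> x \<Longrightarrow> cmod (f (of_real x)) \<le> M * (1 + x)"
    and z: "0 \<le> Im z" "Im z \<le> Re z / 2"
  shows "cmod (f z) \<le> max A M * (1 + cmod z) * exp (3 * a * Im z)"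
proof -
  define B where "B = max A M"
  have A: "A \<ge> 0" using order_trans[OF norm_ge_zero exp_bd[of 0]] by simp
  have B: "B \<ge> 0" "A \<le> B" "M \<le> B" using A by (auto simp: B_def)
  define F where "F d w = f w * exp (3 * \<i> * of_real a * w) / (1 + w) * exp (- (of_real d * w\<^sup>2))" for d :: real and w
  have cF: "cmod (F d w) = cmod (f w) * exp (- (3 * a * Im w)) / cmod (1 + w) * exp (- (d * ((Re w)\<^sup>2 - (Im w)\<^sup>2)))"
    for d w
    by (simp add: F_def norm_mult norm_divide power2_eq_square)
  have one: "1 \<le> cmod (1 + w)" if "0 \<le> Re w" for w
    using abs_Re_le_cmod[of "1 + w"] that by simp
  have main: "cmod (F d z) \<le> B" if d: "d > 0" for d
  proof -
    \<comment> \<open>Beyond this \<open>R\<close> the decay \<open>e\<^bsup>- 3 d R\<^sup>2 / 4\<^esup>\<close> on the right edge beats the growth \<open>e\<^bsup>2 a R\<^esup>\<close>.\<close>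
    define R where "R = max (Re z) (8 * a / (3 * d) + 1)"
    have R: "R > 0" "Re z \<le> R" "8 * a / (3 * d) \<le> R" using a d by (auto simp: R_def less_max_iff_disj add_nonneg_pos)
    define S where "S = {w. 0 \<le> Im w \<and> Im w \<le> Re w / 2 \<and> Re w \<le> R}"
    have "closed S" unfolding S_def by (intro closed_Collect_conj closed_Collect_le continuous_intros) auto
    have "bounded S"
    proof (rule boundedI)
      fix w assume "w \<in> S"
      then show "cmod w \<le> R + R" using cmod_le[of w] by (auto simp: S_def)
    qed
    have neg1: "1 + w \<noteq> 0" if "w \<in> S" for w using that one[of w] by (auto simp: S_def)
    have holF: "F d holomorphic_on S" unfolding F_def[abs_def] using neg1
      by (intro holomorphic_intros holomorphic_on_subset[OF hol]) auto
    show ?thesis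
    proof (rule maximum_modulus_frontier[of "F d" S])
      show "F d holomorphic_on interior S" by (rule holomorphic_on_subset[OF holF interior_subset])
      show "continuous_on (closure S) (F d)"
        using \<open>closed S\<close> holF by (simp add: holomorphic_on_imp_continuous_on)
      show "bounded S" by fact
      show "z \<in> S" using z R by (auto simp: S_def)
      fix w assume "w \<in> frontier S"
      then have w: "w \<in> S" "w \<notin> interior S" using \<open>closed S\<close> by (auto simp: frontier_def)
      have "Im w = 0 \<or> Im w = Re w / 2 \<or> Re w = R"
      proof (rule ccontr)
        assume not: "\<not> ?thesis"
        define U where "U = {w. 0 < Im w \<and> Im w < Re w / 2 \<and> Re w < R}"
        have "open U" unfolding U_def by (intro open_Collect_conj open_Collect_less continuous_intros) auto
        moreover have "U \<subseteq> S" by (auto simp: U_def S_def)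
        ultimately have "U \<subseteq> interior S" by (rule interior_maximal[rotated])
        moreover have "w \<in> U" using w(1) not by (auto simp: U_def S_def)
        ultimately show False using w by auto
      qed
      have x: "0 \<le> Re w" "0 \<le> Im w" "Im w \<le> Re w / 2" "Re w \<le> R" using w(1) by (auto simp: S_def)
      have sq: "3 / 4 * (Re w)\<^sup>2 \<le> (Re w)\<^sup>2 - (Im w)\<^sup>2"
        using power_mono[OF x(3) x(2), of 2] by (simp add: power_divide)
      have e1: "exp (- (d * ((Re w)\<^sup>2 - (Im w)\<^sup>2))) \<le> exp (- (d * (3 / 4 * (Re w)\<^sup>2)))"
        using sq d by simp
      have e2: "exp (- (d * ((Re w)\<^sup>2 - (Im w)\<^sup>2))) \<le> 1"
      proof -
        have "0 \<le> (Re w)\<^sup>2 - (Im w)\<^sup>2" using sq zero_le_power2[of "Re w"] by linarith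
        then show ?thesis using d by simp
      qed
      from \<open>Im w = 0 \<or> Im w = Re w / 2 \<or> Re w = R\<close>
      consider "Im w = 0" | "Im w = Re w / 2" | "Re w = R" by blast
      then show "cmod (F d w) \<le> B"
      proof cases
        case 1
        then have wr: "w = of_real (Re w)" by (simp add: complex_eq_iff)
        have "cmod (f w) \<le> M * (1 + Re w)" by (subst wr) (rule real_bd[OF x(1)])
        moreover have "1 + w = of_real (1 + Re w)" using 1 by (simp add: complex_eq_iff)
        then have "cmod (1 + w) = 1 + Re w" using x(1) by (simp only: norm_of_real)
        ultimately have "cmod (f w) * exp (- (3 * a * Im w)) / cmod (1 + w) \<le> M"
          using 1 x(1) by (simp add: divide_simps)
        then have "cmod (F d w) \<le> B * 1" unfolding cF using B e2 by (intro mult_mono) auto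
        then show ?thesis by simp
      next
        case 2
        have "cmod w \<le> Re w + Im w" using cmod_le[of w] x by simp
        then have "cmod w \<le> 3 * Im w" using 2 by simp
        then have "cmod (f w) \<le> A * exp (a * (3 * Im w))"
          using A a by (intro order_trans[OF exp_bd] mult_left_mono) (auto intro: mult_left_mono)
        then have "cmod (f w) * exp (- (3 * a * Im w)) \<le> A * exp (a * (3 * Im w)) * exp (- (3 * a * Im w))"
          by (rule mult_right_mono) simp
        also have "\<dots> = A" by (simp add: exp_minus field_simps)
        finally have "cmod (f w) * exp (- (3 * a * Im w)) / cmod (1 + w) \<le> A / 1"
          using A one[OF x(1)] by (intro frac_le) auto
        then have "cmod (F d w) \<le> B * 1" unfolding cF using B e2 by (intro mult_mono) auto
        then show ?thesis by simp
      next
        case 3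
        have "cmod w \<le> Re w + Im w" using cmod_le[of w] x by simp
        then have "cmod w \<le> 2 * R" using 3 x by simp
        then have f: "cmod (f w) \<le> A * exp (a * (2 * R))"
          using A a by (intro order_trans[OF exp_bd] mult_left_mono) (auto intro: mult_left_mono)
        have "cmod (f w) * exp (- (3 * a * Im w)) / cmod (1 + w) \<le> (A * exp (a * (2 * R)) * 1) / 1"
          using A a f one[OF x(1)] x by (intro frac_le mult_mono) auto
        then have "cmod (F d w) \<le> (A * exp (a * (2 * R))) * exp (- (d * (3 / 4 * R\<^sup>2)))"
          unfolding cF using A e1 3 by (intro mult_mono) auto
        also have "\<dots> = A * exp (a * (2 * R) - d * (3 / 4 * R\<^sup>2))" by (simp add: mult.assoc flip: exp_add)
        also have "\<dots> \<le> A * 1"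
        proof -
          have "a * 8 \<le> R * (3 * d)" using R(3) d by (simp add: divide_simps mult_ac split: if_splits)
          then have "a * 8 * R \<le> R * (3 * d) * R" using R by (intro mult_right_mono) auto
          then have "a * (2 * R) - d * (3 / 4 * R\<^sup>2) \<le> 0" by (simp add: power2_eq_square algebra_simps)
          then show ?thesis using A by (intro mult_left_mono) auto
        qed
        finally show ?thesis using B by simp
      qed
    qed
  qed
  have "cmod (F 0 z) \<le> B"
  proof (rule tendsto_upperbound)
    show "((\<lambda>d. cmod (F d z)) \<longlongrightarrow> cmod (F 0 z)) (at_right 0)"
      unfolding F_def by (intro tendsto_intros)
    show "\<forall>\<^sub>F d in at_right 0. cmod (F d z) \<le> B"
      by (rule eventually_at_rightI[of 0 1]) (use main in auto)
  qed simp
  then have "cmod (f z) * exp (- (3 * a * Im z)) / cmod (1 + z) \<le> B" unfolding cF by simp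
  moreover have "cmod (1 + z) > 0" using one[of z] z by linarith
  ultimately have "cmod (f z) * exp (- (3 * a * Im z)) \<le> B * cmod (1 + z)" by (simp add: divide_simps split: if_splits)
  also have "\<dots> \<le> B * (1 + cmod z)" using B norm_triangle_ineq[of 1 z] by (intro mult_left_mono) auto
  finally have "cmod (f z) * exp (- (3 * a * Im z)) * exp (3 * a * Im z) \<le> B * (1 + cmod z) * exp (3 * a * Im z)"
    by (rule mult_right_mono) simp
  then show ?thesis by (simp add: B_def exp_minus field_simps)
qed

lemma entire_cnj_cnj:
  assumes "f holomorphic_on UNIV" shows "(\<lambda>w. cnj (f (cnj w))) holomorphic_on UNIV"
proof -
  have "range cnj = UNIV" by (rule surjI[of _ cnj]) simp
  then show ?thesis using holomorphic_on_compose_cnj_cnj[of f UNIV] assms by (simp add: o_def)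
qed

text \<open>Where \<open>|Re z| \<le> 2 |Im z|\<close> the hypothesis itself suffices, because \<open>|z| \<le> 3 |Im z|\<close>. The rest of the plane consists of four
  sectors, which the reflections in the two axes carry to the sector treated above.\<close>

lemma plane_growth:
  assumes hol: "f holomorphic_on UNIV" and a: "0 \<le> a"
    and exp_bd: "\<And>z. cmod (f z) \<le> A * exp (a * cmod z)"
    and real_bd: "\<And>x. cmod (f (of_real x)) \<le> M * (1 + \<bar>x\<bar>)"
  shows "cmod (f z) \<le> max A M * (1 + cmod z) * exp (3 * a * \<bar>Im z\<bar>)"
proof (cases "\<bar>Re z\<bar> \<le> 2 * \<bar>Im z\<bar>")
  case True
  have A: "A \<ge> 0" using order_trans[OF norm_ge_zero exp_bd[of 0]] by simp
  have "cmod z \<le> 3 * \<bar>Im z\<bar>" using cmod_le[of z] True by linarith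
  then have "cmod (f z) \<le> A * exp (a * (3 * \<bar>Im z\<bar>))"
    using A a by (intro order_trans[OF exp_bd] mult_left_mono) (auto intro: mult_left_mono)
  also have "\<dots> = A * 1 * exp (3 * a * \<bar>Im z\<bar>)" by (simp add: mult_ac)
  also have "\<dots> \<le> max A M * (1 + cmod z) * exp (3 * a * \<bar>Im z\<bar>)"
    using A by (intro mult_right_mono mult_mono) auto
  finally show ?thesis .
next
  case False
  define g where "g w = cnj (f (cnj w))" for w
  have holg: "g holomorphic_on UNIV" unfolding g_def by (rule entire_cnj_cnj[OF hol])
  have sym: "cmod (h w) \<le> max A M * (1 + cmod w) * exp (3 * a * Im w)"
    if h: "h holomorphic_on UNIV" "\<And>z. cmod (h z) \<le> A * exp (a * cmod z)" "\<And>x. cmod (h (of_real x)) \<le> M * (1 + \<bar>x\<bar>)"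
      and w: "0 \<le> Im w" "Im w \<le> \<bar>Re w\<bar> / 2" for h w
  proof (cases "Re w \<ge> 0")
    case True
    have "cmod (h (of_real x)) \<le> M * (1 + x)" if "0 \<le> x" for x using h(3)[of x] that by simp
    then show ?thesis using w True by (intro sector_growth[OF h(1) a h(2)]) auto
  next
    case False
    define h' where "h' w = cnj (h (- cnj w))" for w
    have h': "h' holomorphic_on UNIV"
    proof -
      have "(\<lambda>w. h (- w)) holomorphic_on UNIV"
        by (intro holomorphic_on_compose_gen[OF _ h(1), unfolded o_def] holomorphic_intros) auto
      from entire_cnj_cnj[OF this] show ?thesis by (simp add: h'_def[abs_def])
    qed
    have "cmod (h' (- cnj w)) \<le> max A M * (1 + cmod (- cnj w)) * exp (3 * a * Im (- cnj w))"
    proof (rule sector_growth[OF h' a])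
      show "cmod (h' z) \<le> A * exp (a * cmod z)" for z using h(2)[of "- cnj z"] by (simp add: h'_def)
      show "cmod (h' (of_real x)) \<le> M * (1 + x)" if "0 \<le> x" for x using h(3)[of "- x"] that by (simp add: h'_def)
    qed (use w False in auto)
    then show ?thesis by (simp add: h'_def)
  qed
  show ?thesis
  proof (cases "Im z \<ge> 0")
    case True
    with False show ?thesis using sym[OF hol exp_bd real_bd, of z] by simp
  next
    case neg: False
    have "cmod (g (cnj z)) \<le> max A M * (1 + cmod (cnj z)) * exp (3 * a * Im (cnj z))"
    proof (rule sym[OF holg])
      show "cmod (g z) \<le> A * exp (a * cmod z)" for z using exp_bd[of "cnj z"] by (simp add: g_def)
      show "cmod (g (of_real x)) \<le> M * (1 + \<bar>x\<bar>)" for x using real_bd[of x] by (simp add: g_def)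
    qed (use False neg in auto)
    then show ?thesis using neg by (simp add: g_def)
  qed
qed

section \<open>Convolutions with entire kernels\<close>

lemma peetre: "1 + \<bar>t\<bar> \<le> (1 + cmod (z - of_real t)) * (1 + cmod z)"
proof -
  have "\<bar>t\<bar> \<le> cmod (z - of_real t) + cmod z"
    using norm_triangle_ineq2[of "of_real t" z] by (simp add: norm_minus_commute)
  moreover have "(1 + cmod (z - of_real t)) * (1 + cmod z) = 1 + cmod (z - of_real t) + cmod z + cmod (z - of_real t) * cmod z"
    by (simp add: algebra_simps)
  moreover have "0 \<le> cmod (z - of_real t) * cmod z" by simp
  ultimately show ?thesis by linarith
qed

lemma shifted_decay:
  assumes C: "0 \<le> C" and bd: "\<And>z. cmod (K z) \<le> C * exp (b * \<bar>Im z\<bar>) / (1 + cmod z) ^ n"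
  shows "cmod (K (z - of_real t)) \<le> C * exp (b * \<bar>Im z\<bar>) * (1 + cmod z) ^ n / (1 + \<bar>t\<bar>) ^ n"
proof -
  define N where "N = 1 + cmod (z - of_real t)"
  have N: "N > 0" by (simp add: N_def add_pos_nonneg)
  have le: "(1 + \<bar>t\<bar>) ^ n \<le> N ^ n * (1 + cmod z) ^ n"
    unfolding N_def power_mult_distrib[symmetric] by (intro power_mono peetre) auto
  have pos: "0 < (1 + \<bar>t\<bar>) ^ n" "0 < N ^ n" using N by (auto intro: zero_less_power)
  have "1 / N ^ n \<le> (1 + cmod z) ^ n / (1 + \<bar>t\<bar>) ^ n" using le pos by (simp add: divide_simps mult_ac)
  then have "(C * exp (b * \<bar>Im z\<bar>)) * (1 / N ^ n) \<le> (C * exp (b * \<bar>Im z\<bar>)) * ((1 + cmod z) ^ n / (1 + \<bar>t\<bar>) ^ n)"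
    using C by (intro mult_left_mono) auto
  with bd[of "z - of_real t"] show ?thesis by (simp add: N_def)
qed

text \<open>The extension of \<open>conv\<close> to complex arguments, for an entire kernel.\<close>

definition cconv :: "(complex \<Rightarrow> complex) \<Rightarrow> (real \<Rightarrow> complex) \<Rightarrow> complex \<Rightarrow> complex" where
  "cconv K h z = (\<integral>t. K (z - of_real t) * h t \<partial>lebesgue)"

lemma cconv_of_real: "cconv K h (of_real x) = conv (\<lambda>t. K (of_real t)) h x"
  by (simp add: cconv_def conv_def)

lemma entire_translate_measurable:
  assumes hol: "K holomorphic_on UNIV" shows "(\<lambda>t::real. K (z - of_real t)) \<in> borel_measurable lebesgue"
proof -
  have "(\<lambda>w. K (z - w)) holomorphic_on UNIV"
    by (intro holomorphic_on_compose_gen[OF _ hol, unfolded o_def] holomorphic_intros) auto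
  from measurable_compose[OF borel_measurable_lebesgue_ident holomorphic_on_UNIV_measurable[OF this]]
  show ?thesis by simp
qed

lemma cconv_integrable:
  assumes hol: "K holomorphic_on UNIV" and C: "0 \<le> C"
    and bd: "\<And>z. cmod (K z) \<le> C * exp (b * \<bar>Im z\<bar>) / (1 + cmod z) ^ n"
    and h [measurable]: "h \<in> borel_measurable lebesgue" and int: "integrable lebesgue (\<lambda>t. cmod (h t) / (1 + \<bar>t\<bar>) ^ n)"
  shows "integrable lebesgue (\<lambda>t. K (z - of_real t) * h t)"
    and "cmod (cconv K h z) \<le> C * exp (b * \<bar>Im z\<bar>) * (1 + cmod z) ^ n * (\<integral>t. cmod (h t) / (1 + \<bar>t\<bar>) ^ n \<partial>lebesgue)"
proof -
  define D where "D = C * exp (b * \<bar>Im z\<bar>) * (1 + cmod z) ^ n"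
  have D: "D \<ge> 0" using C by (simp add: D_def add_nonneg_nonneg)
  have [measurable]: "(\<lambda>t::real. K (z - of_real t)) \<in> borel_measurable lebesgue"
    by (rule entire_translate_measurable[OF hol])
  have le: "cmod (K (z - of_real t) * h t) \<le> D * (cmod (h t) / (1 + \<bar>t\<bar>) ^ n)" for t
    using mult_right_mono[OF shifted_decay[where K = K, OF C bd, of z t], of "cmod (h t)"]
      by (simp add: D_def norm_mult)
  have int': "integrable lebesgue (\<lambda>t. D * (cmod (h t) / (1 + \<bar>t\<bar>) ^ n))" using int by (rule integrable_mult_right)
  show "integrable lebesgue (\<lambda>t. K (z - of_real t) * h t)"
    by (rule Bochner_Integration.integrable_bound[OF int']) (use le D in \<open>auto intro!: order_trans[OF le]\<close>)
  have "cmod (cconv K h z) \<le> (\<integral>t. cmod (K (z - of_real t) * h t) \<partial>lebesgue)"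
    unfolding cconv_def by (rule integral_norm_bound)
  also have "\<dots> \<le> (\<integral>t. D * (cmod (h t) / (1 + \<bar>t\<bar>) ^ n) \<partial>lebesgue)"
    by (rule integral_mono'[OF int' le]) (use D in auto)
  also have "\<dots> = D * (\<integral>t. cmod (h t) / (1 + \<bar>t\<bar>) ^ n \<partial>lebesgue)" by (rule integral_mult_right_zero)
  finally show "cmod (cconv K h z) \<le> C * exp (b * \<bar>Im z\<bar>) * (1 + cmod z) ^ n * (\<integral>t. cmod (h t) / (1 + \<bar>t\<bar>) ^ n \<partial>lebesgue)"
    by (simp add: D_def)
qed

text \<open>Differentiation under the integral sign. On the unit disc around a point the difference quotients of
  the kernel are dominated by its derivative, which decays like the kernel.\<close>

lemma cconv_holomorphic:
  assumes hol: "K holomorphic_on UNIV" and C: "0 \<le> C" and b: "0 \<le> b"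
    and bd: "\<And>z. cmod (K z) \<le> C * exp (b * \<bar>Im z\<bar>) / (1 + cmod z) ^ n"
    and h [measurable]: "h \<in> borel_measurable lebesgue" and int: "integrable lebesgue (\<lambda>t. cmod (h t) / (1 + \<bar>t\<bar>) ^ n)"
  shows "cconv K h holomorphic_on UNIV"
proof -
  define C' where "C' = C * exp b * 2 ^ n"
  have C': "C' \<ge> 0" using C by (simp add: C'_def)
  have dK: "(K has_field_derivative deriv K z) (at z)" for z
    using holomorphic_derivI[OF hol, of z] by simp
  have bd': "cmod (deriv K z) \<le> C' * exp (b * \<bar>Im z\<bar>) / (1 + cmod z) ^ n" for z
    unfolding C'_def by (rule deriv_decay[OF hol b C bd])
  have hold: "deriv K holomorphic_on UNIV" by (intro holomorphic_intros hol) auto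
  have "(cconv K h has_field_derivative cconv (deriv K) h z0) (at z0)" for z0
  proof -
    define D where "D = C' * exp (b * (\<bar>Im z0\<bar> + 1)) * (2 + cmod z0) ^ n"
    have D: "D \<ge> 0" using C' by (simp add: D_def)
    have near: "cmod (deriv K (w - of_real t)) \<le> D / (1 + \<bar>t\<bar>) ^ n" if w: "w \<in> ball z0 1" for w and t :: real
    proof -
      have 1: "cmod w \<le> cmod z0 + 1" using w norm_triangle_ineq2[of w z0] by (auto simp: dist_norm norm_minus_commute)
      have 2: "\<bar>Im w\<bar> \<le> \<bar>Im z0\<bar> + 1" using w abs_Im_le_cmod[of "w - z0"] by (auto simp: dist_norm norm_minus_commute)
      have "C' * exp (b * \<bar>Im w\<bar>) * (1 + cmod w) ^ n \<le> D" unfolding D_def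
        using 1 2 b C' by (intro mult_mono power_mono) (auto intro!: mult_left_mono)
      then have "C' * exp (b * \<bar>Im w\<bar>) * (1 + cmod w) ^ n / (1 + \<bar>t\<bar>) ^ n \<le> D / (1 + \<bar>t\<bar>) ^ n"
        by (rule divide_right_mono) simp
      with shifted_decay[where K = "deriv K", OF C' bd', of w t] show ?thesis by linarith
    qed
    have "((\<lambda>w. (cconv K h w - cconv K h z0) / (w - z0)) \<longlongrightarrow> cconv (deriv K) h z0) (at z0 within ball z0 1)"
      unfolding tendsto_at_iff_sequentially o_def
    proof (intro allI impI)
      fix X :: "nat \<Rightarrow> complex"
      assume X: "\<forall>i. X i \<in> ball z0 1 - {z0}" "X \<longlonglongrightarrow> z0"
      have eq: "(cconv K h (X i) - cconv K h z0) / (X i - z0)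
         = (\<integral>t. (K (X i - of_real t) - K (z0 - of_real t)) / (X i - z0) * h t \<partial>lebesgue)" for i
      proof -
        have "cconv K h (X i) - cconv K h z0 = (\<integral>t. K (X i - of_real t) * h t - K (z0 - of_real t) * h t \<partial>lebesgue)"
          unfolding cconv_def by (rule Bochner_Integration.integral_diff[symmetric]) (rule cconv_integrable(1)[OF hol C bd h int])+
        then show ?thesis by (simp add: left_diff_distrib[symmetric] flip: integral_divide_zero)
      qed
      show "(\<lambda>i. (cconv K h (X i) - cconv K h z0) / (X i - z0)) \<longlonglongrightarrow> cconv (deriv K) h z0"
        unfolding eq unfolding cconv_def
      proof (rule integral_dominated_convergence[where w = "\<lambda>t. D * (cmod (h t) / (1 + \<bar>t\<bar>) ^ n)"])
        note [measurable] = entire_translate_measurable[OF hol] entire_translate_measurable[OF hold]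
        show "(\<lambda>t. deriv K (z0 - of_real t) * h t) \<in> borel_measurable lebesgue" by measurable
        show "(\<lambda>t. (K (X i - of_real t) - K (z0 - of_real t)) / (X i - z0) * h t) \<in> borel_measurable lebesgue" for i
          by measurable
        show "integrable lebesgue (\<lambda>t. D * (cmod (h t) / (1 + \<bar>t\<bar>) ^ n))" using int by (rule integrable_mult_right)
        show "AE t in lebesgue. (\<lambda>i. (K (X i - of_real t) - K (z0 - of_real t)) / (X i - z0) * h t) \<longlonglongrightarrow> deriv K (z0 - of_real t) * h t"
        proof (intro AE_I2 tendsto_mult tendsto_const)
          fix t :: real
          have "((\<lambda>w. (K (w - of_real t) - K (z0 - of_real t)) / (w - z0)) \<longlongrightarrow> deriv K (z0 - of_real t)) (at z0)"
          proof -
            have "((\<lambda>w. K (w - of_real t)) has_field_derivative (deriv K (z0 - of_real t) * 1)) (at z0)"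
              by (rule DERIV_chain2[OF dK]) (auto intro!: derivative_eq_intros)
            then show ?thesis by (simp add: has_field_derivative_iff)
          qed
          then have "((\<lambda>w. (K (w - of_real t) - K (z0 - of_real t)) / (w - z0)) \<circ> X) \<longlonglongrightarrow> deriv K (z0 - of_real t)"
            using X unfolding tendsto_at_iff_sequentially by auto
          then show "(\<lambda>i. (K (X i - of_real t) - K (z0 - of_real t)) / (X i - z0)) \<longlonglongrightarrow> deriv K (z0 - of_real t)"
            by (simp add: o_def)
        qed
        show "AE t in lebesgue. norm ((K (X i - of_real t) - K (z0 - of_real t)) / (X i - z0) * h t) \<le> D * (cmod (h t) / (1 + \<bar>t\<bar>) ^ n)" for i
        proof (intro AE_I2)
          fix t :: real
          have Xi: "X i \<in> ball z0 1" "X i \<noteq> z0" using X by auto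
          have "cmod (K (X i - of_real t) - K (z0 - of_real t)) \<le> D / (1 + \<bar>t\<bar>) ^ n * cmod (X i - z0)"
          proof (rule field_differentiable_bound[where f = "\<lambda>w. K (w - of_real t)"
            and S = "ball z0 1" and f' = "\<lambda>w. deriv K (w - of_real t)"])
            fix w assume "w \<in> ball z0 1"
            have "((\<lambda>w. K (w - of_real t)) has_field_derivative (deriv K (w - of_real t) * 1)) (at w)"
              by (rule DERIV_chain2[OF dK]) (auto intro!: derivative_eq_intros)
            then show "((\<lambda>w. K (w - of_real t)) has_field_derivative deriv K (w - of_real t)) (at w within ball z0 1)"
              by (simp add: has_field_derivative_at_within)
          qed (use near Xi in auto)
          then have "cmod ((K (X i - of_real t) - K (z0 - of_real t)) / (X i - z0)) \<le> D / (1 + \<bar>t\<bar>) ^ n"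
            using Xi by (simp add: norm_divide divide_simps split: if_splits)
          from mult_right_mono[OF this, of "cmod (h t)"]
          have "norm ((K (X i - of_real t) - K (z0 - of_real t)) / (X i - z0) * h t) \<le> D / (1 + \<bar>t\<bar>) ^ n * cmod (h t)"
            by (subst norm_mult) simp
          also have "\<dots> = D * (cmod (h t) / (1 + \<bar>t\<bar>) ^ n)" by simp
          finally show "norm ((K (X i - of_real t) - K (z0 - of_real t)) / (X i - z0) * h t) \<le> D * (cmod (h t) / (1 + \<bar>t\<bar>) ^ n)" .
        qed
      qed
    qed
    then have "((\<lambda>w. (cconv K h w - cconv K h z0) / (w - z0)) \<longlongrightarrow> cconv (deriv K) h z0) (at z0)"
      using at_within_open[of z0 "ball z0 1"] by simp
    then show ?thesis by (simp add: has_field_derivative_iff)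
  qed
  then show ?thesis unfolding holomorphic_on_def field_differentiable_def by (simp, blast)
qed

text \<open>A power of \<open>1 + |z|\<close> is absorbed by \<open>e\<^bsup>\<epsilon> |z|\<^esup>\<close>, however small \<open>\<epsilon>\<close>.\<close>

lemma exp_type_le_polynomial:
  assumes hol: "u holomorphic_on UNIV" and b: "0 \<le> b"
    and bd: "\<And>z. cmod (u z) \<le> C * (1 + cmod z) ^ n * exp (b * cmod z)"
  shows "exp_type_le b u"
  unfolding exp_type_le_def
proof (intro conjI allI impI hol)
  fix e :: real assume e: "e > 0"
  define d where "d = e / (real n + 1)"
  have d: "d > 0" using e by (simp add: d_def)
  have nd: "real n * d \<le> e" using e by (simp add: d_def field_simps)
  have C: "C \<ge> 0" using order_trans[OF norm_ge_zero bd[of 0]] by simp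
  show "\<exists>A. \<forall>z. cmod (u z) \<le> A * exp ((b + e) * cmod z)"
  proof (intro exI[of _ "C * max 1 (1 / d) ^ n"] allI)
    fix z
    have "(1 + cmod z) ^ n \<le> (max 1 (1 / d) * exp (d * cmod z)) ^ n" using d by (intro power_mono one_plus_le_exp) auto
    also have "\<dots> = max 1 (1 / d) ^ n * exp (real n * d * cmod z)"
      by (simp add: power_mult_distrib exp_of_nat_mult[symmetric] mult.assoc)
    also have "\<dots> \<le> max 1 (1 / d) ^ n * exp (e * cmod z)"
      using nd by (intro mult_left_mono) (auto intro: mult_right_mono)
    finally have "C * (1 + cmod z) ^ n * exp (b * cmod z) \<le> C * (max 1 (1 / d) ^ n * exp (e * cmod z)) * exp (b * cmod z)"
      using C by (intro mult_right_mono mult_left_mono) auto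
    also have "\<dots> = C * max 1 (1 / d) ^ n * exp ((b + e) * cmod z)" by (simp add: distrib_right exp_add)
    finally show "cmod (u z) \<le> C * max 1 (1 / d) ^ n * exp ((b + e) * cmod z)" using bd[of z] by linarith
  qed
qed

lemma cconv_exp_type:
  assumes hol: "K holomorphic_on UNIV" and C: "0 \<le> C" and b: "0 \<le> b"
    and bd: "\<And>z. cmod (K z) \<le> C * exp (b * \<bar>Im z\<bar>) / (1 + cmod z) ^ n"
    and h: "h \<in> borel_measurable lebesgue" and int: "integrable lebesgue (\<lambda>t. cmod (h t) / (1 + \<bar>t\<bar>) ^ n)"
  shows "exp_type_le b (cconv K h)"
proof (rule exp_type_le_polynomial[OF cconv_holomorphic[OF assms] b])
  define I where "I = (\<integral>t. cmod (h t) / (1 + \<bar>t\<bar>) ^ n \<partial>lebesgue)"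
  have I: "I \<ge> 0" unfolding I_def by (rule integral_nonneg_AE) simp
  fix z
  have "cmod (cconv K h z) \<le> C * exp (b * \<bar>Im z\<bar>) * (1 + cmod z) ^ n * I"
    unfolding I_def by (rule cconv_integrable(2)[OF hol C bd h int])
  also have "\<dots> \<le> C * exp (b * cmod z) * (1 + cmod z) ^ n * I"
    using C b I abs_Im_le_cmod[of z] by (intro mult_right_mono mult_left_mono) (auto intro: mult_left_mono)
  finally show "cmod (cconv K h z) \<le> (C * I) * (1 + cmod z) ^ n * exp (b * cmod z)" by (simp add: mult_ac)
qed

lemma exp_type_le_add:
  assumes "exp_type_le b f" "exp_type_le b g" shows "exp_type_le b (\<lambda>z. f z + g z)"
  unfolding exp_type_le_def
proof (intro conjI allI impI)
  show "(\<lambda>z. f z + g z) holomorphic_on UNIV" using assms by (intro holomorphic_intros) (auto simp: exp_type_le_def)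
  fix e :: real assume "e > 0"
  then obtain A B where "\<And>z. cmod (f z) \<le> A * exp ((b + e) * cmod z)" "\<And>z. cmod (g z) \<le> B * exp ((b + e) * cmod z)"
    using assms unfolding exp_type_le_def by meson
  then have "cmod (f z + g z) \<le> (A + B) * exp ((b + e) * cmod z)" for z
    unfolding distrib_right by (intro order_trans[OF norm_triangle_ineq] add_mono)
  then show "\<exists>A. \<forall>z. cmod (f z + g z) \<le> A * exp ((b + e) * cmod z)" by blast
qed

lemma exp_type_le_deriv:
  assumes "exp_type_le b f" "0 \<le> b" shows "exp_type_le b (deriv f)"
  unfolding exp_type_le_def
proof (intro conjI allI impI)
  have hol: "f holomorphic_on UNIV" using assms by (simp add: exp_type_le_def)
  then show "deriv f holomorphic_on UNIV" by (intro holomorphic_intros) auto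
  fix e :: real assume e: "e > 0"
  then obtain A where A: "\<And>z. cmod (f z) \<le> A * exp ((b + e) * cmod z)"
    using assms unfolding exp_type_le_def by meson
  have A0: "A \<ge> 0" using order_trans[OF norm_ge_zero A[of 0]] by simp
  have "cmod (deriv f z) \<le> A * exp (b + e) * exp ((b + e) * cmod z)" for z
  proof (rule deriv_bound_unit_circle[OF hol])
    fix w assume w: "cmod (z - w) = 1"
    have "cmod w \<le> cmod z + 1" using w norm_triangle_ineq2[of w z] by (simp add: norm_minus_commute)
    then have "A * exp ((b + e) * cmod w) \<le> A * exp ((b + e) * (cmod z + 1))"
      using A0 assms(2) e by (intro mult_left_mono) (auto intro: mult_left_mono)
    also have "\<dots> = A * exp (b + e) * exp ((b + e) * cmod z)" by (simp add: distrib_left exp_add)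
    finally show "cmod (f w) \<le> A * exp (b + e) * exp ((b + e) * cmod z)" using A[of w] by linarith
  qed
  then show "\<exists>A. \<forall>z. cmod (deriv f z) \<le> A * exp ((b + e) * cmod z)" by blast
qed

section \<open>Integration by parts against a kernel\<close>

text \<open>The fundamental theorem in integrated form, common to smooth and to absolutely continuous functions.
  Half-open intervals are concatenated without overlap.\<close>

definition primitive_of :: "(real \<Rightarrow> complex) \<Rightarrow> (real \<Rightarrow> complex) \<Rightarrow> bool" where
  "primitive_of D' D \<longleftrightarrow> (\<forall>x y. x \<le> y \<longrightarrow> set_integrable lebesgue {x<..y} D' \<and>
     D y - D x = (LINT t:{x<..y}|lebesgue. D' t))"

text \<open>The sign with which \<open>\<psi> u\<close> enters the tail integral: \<open>\<integral>\<^sub>w\<^sup>\<infinity> \<psi>\<close> for \<open>w \<ge> 0\<close> and \<open>-\<integral>\<^sub>-\<^sub>\<infinity>\<^sup>w \<psi>\<close> for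
  \<open>w < 0\<close>. The tail starting from the nearer infinity is small on both sides; the two formulas
  differ by the full integral of \<open>\<psi>\<close>, which accounts for the term \<open>(\<integral> \<psi>) D x\<close> in the integration by parts.\<close>

definition tail_sign :: "real \<Rightarrow> real \<Rightarrow> real" where
  "tail_sign w u = (if 0 \<le> w then (if w < u then 1 else 0) else (if u \<le> w then -1 else 0))"

definition tail_kernel :: "(real \<Rightarrow> complex) \<Rightarrow> real \<Rightarrow> complex" where
  "tail_kernel \<psi> w = (\<integral>u. of_real (tail_sign w u) * \<psi> u \<partial>lborel)"

lemma tail_sign_measurable [measurable]:
  "(\<lambda>(w, u). tail_sign w u) \<in> borel_measurable (borel \<Otimes>\<^sub>M borel)"
  unfolding tail_sign_def by measurable

lemma nn_integral_tail:
  "(\<integral>\<^sup>+u. ennreal (\<bar>tail_sign w u\<bar> / (1 + \<bar>u\<bar>) ^ 4) \<partial>lborel) \<le> ennreal (1 / (1 + \<bar>w\<bar>) ^ 3)"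
proof -
  have pos: "(\<integral>\<^sup>+u. ennreal (1 / (1 + \<bar>u\<bar>) ^ 4) * indicator {a..} u \<partial>lborel) \<le> ennreal (1 / (1 + a) ^ 3)"
    if a: "0 \<le> a" for a
  proof -
    have "(\<integral>\<^sup>+u. ennreal (1 / (1 + \<bar>u\<bar>) ^ 4) * indicator {a..} u \<partial>lborel) = (\<integral>\<^sup>+u. ennreal (1 / (1 + u) ^ 4) * indicator {a..} u \<partial>lborel)"
      using a by (intro nn_integral_cong) (auto simp: indicator_def)
    also have "\<dots> = ennreal (0 - (- 1 / (3 * (1 + a) ^ 3)))"
    proof (rule nn_integral_FTC_atLeast)
      show "((\<lambda>u. - 1 / (3 * (1 + u) ^ 3)) \<longlongrightarrow> (0::real)) at_top" by real_asymp
      fix x assume x: "a \<le> x"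
      then have nz: "1 + x \<noteq> 0" using a by auto
      show "((\<lambda>u. - 1 / (3 * (1 + u) ^ 3)) has_real_derivative 1 / (1 + x) ^ 4) (at x)"
        using nz by (auto intro!: derivative_eq_intros simp: divide_simps eval_nat_numeral)
      show "0 \<le> 1 / (1 + x) ^ 4" by simp
    qed simp
    also have "\<dots> \<le> ennreal (1 / (1 + a) ^ 3)" using a by (intro ennreal_leI) (simp add: divide_simps)
    finally show ?thesis .
  qed
  show ?thesis
  proof (cases "0 \<le> w")
    case True
    have "(\<integral>\<^sup>+u. ennreal (\<bar>tail_sign w u\<bar> / (1 + \<bar>u\<bar>) ^ 4) \<partial>lborel) \<le> (\<integral>\<^sup>+u. ennreal (1 / (1 + \<bar>u\<bar>) ^ 4) * indicator {w..} u \<partial>lborel)"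
      using True by (intro nn_integral_mono) (auto simp: tail_sign_def indicator_def)
    also have "\<dots> \<le> ennreal (1 / (1 + w) ^ 3)" by (rule pos[OF True])
    finally show ?thesis using True by simp
  next
    case False
    have "(\<integral>\<^sup>+u. ennreal (\<bar>tail_sign w u\<bar> / (1 + \<bar>u\<bar>) ^ 4) \<partial>lborel) \<le> (\<integral>\<^sup>+u. ennreal (1 / (1 + \<bar>u\<bar>) ^ 4) * indicator {..w} u \<partial>lborel)"
      using False by (intro nn_integral_mono) (auto simp: tail_sign_def indicator_def)
    also have "\<dots> = ennreal \<bar>-1\<bar> * (\<integral>\<^sup>+u. ennreal (1 / (1 + \<bar>0 + (-1) * u\<bar>) ^ 4) * indicator {..w} (0 + (-1) * u) \<partial>lborel)"
      by (rule nn_integral_real_affine) auto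
    also have "\<dots> = (\<integral>\<^sup>+u. ennreal (1 / (1 + \<bar>u\<bar>) ^ 4) * indicator {-w..} u \<partial>lborel)"
      by (simp add: indicator_def) (intro nn_integral_cong, auto)
    also have "\<dots> \<le> ennreal (1 / (1 + (- w)) ^ 3)" using False by (intro pos) auto
    finally show ?thesis using False by simp
  qed
qed

lemma integral_tail:
  "integrable lborel (\<lambda>u. \<bar>tail_sign w u\<bar> / (1 + \<bar>u\<bar>) ^ 4)"
  "(\<integral>u. \<bar>tail_sign w u\<bar> / (1 + \<bar>u\<bar>) ^ 4 \<partial>lborel) \<le> 1 / (1 + \<bar>w\<bar>) ^ 3"
proof -
  show int: "integrable lborel (\<lambda>u. \<bar>tail_sign w u\<bar> / (1 + \<bar>u\<bar>) ^ 4)"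
    using nn_integral_tail[of w] by (intro integrableI_nonneg) (auto intro: le_less_trans)
  have "ennreal (\<integral>u. \<bar>tail_sign w u\<bar> / (1 + \<bar>u\<bar>) ^ 4 \<partial>lborel) \<le> ennreal (1 / (1 + \<bar>w\<bar>) ^ 3)"
    using nn_integral_tail[of w] by (subst nn_integral_eq_integral[OF int, symmetric]) auto
  then show "(\<integral>u. \<bar>tail_sign w u\<bar> / (1 + \<bar>u\<bar>) ^ 4 \<partial>lborel) \<le> 1 / (1 + \<bar>w\<bar>) ^ 3"
    by (subst (asm) ennreal_le_iff) auto
qed

lemma tail_kernel_bound:
  assumes m [measurable]: "\<psi> \<in> borel_measurable borel" and bd: "\<And>u. cmod (\<psi> u) \<le> C / (1 + \<bar>u\<bar>) ^ 4"
  shows "integrable lborel (\<lambda>u. of_real (tail_sign w u) * \<psi> u)"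
    "(\<integral>u. cmod (of_real (tail_sign w u) * \<psi> u) \<partial>lborel) \<le> C / (1 + \<bar>w\<bar>) ^ 3"
    "cmod (tail_kernel \<psi> w) \<le> C / (1 + \<bar>w\<bar>) ^ 3"
proof -
  have C: "C \<ge> 0" using order_trans[OF norm_ge_zero bd[of 0]] by simp
  have le: "cmod (of_real (tail_sign w u) * \<psi> u) \<le> C * (\<bar>tail_sign w u\<bar> / (1 + \<bar>u\<bar>) ^ 4)" for u
    using mult_left_mono[OF bd[of u], of "\<bar>tail_sign w u\<bar>"] by (simp add: norm_mult mult_ac)
  have int: "integrable lborel (\<lambda>u. C * (\<bar>tail_sign w u\<bar> / (1 + \<bar>u\<bar>) ^ 4))"
    by (intro integrable_mult_right integral_tail)
  show "integrable lborel (\<lambda>u. of_real (tail_sign w u) * \<psi> u)"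
    by (rule Bochner_Integration.integrable_bound[OF int]) (measurable, use C in \<open>auto intro!: order_trans[OF le]\<close>)
  have "(\<integral>u. cmod (of_real (tail_sign w u) * \<psi> u) \<partial>lborel) \<le> (\<integral>u. C * (\<bar>tail_sign w u\<bar> / (1 + \<bar>u\<bar>) ^ 4) \<partial>lborel)"
    by (rule integral_mono'[OF int le]) (use C in auto)
  also have "\<dots> = C * (\<integral>u. \<bar>tail_sign w u\<bar> / (1 + \<bar>u\<bar>) ^ 4 \<partial>lborel)" by (rule integral_mult_right_zero)
  also have "\<dots> \<le> C * (1 / (1 + \<bar>w\<bar>) ^ 3)" using C by (intro mult_left_mono integral_tail)
  finally show *: "(\<integral>u. cmod (of_real (tail_sign w u) * \<psi> u) \<partial>lborel) \<le> C / (1 + \<bar>w\<bar>) ^ 3" by simp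
  show "cmod (tail_kernel \<psi> w) \<le> C / (1 + \<bar>w\<bar>) ^ 3"
    unfolding tail_kernel_def by (rule order_trans[OF integral_norm_bound *])
qed

lemma tail_kernel_measurable:
  assumes [measurable]: "\<psi> \<in> borel_measurable borel"
  shows "tail_kernel \<psi> \<in> borel_measurable borel"
  unfolding tail_kernel_def[abs_def] by measurable

lemma primitive_of_difference:
  assumes "primitive_of D' D"
  shows "integrable lebesgue (\<lambda>s. of_real (tail_sign (x - s) (x - t)) * D' s)"
    "D x - D t = (\<integral>s. of_real (tail_sign (x - s) (x - t)) * D' s \<partial>lebesgue)"
proof -
  consider "t \<le> x" | "x < t" by linarith
  then have "integrable lebesgue (\<lambda>s. of_real (tail_sign (x - s) (x - t)) * D' s) \<and>
    D x - D t = (\<integral>s. of_real (tail_sign (x - s) (x - t)) * D' s \<partial>lebesgue)"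
  proof cases
    case 1
    have "(\<lambda>s. of_real (tail_sign (x - s) (x - t)) * D' s) = (\<lambda>s. indicator {t<..x} s *\<^sub>R D' s)"
      using 1 by (auto simp: tail_sign_def indicator_def fun_eq_iff)
    then show ?thesis using assms 1 unfolding primitive_of_def set_integrable_def set_lebesgue_integral_def by simp
  next
    case 2
    have eq: "(\<lambda>s. of_real (tail_sign (x - s) (x - t)) * D' s) = (\<lambda>s. - (indicator {x<..t} s *\<^sub>R D' s))"
      using 2 by (auto simp: tail_sign_def indicator_def fun_eq_iff)
    have "integrable lebesgue (\<lambda>s. indicator {x<..t} s *\<^sub>R D' s)" "D t - D x = (\<integral>s. indicator {x<..t} s *\<^sub>R D' s \<partial>lebesgue)"
      using assms 2 unfolding primitive_of_def set_integrable_def set_lebesgue_integral_def by simp_all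
    then show ?thesis unfolding eq by (simp add: algebra_simps)
  qed
  then show "integrable lebesgue (\<lambda>s. of_real (tail_sign (x - s) (x - t)) * D' s)"
    "D x - D t = (\<integral>s. of_real (tail_sign (x - s) (x - t)) * D' s \<partial>lebesgue)" by auto
qed

lemma real_peetre: "1 + \<bar>t\<bar> \<le> (1 + \<bar>x - t\<bar>) * (1 + \<bar>x\<bar>)" for x t :: real
  using peetre[of t "of_real x"] by (simp only: norm_of_real flip: of_real_diff)

lemma decay_shift:
  fixes x t :: real
  assumes "0 \<le> C" shows "C / (1 + \<bar>x - t\<bar>) ^ n \<le> C * (1 + \<bar>x\<bar>) ^ n * (1 / (1 + \<bar>t\<bar>) ^ n)"
proof -
  have le: "(1 + \<bar>t\<bar>) ^ n \<le> (1 + \<bar>x - t\<bar>) ^ n * (1 + \<bar>x\<bar>) ^ n"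
    unfolding power_mult_distrib[symmetric] by (intro power_mono real_peetre) auto
  have pos: "0 < (1 + \<bar>t\<bar>) ^ n" "0 < (1 + \<bar>x - t\<bar>) ^ n" by (auto intro!: zero_less_power add_pos_nonneg)
  have "1 / (1 + \<bar>x - t\<bar>) ^ n \<le> (1 + \<bar>x\<bar>) ^ n / (1 + \<bar>t\<bar>) ^ n" using le pos by (simp add: divide_simps mult_ac)
  from mult_left_mono[OF this assms] show ?thesis by simp
qed

lemma lborel_integral_reflect:
  fixes f :: "real \<Rightarrow> 'a::{banach, second_countable_topology}"
  shows "(\<integral>t. f (x - t) \<partial>lborel) = (\<integral>u. f u \<partial>lborel)"
    "integrable lborel f \<Longrightarrow> integrable lborel (\<lambda>t. f (x - t))"
  using lborel_integral_real_affine[of "-1" f x] lborel_integrable_real_affine[of f "-1" x] by auto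

text \<open>Write \<open>D x - D t\<close> as an integral of \<open>D'\<close> over \<open>s\<close> between \<open>t\<close> and \<open>x\<close> and exchange the two integrations; the
  inner integral over \<open>t\<close> is then the tail integral of \<open>\<psi>\<close> at \<open>x - s\<close>.\<close>

lemma conv_by_parts:
  assumes prim: "primitive_of D' D"
    and m [measurable]: "\<psi> \<in> borel_measurable borel" and bd: "\<And>u. cmod (\<psi> u) \<le> C / (1 + \<bar>u\<bar>) ^ 4"
    and D [measurable]: "D \<in> borel_measurable lebesgue" and D' [measurable]: "D' \<in> borel_measurable lebesgue"
    and int_D: "integrable lebesgue (\<lambda>t. cmod (D t) / (1 + \<bar>t\<bar>) ^ 4)"
    and int_D': "integrable lebesgue (\<lambda>t. cmod (D' t) / (1 + \<bar>t\<bar>) ^ 3)"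
  shows "(\<integral>u. \<psi> u \<partial>lborel) * D x - conv \<psi> D x = conv (tail_kernel \<psi>) D' x"
proof -
  have C: "C \<ge> 0" using order_trans[OF norm_ge_zero bd[of 0]] by simp
  define f where "f s t = of_real (tail_sign (x - s) (x - t)) * \<psi> (x - t) * D' s" for s t
  have [measurable]: "(\<lambda>t. \<psi> (x - t)) \<in> borel_measurable lebesgue" by (rule borel_measurable_lebesgue_diff) fact
  have fm [measurable]: "(\<lambda>(s, t). f s t) \<in> borel_measurable (lebesgue \<Otimes>\<^sub>M lebesgue)"
  proof -
    have "(\<lambda>p. (x - fst p, x - snd p)) \<in> (lebesgue \<Otimes>\<^sub>M lebesgue) \<rightarrow>\<^sub>M (borel \<Otimes>\<^sub>M borel)"
      by (intro measurable_Pair borel_measurable_diff borel_measurable_const lebesgue_pair_fst_snd)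
    from measurable_compose[OF this tail_sign_measurable]
    have a: "(\<lambda>p. of_real (tail_sign (x - fst p) (x - snd p)) :: complex) \<in> borel_measurable (lebesgue \<Otimes>\<^sub>M lebesgue)"
      using borel_measurable_of_real by simp
    have b: "(\<lambda>p :: real \<times> real. \<psi> (x - snd p)) \<in> borel_measurable (lebesgue \<Otimes>\<^sub>M lebesgue)"
      by (intro measurable_compose[OF _ m] borel_measurable_diff borel_measurable_const lebesgue_pair_fst_snd)
    show ?thesis unfolding f_def split_beta
      by (intro borel_measurable_times a b measurable_compose[OF measurable_fst D'])
  qed
  have fm': "(\<lambda>t. of_real (tail_sign (x - s) (x - t)) * \<psi> (x - t)) \<in> borel_measurable lborel" for s
    by measurable
  have int_t: "integrable lebesgue (\<lambda>t. of_real (tail_sign (x - s) (x - t)) * \<psi> (x - t))"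
    and val_t: "(\<integral>t. of_real (tail_sign (x - s) (x - t)) * \<psi> (x - t) \<partial>lebesgue) = tail_kernel \<psi> (x - s)"
    and nrm_t: "(\<integral>t. cmod (of_real (tail_sign (x - s) (x - t)) * \<psi> (x - t)) \<partial>lebesgue) \<le> C / (1 + \<bar>x - s\<bar>) ^ 3" for s
  proof -
    note r = lborel_integral_reflect[where x = x]
    show "integrable lebesgue (\<lambda>t. of_real (tail_sign (x - s) (x - t)) * \<psi> (x - t))"
      using r(2)[OF tail_kernel_bound(1)[OF m bd, of "x - s"]] by (subst integrable_completion[OF fm'])
    show "(\<integral>t. of_real (tail_sign (x - s) (x - t)) * \<psi> (x - t) \<partial>lebesgue) = tail_kernel \<psi> (x - s)"
      using r(1)[of "\<lambda>u. of_real (tail_sign (x - s) u) * \<psi> u"] unfolding tail_kernel_def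
      by (subst integral_completion[OF fm'])
    have "(\<integral>t. cmod (of_real (tail_sign (x - s) (x - t)) * \<psi> (x - t)) \<partial>lebesgue)
      = (\<integral>t. cmod (of_real (tail_sign (x - s) (x - t)) * \<psi> (x - t)) \<partial>lborel)"
      using measurable_compose[OF fm'[of s] borel_measurable_norm] by (rule integral_completion)
    also have "\<dots> = (\<integral>u. cmod (of_real (tail_sign (x - s) u) * \<psi> u) \<partial>lborel)"
      by (rule r(1)[of "\<lambda>u. cmod (of_real (tail_sign (x - s) u) * \<psi> u)"])
    also have "\<dots> \<le> C / (1 + \<bar>x - s\<bar>) ^ 3" by (rule tail_kernel_bound[OF m bd])
    finally show "(\<integral>t. cmod (of_real (tail_sign (x - s) (x - t)) * \<psi> (x - t)) \<partial>lebesgue) \<le> C / (1 + \<bar>x - s\<bar>) ^ 3" .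
  qed
  have int_pair: "integrable (lebesgue \<Otimes>\<^sub>M lebesgue) (\<lambda>(s, t). f s t)"
  proof (rule lebesgue_pair.Fubini_integrable[OF fm])
    show "integrable lebesgue (\<lambda>s. \<integral>t. norm (case (s, t) of (s, t) \<Rightarrow> f s t) \<partial>lebesgue)"
    proof (rule Bochner_Integration.integrable_bound)
      show "integrable lebesgue (\<lambda>s. C * (1 + \<bar>x\<bar>) ^ 3 * (cmod (D' s) / (1 + \<bar>s\<bar>) ^ 3))"
        using int_D' by (rule integrable_mult_right)
      show "(\<lambda>s. \<integral>t. norm (case (s, t) of (s, t) \<Rightarrow> f s t) \<partial>lebesgue) \<in> borel_measurable lebesgue"
        using fm by measurable
      show "AE s in lebesgue. norm (\<integral>t. norm (case (s, t) of (s, t) \<Rightarrow> f s t) \<partial>lebesgue)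
         \<le> norm (C * (1 + \<bar>x\<bar>) ^ 3 * (cmod (D' s) / (1 + \<bar>s\<bar>) ^ 3))"
      proof (intro AE_I2)
        fix s
        have "(\<integral>t. cmod (f s t) \<partial>lebesgue) = (\<integral>t. cmod (of_real (tail_sign (x - s) (x - t)) * \<psi> (x - t)) \<partial>lebesgue) * cmod (D' s)"
          by (simp add: f_def norm_mult)
        also have "\<dots> \<le> (C / (1 + \<bar>x - s\<bar>) ^ 3) * cmod (D' s)" by (intro mult_right_mono nrm_t) auto
        also have "\<dots> \<le> (C * (1 + \<bar>x\<bar>) ^ 3 * (1 / (1 + \<bar>s\<bar>) ^ 3)) * cmod (D' s)"
          by (intro mult_right_mono decay_shift C) auto
        finally have "(\<integral>t. cmod (f s t) \<partial>lebesgue) \<le> C * (1 + \<bar>x\<bar>) ^ 3 * (cmod (D' s) / (1 + \<bar>s\<bar>) ^ 3)" by simp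
        moreover have "0 \<le> (\<integral>t. cmod (f s t) \<partial>lebesgue)" by (rule integral_nonneg_AE) simp
        ultimately show "norm (\<integral>t. norm (case (s, t) of (s, t) \<Rightarrow> f s t) \<partial>lebesgue)
         \<le> norm (C * (1 + \<bar>x\<bar>) ^ 3 * (cmod (D' s) / (1 + \<bar>s\<bar>) ^ 3))" using C by (simp add: abs_mult)
      qed
    qed
    show "AE s in lebesgue. integrable lebesgue (\<lambda>t. case (s, t) of (s, t) \<Rightarrow> f s t)"
      using int_t by (simp add: f_def)
  qed
  have int_psi: "integrable lebesgue (\<lambda>t. \<psi> (x - t))" and val_psi: "(\<integral>t. \<psi> (x - t) \<partial>lebesgue) = (\<integral>u. \<psi> u \<partial>lborel)"
  proof -
    have mm: "(\<lambda>t. \<psi> (x - t)) \<in> borel_measurable lborel" by measurable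
    have "integrable lborel \<psi>" by (rule integrable_lborel_decay[OF m bd]) simp
    from lborel_integral_reflect(2)[OF this] show "integrable lebesgue (\<lambda>t. \<psi> (x - t))"
      by (simp add: integrable_completion[OF mm])
    show "(\<integral>t. \<psi> (x - t) \<partial>lebesgue) = (\<integral>u. \<psi> u \<partial>lborel)"
      by (simp add: integral_completion[OF mm] lborel_integral_reflect)
  qed
  have int_psiD: "integrable lebesgue (\<lambda>t. \<psi> (x - t) * D t)"
  proof (rule Bochner_Integration.integrable_bound)
    show "integrable lebesgue (\<lambda>t. C * (1 + \<bar>x\<bar>) ^ 4 * (cmod (D t) / (1 + \<bar>t\<bar>) ^ 4))"
      using int_D by (rule integrable_mult_right)
    show "AE t in lebesgue. norm (\<psi> (x - t) * D t) \<le> norm (C * (1 + \<bar>x\<bar>) ^ 4 * (cmod (D t) / (1 + \<bar>t\<bar>) ^ 4))"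
    proof (intro AE_I2)
      fix t
      have "cmod (\<psi> (x - t) * D t) \<le> (C * (1 + \<bar>x\<bar>) ^ 4 * (1 / (1 + \<bar>t\<bar>) ^ 4)) * cmod (D t)"
        unfolding norm_mult by (intro mult_right_mono order_trans[OF bd] decay_shift C) auto
      then show "norm (\<psi> (x - t) * D t) \<le> norm (C * (1 + \<bar>x\<bar>) ^ 4 * (cmod (D t) / (1 + \<bar>t\<bar>) ^ 4))" using C by simp
    qed
  qed measurable
  have "(\<integral>u. \<psi> u \<partial>lborel) * D x - conv \<psi> D x = (\<integral>t. \<psi> (x - t) * D x - \<psi> (x - t) * D t \<partial>lebesgue)"
    unfolding conv_def val_psi[symmetric] using int_psi int_psiD by simp
  also have "\<dots> = (\<integral>t. (\<integral>s. f s t \<partial>lebesgue) \<partial>lebesgue)"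
  proof (intro Bochner_Integration.integral_cong refl)
    fix t
    have "\<psi> (x - t) * D x - \<psi> (x - t) * D t = \<psi> (x - t) * (D x - D t)" by (simp add: algebra_simps)
    also have "\<dots> = (\<integral>s. \<psi> (x - t) * (of_real (tail_sign (x - s) (x - t)) * D' s) \<partial>lebesgue)"
      unfolding primitive_of_difference(2)[OF prim] by simp
    also have "\<dots> = (\<integral>s. f s t \<partial>lebesgue)" by (simp add: f_def mult_ac)
    finally show "\<psi> (x - t) * D x - \<psi> (x - t) * D t = (\<integral>s. f s t \<partial>lebesgue)" .
  qed
  also have "\<dots> = (\<integral>s. (\<integral>t. f s t \<partial>lebesgue) \<partial>lebesgue)"
    using lebesgue_pair.Fubini_integral[of f] int_pair by simp
  also have "\<dots> = conv (tail_kernel \<psi>) D' x"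
    unfolding conv_def f_def using val_t by simp
  finally show ?thesis .
qed

lemma integral_halfline_FTC:
  fixes G g :: "real \<Rightarrow> complex"
  assumes G: "\<And>x. (G has_vector_derivative g x) (at x)" and g: "continuous_on UNIV g" and int: "integrable lborel g"
    and top: "(G \<longlongrightarrow> 0) at_top" and bot: "(G \<longlongrightarrow> 0) at_bot"
  shows "(\<integral>u. indicator {w<..} u *\<^sub>R g u \<partial>lborel) = - G w" "(\<integral>u. indicator {..w} u *\<^sub>R g u \<partial>lborel) = G w"
proof -
  have cont: "isCont g x" for x using g by (simp add: continuous_on_eq_continuous_at)
  have GC: "isCont G x" for x using G[of x] by (rule has_vector_derivative_continuous)
  have si: "set_integrable lborel A g" if "A \<in> sets borel" for A
    unfolding set_integrable_def using int that by (simp add: integrable_mult_indicator)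
  have "(LBINT x=ereal w..\<infinity>. g x) = 0 - G w"
  proof (rule interval_integral_FTC_integrable)
    show "((G \<circ> real_of_ereal) \<longlongrightarrow> G w) (at_right (ereal w))"
      using GC[of w] by (simp add: ereal_tendsto_simps isCont_def filterlim_at_split)
    show "((G \<circ> real_of_ereal) \<longlongrightarrow> 0) (at_left \<infinity>)" using top by (simp add: ereal_tendsto_simps)
  qed (use G cont si in auto)
  then show "(\<integral>u. indicator {w<..} u *\<^sub>R g u \<partial>lborel) = - G w"
    by (simp add: interval_lebesgue_integral_def set_lebesgue_integral_def einterval_def greaterThan_def)
  have "(LBINT x=-\<infinity>..ereal w. g x) = G w - 0"
  proof (rule interval_integral_FTC_integrable)
    show "((G \<circ> real_of_ereal) \<longlongrightarrow> G w) (at_left (ereal w))"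
      using GC[of w] by (simp add: ereal_tendsto_simps isCont_def filterlim_at_split)
    show "((G \<circ> real_of_ereal) \<longlongrightarrow> 0) (at_right (-\<infinity>))" using bot by (simp add: ereal_tendsto_simps)
  qed (use G cont si in auto)
  then have "(\<integral>u. indicator {..<w} u *\<^sub>R g u \<partial>lborel) = G w"
    by (simp add: interval_lebesgue_integral_def set_lebesgue_integral_def einterval_def lessThan_def)
  moreover have "(\<integral>u. indicator {..w} u *\<^sub>R g u \<partial>lborel) = (\<integral>u. indicator {..<w} u *\<^sub>R g u \<partial>lborel)"
  proof (rule integral_cong_AE)
    show "AE u in lborel. indicator {..w} u *\<^sub>R g u = indicator {..<w} u *\<^sub>R g u"
      using AE_lborel_singleton[of w] by eventually_elim (auto simp: indicator_def)
  qed (use int in auto)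
  ultimately show "(\<integral>u. indicator {..w} u *\<^sub>R g u \<partial>lborel) = G w" by simp
qed

lemma decay_tendsto_zero:
  assumes "\<And>t. cmod (f t) \<le> C / (1 + \<bar>t\<bar>) ^ 4"
  shows "(f \<longlongrightarrow> 0) at_top" "(f \<longlongrightarrow> 0) at_bot"
proof -
  have "((\<lambda>t. C / (1 + \<bar>t\<bar>) ^ 4) \<longlongrightarrow> 0) at_top" "((\<lambda>t. C / (1 + \<bar>t\<bar>) ^ 4) \<longlongrightarrow> 0) at_bot"
    by real_asymp+
  then show "(f \<longlongrightarrow> 0) at_top" "(f \<longlongrightarrow> 0) at_bot"
    by (auto intro!: Lim_null_comparison[of f "\<lambda>t. C / (1 + \<bar>t\<bar>) ^ 4"] always_eventually assms)
qed

text \<open>The fundamental theorem on the two half-lines, as \<open>K\<close> vanishes at both ends. Thus integration by parts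
  against \<open>K'\<close> takes its classical form without boundary term.\<close>

lemma tail_kernel_deriv:
  assumes hol: "K holomorphic_on UNIV" and bd: "\<And>t. cmod (K (of_real t)) \<le> C / (1 + \<bar>t\<bar>) ^ 4"
    and bd': "\<And>t. cmod (deriv K (of_real t)) \<le> C' / (1 + \<bar>t\<bar>) ^ 4"
  shows "tail_kernel (\<lambda>t. deriv K (of_real t)) w = - K (of_real w)" "(\<integral>t. deriv K (of_real t) \<partial>lborel) = 0"
proof -
  have hol': "deriv K holomorphic_on UNIV" by (intro holomorphic_intros hol) auto
  have int: "integrable lborel (\<lambda>t. deriv K (of_real t))"
    by (rule integrable_lborel_decay[OF holomorphic_on_UNIV_measurable[OF hol'] bd']) simp
  have cont: "continuous_on UNIV (\<lambda>t::real. deriv K (of_real t))"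
    by (intro continuous_on_compose2[OF holomorphic_on_imp_continuous_on[OF hol']] continuous_intros) auto
  note FTC = integral_halfline_FTC[OF has_vector_derivative_of_entire[OF hol] cont int decay_tendsto_zero[OF bd]]
  show "tail_kernel (\<lambda>t. deriv K (of_real t)) w = - K (of_real w)"
  proof (cases "0 \<le> w")
    case True
    then have "tail_kernel (\<lambda>t. deriv K (of_real t)) w = (\<integral>u. indicator {w<..} u *\<^sub>R deriv K (of_real u) \<partial>lborel)"
      unfolding tail_kernel_def by (intro Bochner_Integration.integral_cong) (auto simp: tail_sign_def indicator_def)
    with FTC(1) show ?thesis by simp
  next
    case False
    then have "tail_kernel (\<lambda>t. deriv K (of_real t)) w = (\<integral>u. - (indicator {..w} u *\<^sub>R deriv K (of_real u)) \<partial>lborel)"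
      unfolding tail_kernel_def by (intro Bochner_Integration.integral_cong) (auto simp: tail_sign_def indicator_def)
    with FTC(2) show ?thesis by simp
  qed
  have "(\<integral>t. deriv K (of_real t) \<partial>lborel) = (\<integral>u. indicator {0<..} u *\<^sub>R deriv K (of_real u) + indicator {..0} u *\<^sub>R deriv K (of_real u) \<partial>lborel)"
    by (intro Bochner_Integration.integral_cong) (auto simp: indicator_def)
  also have "\<dots> = - K (of_real 0) + K (of_real 0)"
    using FTC[of 0] int by (subst Bochner_Integration.integral_add) (auto intro!: integrable_mult_indicator)
  finally show "(\<integral>t. deriv K (of_real t) \<partial>lborel) = 0" by simp
qed

subsection \<open>The scaled kernels\<close>

lemma tail_kernel_scaled:
  assumes "l > 0"
  shows "tail_kernel (\<lambda>t. scaled_kernel l (of_real t)) w = tail_kernel (\<lambda>t. rep_kernel (of_real t)) (l * w)"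
proof -
  have sgn: "tail_sign (l * w) (0 + l * u) = tail_sign w u" for u
    using assms by (simp add: tail_sign_def zero_le_mult_iff)
  have "tail_kernel (\<lambda>t. rep_kernel (of_real t)) (l * w)
     = \<bar>l\<bar> *\<^sub>R (\<integral>u. of_real (tail_sign (l * w) (0 + l * u)) * rep_kernel (of_real (0 + l * u)) \<partial>lborel)"
    unfolding tail_kernel_def by (rule lborel_integral_real_affine) (use assms in auto)
  also have "\<dots> = (\<integral>u. \<bar>l\<bar> *\<^sub>R (of_real (tail_sign w u) * rep_kernel (of_real (0 + l * u))) \<partial>lborel)"
    unfolding sgn by simp
  also have "\<dots> = tail_kernel (\<lambda>t. scaled_kernel l (of_real t)) w"
    unfolding tail_kernel_def using assms
    by (intro Bochner_Integration.integral_cong) (auto simp: scaled_kernel_def scaleR_conv_of_real)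
  finally show ?thesis ..
qed

lemma scaled_decay_le_poisson:
  assumes "l > 0" "2 \<le> n" shows "1 / (1 + \<bar>l * t\<bar>) ^ n \<le> pi / l * poisson_kernel (1 / l) t"
proof -
  have "1 / (1 + \<bar>l * t\<bar>) ^ n \<le> 1 / (1 + (l * t)\<^sup>2)" by (rule square_weight_dominates) fact
  also have "\<dots> = pi / l * poisson_kernel (1 / l) t"
  proof -
    have "(1 / l)\<^sup>2 + t\<^sup>2 = (1 + (l * t)\<^sup>2) / l\<^sup>2" using assms by (simp add: field_simps)
    then show ?thesis using assms by (simp add: poisson_kernel_def power2_eq_square)
  qed
  finally show ?thesis .
qed

lemma deriv_scaled_kernel: "deriv (scaled_kernel l) z = of_real (l\<^sup>2) * deriv rep_kernel (of_real l * z)"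
proof (rule DERIV_imp_deriv)
  have "(rep_kernel has_field_derivative deriv rep_kernel (of_real l * z)) (at (of_real l * z))"
    using holomorphic_derivI[OF rep_kernel_holomorphic[of UNIV], of "of_real l * z"] by simp
  from DERIV_chain2[where g = "\<lambda>z. of_real l * z" and x = z and Db = "of_real l" and s = UNIV, OF this]
  have "((\<lambda>z. rep_kernel (of_real l * z)) has_field_derivative deriv rep_kernel (of_real l * z) * of_real l) (at z)"
    by (auto intro!: derivative_eq_intros)
  from DERIV_cmult[OF this, of "of_real l"]
  show "(scaled_kernel l has_field_derivative of_real (l\<^sup>2) * deriv rep_kernel (of_real l * z)) (at z)"
    unfolding scaled_kernel_def[abs_def] by (simp add: power2_eq_square mult_ac)
qed

lemma scaled_kernel_decay:
  assumes "l > 0"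
  obtains C where "C > 0" "\<And>z. cmod (scaled_kernel l z) \<le> C * exp (12 * l * \<bar>Im z\<bar>) / (1 + cmod z) ^ 4"
proof -
  obtain C where C: "C > 0" "\<And>z. cmod (rep_kernel z) \<le> C * exp (12 * \<bar>Im z\<bar>) / (1 + cmod z) ^ 4"
    using rep_kernel_bound by metis
  define m where "m = min 1 l"
  have m: "0 < m" "m \<le> 1" "m \<le> l" using assms by (auto simp: m_def)
  have "cmod (scaled_kernel l z) \<le> (l * C / m ^ 4) * exp (12 * l * \<bar>Im z\<bar>) / (1 + cmod z) ^ 4" for z
  proof -
    have "m * 1 + m * cmod z \<le> 1 + l * cmod z" using m by (intro add_mono mult_right_mono) auto
    then have mm: "m * (1 + cmod z) \<le> 1 + cmod (of_real l * z)" using assms by (simp add: distrib_left norm_mult)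
    have pos: "0 < 1 + cmod z" by (simp add: add_pos_nonneg)
    have "cmod (scaled_kernel l z) = l * cmod (rep_kernel (of_real l * z))"
      using assms by (simp add: scaled_kernel_def norm_mult)
    also have "\<dots> \<le> l * (C * exp (12 * \<bar>Im (of_real l * z)\<bar>) / (1 + cmod (of_real l * z)) ^ 4)"
      using assms by (intro mult_left_mono C) auto
    also have "12 * \<bar>Im (of_real l * z)\<bar> = 12 * l * \<bar>Im z\<bar>" using assms by (simp add: abs_mult)
    also have "l * (C * exp (12 * l * \<bar>Im z\<bar>) / (1 + cmod (of_real l * z)) ^ 4) \<le> l * (C * exp (12 * l * \<bar>Im z\<bar>) / (m * (1 + cmod z)) ^ 4)"
      using assms C m mm pos
        by (intro mult_left_mono divide_left_mono power_mono mult_pos_pos zero_less_power mult_nonneg_nonneg) (auto simp: add_pos_nonneg)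
    also have "\<dots> = (l * C / m ^ 4) * exp (12 * l * \<bar>Im z\<bar>) / (1 + cmod z) ^ 4" by (simp add: power_mult_distrib)
    finally show ?thesis .
  qed
  moreover have "0 < l * C / m ^ 4" using assms C m by simp
  ultimately show thesis using that by blast
qed

lemma scaled_kernel_real_measurable [measurable]:
  "(\<lambda>t. scaled_kernel l (of_real t)) \<in> borel_measurable borel"
  "(\<lambda>t. deriv (scaled_kernel l) (of_real t)) \<in> borel_measurable borel"
  by (rule holomorphic_on_UNIV_measurable, rule scaled_kernel_holomorphic)
     (rule holomorphic_on_UNIV_measurable, intro holomorphic_intros scaled_kernel_holomorphic, simp)

text \<open>Decay of order at least 2, dilated by \<open>l\<close>, is dominated by a Poisson kernel of width \<open>1 / l\<close>. The tail
  integral loses one of the four orders of decay, so 3 remain. Differentiation brings a factor \<open>l\<close>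
  and integration a factor \<open>1 / l\<close>.\<close>

lemma scaled_kernel_poisson_bounds:
  obtains A where "A > 0"
    "\<And>l t. l > 0 \<Longrightarrow> cmod (scaled_kernel l (of_real t)) \<le> A * poisson_kernel (1 / l) t"
    "\<And>l t. l > 0 \<Longrightarrow> cmod (deriv (scaled_kernel l) (of_real t)) \<le> (A * l) * poisson_kernel (1 / l) t"
    "\<And>l t. l > 0 \<Longrightarrow> cmod (tail_kernel (\<lambda>t. scaled_kernel l (of_real t)) t) \<le> (A / l) * poisson_kernel (1 / l) t"
proof -
  obtain C where C: "C > 0" "\<And>z. cmod (rep_kernel z) \<le> C * exp (12 * \<bar>Im z\<bar>) / (1 + cmod z) ^ 4"
    using rep_kernel_bound by metis
  define C' where "C' = C * exp 12 * 2 ^ 4"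
  have C': "C' > 0" "C \<le> C'"
  proof -
    show "C' > 0" using C by (simp add: C'_def)
    have "1 * 1 \<le> exp (12::real) * 2 ^ 4" by (intro mult_mono) auto
    from mult_left_mono[OF this, of C] show "C \<le> C'" using C by (simp add: C'_def mult.assoc)
  qed
  have rb: "cmod (rep_kernel (of_real t)) \<le> C / (1 + \<bar>t\<bar>) ^ 4" for t using C(2)[of "of_real t"] by simp
  have drb: "cmod (deriv rep_kernel (of_real t)) \<le> C' / (1 + \<bar>t\<bar>) ^ 4" for t
    using deriv_decay[OF rep_kernel_holomorphic _ _ C(2), of "of_real t"] C by (simp add: C'_def)
  define A where "A = C' * pi"
  have A: "A > 0" using C' by (simp add: A_def)
  moreover have "cmod (scaled_kernel l (of_real t)) \<le> A * poisson_kernel (1 / l) t" if l: "l > 0" for l t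
  proof -
    have "cmod (scaled_kernel l (of_real t)) = l * cmod (rep_kernel (of_real (l * t)))"
      using l by (simp add: scaled_kernel_def norm_mult)
    also have "\<dots> \<le> l * (C' * (1 / (1 + \<bar>l * t\<bar>) ^ 4))"
      using l C' by (intro mult_left_mono order_trans[OF rb]) (auto intro!: divide_right_mono)
    also have "\<dots> \<le> l * (C' * (pi / l * poisson_kernel (1 / l) t))"
      using l C' by (intro mult_left_mono scaled_decay_le_poisson) auto
    finally show ?thesis using l by (simp add: A_def)
  qed
  moreover have "cmod (deriv (scaled_kernel l) (of_real t)) \<le> (A * l) * poisson_kernel (1 / l) t" if l: "l > 0" for l t
  proof -
    have "cmod (deriv (scaled_kernel l) (of_real t)) = l\<^sup>2 * cmod (deriv rep_kernel (of_real (l * t)))"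
      using l by (simp add: deriv_scaled_kernel norm_mult norm_power)
    also have "\<dots> \<le> l\<^sup>2 * (C' * (1 / (1 + \<bar>l * t\<bar>) ^ 4))"
      using l C' drb[of "l * t"] by (intro mult_left_mono) auto
    also have "\<dots> \<le> l\<^sup>2 * (C' * (pi / l * poisson_kernel (1 / l) t))"
      using l C' by (intro mult_left_mono scaled_decay_le_poisson) auto
    finally show ?thesis using l by (simp add: A_def power2_eq_square mult_ac)
  qed
  moreover have "cmod (tail_kernel (\<lambda>t. scaled_kernel l (of_real t)) t) \<le> (A / l) * poisson_kernel (1 / l) t"
    if l: "l > 0" for l t
  proof -
    have "cmod (tail_kernel (\<lambda>t. scaled_kernel l (of_real t)) t) \<le> C / (1 + \<bar>l * t\<bar>) ^ 3"
      unfolding tail_kernel_scaled[OF l]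
      by (rule tail_kernel_bound(3)[OF holomorphic_on_UNIV_measurable[OF rep_kernel_holomorphic] rb])
    also have "\<dots> \<le> C' * (1 / (1 + \<bar>l * t\<bar>) ^ 3)" using C' by (auto intro!: divide_right_mono)
    also have "\<dots> \<le> C' * (pi / l * poisson_kernel (1 / l) t)"
      using l C' by (intro mult_left_mono scaled_decay_le_poisson) auto
    finally show ?thesis by (simp add: A_def)
  qed
  ultimately show thesis by (rule that)
qed

text \<open>The kernel reproduces the constant 1.\<close>

lemma scaled_kernel_integral:
  assumes "l > 0" shows "(\<integral>t. scaled_kernel l (of_real t) \<partial>lborel) = 1"
proof -
  have b: "cmod 1 \<le> 1 * (1 + cmod z) * exp (6 * l * \<bar>Im z\<bar>)" for z
  proof -
    have "1 * 1 \<le> (1 + cmod z) * exp (6 * l * \<bar>Im z\<bar>)" using assms by (intro mult_mono) auto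
    then show ?thesis by simp
  qed
  have "1 = conv (\<lambda>t. scaled_kernel l (of_real t)) (\<lambda>t. 1) 0"
    using scaled_kernel_reproduces[OF assms, of "\<lambda>z. 1" 1 0] b by simp
  also have "\<dots> = (\<integral>t. scaled_kernel l (of_real (0 - t)) \<partial>lborel)"
    unfolding conv_def using measurable_compose[of "\<lambda>t::real. 0 - t" lborel borel, OF _ scaled_kernel_real_measurable(1)]
    by (subst integral_completion) auto
  also have "\<dots> = (\<integral>t. scaled_kernel l (of_real t) \<partial>lborel)" by (rule lborel_integral_reflect)
  finally show ?thesis ..
qed

section \<open>Absolutely continuous functions\<close>

subsection \<open>Families of non-overlapping intervals\<close>

text \<open>Intervals are indexed by an arbitrary type, rather than collected as a set of pairs of end points, so that
  families can be cut, extended, and refined by a family inside each interval.\<close>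

definition interval_family :: "'i set \<Rightarrow> ('i \<Rightarrow> real) \<Rightarrow> ('i \<Rightarrow> real) \<Rightarrow> real \<Rightarrow> real \<Rightarrow> bool" where
  "interval_family I u v a b \<longleftrightarrow> finite I \<and> (\<forall>i\<in>I. a \<le> u i \<and> u i \<le> v i \<and> v i \<le> b) \<and>
     disjoint_family_on (\<lambda>i. {u i<..<v i}) I"

lemma interval_family_length:
  assumes "interval_family I u v a b" "a \<le> b"
  shows "(\<Sum>i\<in>I. v i - u i) \<le> b - a"
proof -
  have uv: "finite I" "\<And>i. i \<in> I \<Longrightarrow> a \<le> u i \<and> u i \<le> v i \<and> v i \<le> b" "disjoint_family_on (\<lambda>i. {u i<..<v i}) I"
    using assms by (auto simp: interval_family_def)
  have "(\<Sum>i\<in>I. v i - u i) = (\<Sum>i\<in>I. measure lborel {u i<..<v i})"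
    using uv by (intro sum.cong) auto
  also have "\<dots> = measure lborel (\<Union>i\<in>I. {u i<..<v i})"
    using uv by (intro measure_finite_Union[symmetric]) auto
  also have "\<dots> \<le> measure lborel {a..b}"
  proof (rule measure_mono_fmeasurable)
    show "(\<Union>i\<in>I. {u i<..<v i}) \<subseteq> {a..b}" using uv(2) by force
    show "{a..b} \<in> fmeasurable lborel" by (intro fmeasurableI) (auto simp: assms)
  qed (use uv in auto)
  also have "\<dots> = b - a" using assms by simp
  finally show ?thesis .
qed

text \<open>Intervals of length 0 may occur repeatedly in an indexed family. They contribute nothing and are removed
  first; the indexing of the others by their end points is injective.\<close>

lemma abs_cont_on_family:
  fixes h :: "real \<Rightarrow> complex"
  assumes "abs_cont_on a b h" "e > 0"
  shows "\<exists>d>0. \<forall>I (u :: 'i \<Rightarrow> real) v. interval_family I u v a b \<longrightarrow> (\<Sum>i\<in>I. v i - u i) < d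
      \<longrightarrow> (\<Sum>i\<in>I. cmod (h (v i) - h (u i))) < e"
proof -
  obtain d where d: "d > 0" "\<And>D. finite D \<Longrightarrow> (\<forall>(u, v)\<in>D. a \<le> u \<and> u \<le> v \<and> v \<le> b) \<Longrightarrow>
     disjoint_family_on (\<lambda>(u, v). {u<..<v}) D \<Longrightarrow>
     (\<Sum>(u, v)\<in>D. v - u) < d \<Longrightarrow> (\<Sum>(u, v)\<in>D. cmod (h v - h u)) < e"
    using assms unfolding abs_cont_on_def by meson
  show ?thesis
  proof (intro exI[of _ d] conjI allI impI d(1))
    fix I and u v :: "'i \<Rightarrow> real"
    assume F: "interval_family I u v a b" and len: "(\<Sum>i\<in>I. v i - u i) < d"
    define J where "J = {i \<in> I. u i < v i}"
    define f where "f i = (u i, v i)" for i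
    have J: "finite J" "J \<subseteq> I" and ui: "\<And>i. i \<in> I \<Longrightarrow> a \<le> u i \<and> u i \<le> v i \<and> v i \<le> b"
      and dj: "\<And>i j. i \<in> I \<Longrightarrow> j \<in> I \<Longrightarrow> i \<noteq> j \<Longrightarrow> {u i<..<v i} \<inter> {u j<..<v j} = {}"
      using F by (auto simp: J_def interval_family_def disjoint_family_on_def)
    have inj: "inj_on f J"
    proof (rule inj_onI, rule ccontr)
      fix i j assume ij: "i \<in> J" "j \<in> J" "f i = f j" "i \<noteq> j"
      then have "{u i<..<v i} = {}" using dj[of i j] J(2) by (auto simp: f_def)
      then show False using ij by (auto simp: J_def)
    qed
    have z: "\<And>g. (\<And>i. i \<in> I - J \<Longrightarrow> g i = 0) \<Longrightarrow> sum g I = sum g J" for g :: "'i \<Rightarrow> real"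
      using J F by (intro sum.mono_neutral_right) (auto simp: interval_family_def)
    have eq: "u i = v i" if "i \<in> I - J" for i using that ui[of i] by (auto simp: J_def)
    have "(\<Sum>(u, v)\<in>f ` J. cmod (h v - h u)) < e"
    proof (rule d(2))
      show "disjoint_family_on (\<lambda>(u, v). {u<..<v}) (f ` J)"
        unfolding disjoint_family_on_def
      proof (intro ballI impI)
        fix m n assume mn: "m \<in> f ` J" "n \<in> f ` J" "m \<noteq> n"
        then obtain i j where ij: "i \<in> J" "j \<in> J" "m = f i" "n = f j" by auto
        with mn have "i \<noteq> j" by auto
        with ij dj[of i j] J(2) show "(case m of (u, v) \<Rightarrow> {u<..<v}) \<inter> (case n of (u, v) \<Rightarrow> {u<..<v}) = {}"
          by (auto simp: f_def)
      qed
      have "(\<Sum>(u, v)\<in>f ` J. v - u) = (\<Sum>i\<in>J. v i - u i)" unfolding sum.reindex[OF inj] by (simp add: f_def)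
      also have "\<dots> = (\<Sum>i\<in>I. v i - u i)" by (rule z[symmetric]) (use eq in auto)
      finally show "(\<Sum>(u, v)\<in>f ` J. v - u) < d" using len by simp
    qed (use J ui in \<open>auto simp: f_def\<close>)
    also have "(\<Sum>(u, v)\<in>f ` J. cmod (h v - h u)) = (\<Sum>i\<in>J. cmod (h (v i) - h (u i)))"
      unfolding sum.reindex[OF inj] by (simp add: f_def)
    also have "\<dots> = (\<Sum>i\<in>I. cmod (h (v i) - h (u i)))" by (rule z[symmetric]) (use eq in auto)
    finally show "(\<Sum>i\<in>I. cmod (h (v i) - h (u i))) < e" .
  qed
qed

subsection \<open>The total variation\<close>

definition variation_sums :: "(real \<Rightarrow> complex) \<Rightarrow> real \<Rightarrow> real \<Rightarrow> real set" where
  "variation_sums h a b = {(\<Sum>i\<in>I. cmod (h (v i) - h (u i))) | (I :: nat set) u v. interval_family I u v a b}"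

definition variation :: "(real \<Rightarrow> complex) \<Rightarrow> real \<Rightarrow> real \<Rightarrow> real" where
  "variation h a b = Sup (variation_sums h a b)"

lemma variation_sumsI:
  "interval_family (I :: nat set) u v a b \<Longrightarrow> (\<Sum>i\<in>I. cmod (h (v i) - h (u i))) \<in> variation_sums h a b"
  unfolding variation_sums_def by blast

lemma interval_family_mono: "interval_family I u v a b \<Longrightarrow> a' \<le> a \<Longrightarrow> b \<le> b' \<Longrightarrow> interval_family I u v a' b'"
  unfolding interval_family_def by (meson order_trans)

lemma zero_in_variation_sums: "0 \<in> variation_sums h a b"
  using variation_sumsI[of "{}" "\<lambda>_. 0" "\<lambda>_. 0" a b h] by (simp add: interval_family_def disjoint_family_on_def)

locale bounded_variation_interval =
  fixes h :: "real \<Rightarrow> complex" and a b :: real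
  assumes bdd: "bdd_above (variation_sums h a b)" and ab: "a \<le> b"
begin

lemma bdd_sub: "a \<le> x \<Longrightarrow> y \<le> b \<Longrightarrow> bdd_above (variation_sums h x y)"
  by (rule bdd_above_mono[OF bdd]) (auto simp: variation_sums_def intro: interval_family_mono)

lemma variation_upper:
  "a \<le> x \<Longrightarrow> y \<le> b \<Longrightarrow> interval_family (I :: nat set) u v x y \<Longrightarrow> (\<Sum>i\<in>I. cmod (h (v i) - h (u i))) \<le> variation h x y"
  unfolding variation_def by (intro cSup_upper variation_sumsI bdd_sub)

lemma variation_least:
  assumes "\<And>I u v. interval_family (I :: nat set) u v x y \<Longrightarrow> (\<Sum>i\<in>I. cmod (h (v i) - h (u i))) \<le> c"
  shows "variation h x y \<le> c"
  unfolding variation_def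
proof (rule cSup_least)
  show "variation_sums h x y \<noteq> {}" using zero_in_variation_sums[of h x y] by blast
qed (use assms in \<open>auto simp: variation_sums_def\<close>)

text \<open>Append the interval from \<open>x\<close> to \<open>y\<close> to a family in \<open>[a, x]\<close>.\<close>

lemma variation_increment:
  assumes "a \<le> x" "x \<le> y" "y \<le> b"
  shows "variation h a x + cmod (h y - h x) \<le> variation h a y"
proof -
  have "variation h a x \<le> variation h a y - cmod (h y - h x)"
  proof (rule variation_least)
    fix I :: "nat set" and u v assume F: "interval_family I u v a x"
    then have "finite I" by (simp add: interval_family_def)
    then obtain n where n: "n \<notin> I" using ex_new_if_finite infinite_UNIV_nat by blast
    define u' v' where "u' = u(n := x)" and "v' = v(n := y)"
    have "interval_family (insert n I) u' v' a y"
    proof -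
      have ui: "\<And>i. i \<in> I \<Longrightarrow> a \<le> u i \<and> u i \<le> v i \<and> v i \<le> x" using F by (auto simp: interval_family_def)
      have sub: "(\<lambda>i. {u' i<..<v' i}) i = {u i<..<v i}" if "i \<in> I" for i using that n by (auto simp: u'_def v'_def)
      have dj: "disjoint_family_on (\<lambda>i. {u' i<..<v' i}) I"
        using F n sub unfolding interval_family_def disjoint_family_on_def by (metis (no_types, lifting))
      have "{u' n<..<v' n} \<inter> (\<Union>i\<in>I. {u' i<..<v' i}) = {}"
      proof -
        have "{u' i<..<v' i} \<subseteq> {..x}" if "i \<in> I" for i using sub[OF that] ui[OF that] by auto
        moreover have "{u' n<..<v' n} \<inter> {..x} = {}" by (auto simp: u'_def v'_def)
        ultimately show ?thesis by blast
      qed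
      then have "disjoint_family_on (\<lambda>i. {u' i<..<v' i}) (insert n I)"
        using dj n by (subst disjoint_family_on_insert) auto
      then show ?thesis using F assms ui n unfolding interval_family_def
        by (auto simp: u'_def v'_def intro: order_trans)
    qed
    from variation_upper[OF order_refl _ this]
    have "(\<Sum>i\<in>insert n I. cmod (h (v' i) - h (u' i))) \<le> variation h a y" using assms by simp
    also have "(\<Sum>i\<in>insert n I. cmod (h (v' i) - h (u' i))) = cmod (h y - h x) + (\<Sum>i\<in>I. cmod (h (v' i) - h (u' i)))"
      using \<open>finite I\<close> n by (simp add: u'_def v'_def)
    also have "(\<Sum>i\<in>I. cmod (h (v' i) - h (u' i))) = (\<Sum>i\<in>I. cmod (h (v i) - h (u i)))"
      using n by (intro sum.cong) (auto simp: u'_def v'_def)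
    finally show "(\<Sum>i\<in>I. cmod (h (v i) - h (u i))) \<le> variation h a y - cmod (h y - h x)" by simp
  qed
  then show ?thesis by simp
qed

text \<open>Cut every interval of the family at \<open>x\<close>; an interval that contains \<open>x\<close> is split by the triangle inequality.\<close>

lemma variation_split:
  assumes "a \<le> x" "x \<le> y" "y \<le> b"
  shows "variation h a y \<le> variation h a x + variation h x y"
proof (rule variation_least)
  fix I :: "nat set" and u v assume F: "interval_family I u v a y"
  have ui: "\<And>i. i \<in> I \<Longrightarrow> a \<le> u i \<and> u i \<le> v i \<and> v i \<le> y" and fin: "finite I"
    and dj: "\<And>i j. i \<in> I \<Longrightarrow> j \<in> I \<Longrightarrow> i \<noteq> j \<Longrightarrow> {u i<..<v i} \<inter> {u j<..<v j} = {}"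
    using F by (auto simp: interval_family_def disjoint_family_on_def)
  have F1: "interval_family I (\<lambda>i. min (u i) x) (\<lambda>i. min (v i) x) a x"
    unfolding interval_family_def disjoint_family_on_def
  proof (intro conjI ballI impI fin)
    fix i j assume ij: "i \<in> I" "j \<in> I" "i \<noteq> j"
    have "{min (u i) x<..<min (v i) x} \<inter> {min (u j) x<..<min (v j) x} \<subseteq> {u i<..<v i} \<inter> {u j<..<v j}" by auto
    with dj[OF ij] show "{min (u i) x<..<min (v i) x} \<inter> {min (u j) x<..<min (v j) x} = {}" by blast
  next
    fix i assume "i \<in> I"
    from ui[OF this] assms show "a \<le> min (u i) x" "min (u i) x \<le> min (v i) x" "min (v i) x \<le> x"
      by (auto intro: min.mono)
  qed
  have F2: "interval_family I (\<lambda>i. max (u i) x) (\<lambda>i. max (v i) x) x y"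
    unfolding interval_family_def disjoint_family_on_def
  proof (intro conjI ballI impI fin)
    fix i j assume ij: "i \<in> I" "j \<in> I" "i \<noteq> j"
    have "{max (u i) x<..<max (v i) x} \<inter> {max (u j) x<..<max (v j) x} \<subseteq> {u i<..<v i} \<inter> {u j<..<v j}" by auto
    with dj[OF ij] show "{max (u i) x<..<max (v i) x} \<inter> {max (u j) x<..<max (v j) x} = {}" by blast
  next
    fix i assume "i \<in> I"
    from ui[OF this] assms show "x \<le> max (u i) x" "max (u i) x \<le> max (v i) x" "max (v i) x \<le> y"
      by (auto intro: max.mono)
  qed
  have pt: "cmod (h (v i) - h (u i)) \<le> cmod (h (min (v i) x) - h (min (u i) x)) + cmod (h (max (v i) x) - h (max (u i) x))"
    if "i \<in> I" for i
  proof -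
    consider "v i \<le> x" | "x \<le> u i" | "u i < x" "x < v i" by linarith
    then show ?thesis
    proof cases
      case 3
      then show ?thesis using norm_triangle_ineq[of "h x - h (u i)" "h (v i) - h x"] by (simp add: min_def max_def)
    next
      case 1
      with ui[OF that] have "min (v i) x = v i" "min (u i) x = u i" by auto
      then show ?thesis by simp
    next
      case 2
      with ui[OF that] have "max (v i) x = v i" "max (u i) x = u i" by auto
      then show ?thesis by simp
    qed
  qed
  have "(\<Sum>i\<in>I. cmod (h (v i) - h (u i))) \<le> (\<Sum>i\<in>I. cmod (h (min (v i) x) - h (min (u i) x))) + (\<Sum>i\<in>I. cmod (h (max (v i) x) - h (max (u i) x)))"
    unfolding sum.distrib[symmetric] by (rule sum_mono) (rule pt)
  also have "\<dots> \<le> variation h a x + variation h x y"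
    using assms by (intro add_mono variation_upper F1 F2) auto
  finally show "(\<Sum>i\<in>I. cmod (h (v i) - h (u i))) \<le> variation h a x + variation h x y" .
qed

text \<open>Choose in every interval of the family a subdivision that nearly exhausts the variation there. All the
  subdivisions together form one family, indexed by pairs, whose total length is no larger.\<close>

lemma variation_abs_cont:
  assumes ac: "abs_cont_on a b h" and e: "e > 0"
  shows "\<exists>d>0. \<forall>I (u :: 'i \<Rightarrow> real) v. interval_family I u v a b \<longrightarrow> (\<Sum>i\<in>I. v i - u i) < d
      \<longrightarrow> (\<Sum>i\<in>I. variation h a (v i) - variation h a (u i)) \<le> e"
proof -
  obtain d where d: "d > 0" "\<And>I (u :: 'i \<times> nat \<Rightarrow> real) v. interval_family I u v a b \<Longrightarrow> (\<Sum>i\<in>I. v i - u i) < d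
      \<Longrightarrow> (\<Sum>i\<in>I. cmod (h (v i) - h (u i))) < e / 2"
    using abs_cont_on_family[OF ac half_gt_zero[OF e], where 'i = "'i \<times> nat"] by auto
  show ?thesis
  proof (intro exI[of _ d] conjI allI impI d(1))
    fix I and u v :: "'i \<Rightarrow> real"
    assume F: "interval_family I u v a b" and len: "(\<Sum>i\<in>I. v i - u i) < d"
    have ui: "\<And>i. i \<in> I \<Longrightarrow> a \<le> u i \<and> u i \<le> v i \<and> v i \<le> b" and fin: "finite I"
      and dj: "\<And>i j. i \<in> I \<Longrightarrow> j \<in> I \<Longrightarrow> i \<noteq> j \<Longrightarrow> {u i<..<v i} \<inter> {u j<..<v j} = {}"
      using F by (auto simp: interval_family_def disjoint_family_on_def)
    define \<eta> where "\<eta> = e / (2 * (real (card I) + 1))"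
    have \<eta>: "\<eta> > 0" "real (card I) * \<eta> \<le> e / 2" using e by (auto simp: \<eta>_def field_simps)
    have "\<exists>J s t. interval_family (J :: nat set) s t (u i) (v i) \<and> variation h (u i) (v i) - \<eta> < (\<Sum>j\<in>J. cmod (h (t j) - h (s j)))" if "i \<in> I" for i
    proof -
      have "variation h (u i) (v i) - \<eta> < Sup (variation_sums h (u i) (v i))" using \<eta> by (simp add: variation_def)
      then obtain y where "y \<in> variation_sums h (u i) (v i)" "variation h (u i) (v i) - \<eta> < y"
        using less_cSupD[of "variation_sums h (u i) (v i)"] zero_in_variation_sums by blast
      then show ?thesis unfolding variation_sums_def by blast
    qed
    then obtain J s t where Jst: "\<And>i. i \<in> I \<Longrightarrow> interval_family (J i :: nat set) (s i) (t i) (u i) (v i)"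
      "\<And>i. i \<in> I \<Longrightarrow> variation h (u i) (v i) - \<eta> < (\<Sum>j\<in>J i. cmod (h (t i j) - h (s i j)))"
      by metis
    have finJ: "\<And>i. i \<in> I \<Longrightarrow> finite (J i)" and st: "\<And>i j. i \<in> I \<Longrightarrow> j \<in> J i \<Longrightarrow> u i \<le> s i j \<and> s i j \<le> t i j \<and> t i j \<le> v i"
      and djJ: "\<And>i j j'. i \<in> I \<Longrightarrow> j \<in> J i \<Longrightarrow> j' \<in> J i \<Longrightarrow> j \<noteq> j' \<Longrightarrow> {s i j<..<t i j} \<inter> {s i j'<..<t i j'} = {}"
      using Jst(1) by (auto simp: interval_family_def disjoint_family_on_def)
    have Fam: "interval_family (Sigma I J) (\<lambda>(i, j). s i j) (\<lambda>(i, j). t i j) a b"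
      unfolding interval_family_def disjoint_family_on_def
    proof (intro conjI ballI impI)
      show "finite (Sigma I J)" using fin finJ by auto
      fix m assume m: "m \<in> Sigma I J"
      show "a \<le> (case m of (i, j) \<Rightarrow> s i j)" "(case m of (i, j) \<Rightarrow> s i j) \<le> (case m of (i, j) \<Rightarrow> t i j)" "(case m of (i, j) \<Rightarrow> t i j) \<le> b"
        using m st ui by (auto intro: order_trans)
      fix n assume n: "n \<in> Sigma I J" "m \<noteq> n"
      obtain i j i' j' where mn: "m = (i, j)" "n = (i', j')" by (cases m, cases n) auto
      have "{s i j<..<t i j} \<inter> {s i' j'<..<t i' j'} = {}"
      proof (cases "i = i'")
        case True
        then show ?thesis using djJ[of i j j'] m n mn by auto
      next
        case False
        have "{s i j<..<t i j} \<subseteq> {u i<..<v i}" using st[of i j] m mn by auto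
        moreover have "{s i' j'<..<t i' j'} \<subseteq> {u i'<..<v i'}" using st[of i' j'] n mn by auto
        ultimately show ?thesis using dj[of i i'] False m n mn by blast
      qed
      then show "{(case m of (i, j) \<Rightarrow> s i j)<..<(case m of (i, j) \<Rightarrow> t i j)} \<inter> {(case n of (i, j) \<Rightarrow> s i j)<..<(case n of (i, j) \<Rightarrow> t i j)} = {}"
        by (simp add: mn)
    qed
    have "(\<Sum>m\<in>Sigma I J. (case m of (i, j) \<Rightarrow> t i j) - (case m of (i, j) \<Rightarrow> s i j)) = (\<Sum>i\<in>I. \<Sum>j\<in>J i. t i j - s i j)"
      using fin finJ by (subst sum.Sigma) (auto intro!: sum.cong)
    also have "\<dots> \<le> (\<Sum>i\<in>I. v i - u i)"
      using Jst(1) ui by (intro sum_mono interval_family_length) auto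
    finally have len': "(\<Sum>m\<in>Sigma I J. (case m of (i, j) \<Rightarrow> t i j) - (case m of (i, j) \<Rightarrow> s i j)) < d" using len by simp
    have "(\<Sum>i\<in>I. variation h a (v i) - variation h a (u i)) \<le> (\<Sum>i\<in>I. (\<Sum>j\<in>J i. cmod (h (t i j) - h (s i j))) + \<eta>)"
    proof (rule sum_mono)
      fix i assume i: "i \<in> I"
      have "variation h a (v i) \<le> variation h a (u i) + variation h (u i) (v i)"
        using ui[OF i] by (intro variation_split) auto
      then show "variation h a (v i) - variation h a (u i) \<le> (\<Sum>j\<in>J i. cmod (h (t i j) - h (s i j))) + \<eta>"
        using Jst(2)[OF i] by linarith
    qed
    also have "\<dots> = (\<Sum>i\<in>I. \<Sum>j\<in>J i. cmod (h (t i j) - h (s i j))) + real (card I) * \<eta>" by (simp add: sum.distrib)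
    also have "(\<Sum>i\<in>I. \<Sum>j\<in>J i. cmod (h (t i j) - h (s i j))) = (\<Sum>m\<in>Sigma I J. cmod (h (case m of (i, j) \<Rightarrow> t i j) - h (case m of (i, j) \<Rightarrow> s i j)))"
      using fin finJ by (subst sum.Sigma) (auto intro!: sum.cong)
    also have "\<dots> + real (card I) * \<eta> \<le> e / 2 + e / 2"
      using d(2)[OF Fam len'] \<eta> by (intro add_mono) auto
    finally show "(\<Sum>i\<in>I. variation h a (v i) - variation h a (u i)) \<le> e" by simp
  qed
qed

end

subsection \<open>Monotone absolutely continuous functions have densities\<close>

lemma open_connected_bounded_real:
  fixes c :: "real set"
  assumes "open c" "connected c" "bounded c" "c \<noteq> {}"
  shows "c = {Inf c<..<Sup c}"
proof
  have bd: "bdd_above c" "bdd_below c" using assms bounded_imp_bdd_above bounded_imp_bdd_below by auto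
  show "c \<subseteq> {Inf c<..<Sup c}"
  proof
    fix x assume x: "x \<in> c"
    then obtain e where e: "e > 0" "ball x e \<subseteq> c" using assms(1) open_contains_ball by blast
    then have "x - e / 2 \<in> c" "x + e / 2 \<in> c" by (auto simp: dist_real_def subset_iff)
    then have "Inf c \<le> x - e / 2" "x + e / 2 \<le> Sup c" using bd by (auto intro: cInf_lower cSup_upper)
    then show "x \<in> {Inf c<..<Sup c}" using e by auto
  qed
  show "{Inf c<..<Sup c} \<subseteq> c"
  proof
    fix x assume "x \<in> {Inf c<..<Sup c}"
    then obtain y z where "y \<in> c" "y < x" "z \<in> c" "x < z"
      using less_cSupD[of c x] cInf_lessD[of c x] assms(4) by auto
    then show "x \<in> c" using connected_contains_Icc[OF assms(2), of y z] by auto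
  qed
qed

text \<open>Enclose the null set in an open set of small measure. Its components are disjoint intervals, and by
  absolute continuity every finite union of them has small Stieltjes measure. The components themselves serve as
  indices of the family, which is why families indexed by sets of reals occur in the hypothesis.\<close>

lemma monotone_abs_cont_null_sets:
  fixes G :: "real \<Rightarrow> real"
  assumes mono: "\<And>x y. x \<le> y \<Longrightarrow> G x \<le> G y" and cont: "continuous_on UNIV G"
    and ac: "\<And>e. e > 0 \<Longrightarrow> \<exists>d>0. \<forall>I (u :: real set \<Rightarrow> real) v. finite I \<longrightarrow> (\<forall>i\<in>I. u i \<le> v i) \<longrightarrow>
      disjoint_family_on (\<lambda>i. {u i<..<v i}) I \<longrightarrow> (\<Sum>i\<in>I. v i - u i) < d \<longrightarrow> (\<Sum>i\<in>I. G (v i) - G (u i)) \<le> e"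
    and N: "N \<in> null_sets lborel" "N \<subseteq> {a<..<b}"
  shows "emeasure (interval_measure G) N = 0"
proof (rule antisym)
  let ?M = "interval_measure G"
  have rc: "continuous (at_right x) G" for x
    using cont by (auto intro: continuous_at_imp_continuous_at_within simp: continuous_on_eq_continuous_at)
  have Ioo: "emeasure ?M {u<..<v} \<le> ennreal (G v - G u)" if "u \<le> v" for u v
  proof -
    have "emeasure ?M {u<..<v} \<le> emeasure ?M {u<..v}" by (intro emeasure_mono) auto
    also have "\<dots> = ennreal (G v - G u)" using that by (intro emeasure_interval_measure_Ioc mono rc)
    finally show ?thesis .
  qed
  show "emeasure ?M N \<le> 0"
  proof (rule ennreal_le_epsilon)
    fix e :: real assume e: "e > 0"
    obtain d where d: "d > 0" "\<And>I (u :: real set \<Rightarrow> real) v. finite I \<Longrightarrow> (\<forall>i\<in>I. u i \<le> v i) \<Longrightarrow>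
      disjoint_family_on (\<lambda>i. {u i<..<v i}) I \<Longrightarrow> (\<Sum>i\<in>I. v i - u i) < d \<Longrightarrow> (\<Sum>i\<in>I. G (v i) - G (u i)) \<le> e"
      using ac[OF e] by auto
    obtain U0 where U0: "open U0" "N \<subseteq> U0" "emeasure lborel (U0 - N) < ennreal d"
      using outer_regular_lborel[of N d] N(1) d(1) by (auto simp: null_sets_def)
    define U where "U = U0 \<inter> {a<..<b}"
    have U: "open U" "N \<subseteq> U" "bounded U"
      using U0 N by (auto simp: U_def intro: bounded_subset[OF compact_imp_bounded[OF compact_Icc[of a b]]])
    have Ud: "emeasure lborel U < ennreal d"
    proof -
      have "emeasure lborel U \<le> emeasure lborel ((U0 - N) \<union> N)"
        using U0 N by (intro emeasure_mono) (auto simp: U_def null_sets_def)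
      also have "\<dots> = emeasure lborel (U0 - N)" using U0 N(1) by (intro emeasure_Un_null_set) (auto simp: null_sets_def)
      finally show ?thesis using U0 by simp
    qed
    define C where "C = components U"
    have "pairwise disjnt C" using pairwise_disjoint_components[of U] by (simp add: C_def pairwise_def disjnt_def)
    then have C: "countable C" "\<Union>C = U"
      using U countable_disjoint_open_subsets[of C] by (auto simp: C_def open_components)
    have c: "c = {Inf c<..<Sup c}" "Inf c \<le> Sup c" if "c \<in> C" for c
    proof -
      have cc: "open c" "connected c" "bounded c" "c \<noteq> {}" using that U
        by (auto simp: C_def in_components_connected in_components_nonempty intro: open_components[OF U(1)] bounded_subset dest: in_components_subset)
      show eq: "c = {Inf c<..<Sup c}" by (rule open_connected_bounded_real[OF cc])
      with cc(4) show "Inf c \<le> Sup c" by (metis greaterThanLessThan_empty_iff linorder_not_le less_imp_le)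
    qed
    have fin: "emeasure ?M (\<Union>I) \<le> ennreal e" if I: "finite I" "I \<subseteq> C" for I
    proof -
      have meas: "i \<in> sets borel" if "i \<in> I" for i
        using that I U by (auto simp: C_def intro!: borel_open open_components[OF U(1)])
      have dj: "disjoint_family_on (\<lambda>i. i) I"
        using I pairwise_disjoint_components[of U]
          unfolding C_def disjoint_family_on_def pairwise_def disjnt_def by blast
      have "(\<Sum>i\<in>I. Sup i - Inf i) < d"
      proof -
        have "ennreal (\<Sum>i\<in>I. Sup i - Inf i) = (\<Sum>i\<in>I. ennreal (Sup i - Inf i))"
          using c(2) I by (intro sum_ennreal[symmetric]) auto
        also have "\<dots> = (\<Sum>i\<in>I. emeasure lborel i)"
        proof (rule sum.cong)
          fix i assume "i \<in> I"
          with I have "i \<in> C" by auto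
          then show "ennreal (Sup i - Inf i) = emeasure lborel i"
            using c[of i] emeasure_lborel_Ioo[of "Inf i" "Sup i"] by metis
        qed simp
        also have "\<dots> = emeasure lborel (\<Union>i\<in>I. i)" using meas dj I by (intro sum_emeasure) auto
        also have "\<dots> \<le> emeasure lborel U" using I C U by (intro emeasure_mono) auto
        finally have "ennreal (\<Sum>i\<in>I. Sup i - Inf i) < ennreal d" using Ud by (rule le_less_trans)
        then show ?thesis using c(2) I by (subst (asm) ennreal_less_iff) (auto intro!: sum_nonneg)
      qed
      moreover have "disjoint_family_on (\<lambda>i. {Inf i<..<Sup i}) I"
        unfolding disjoint_family_on_def using dj c(1) I unfolding disjoint_family_on_def by (metis subsetD)
      ultimately have s: "(\<Sum>i\<in>I. G (Sup i) - G (Inf i)) \<le> e" using I c(2) by (intro d(2)) auto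
      have "emeasure ?M (\<Union>I) \<le> (\<Sum>i\<in>I. emeasure ?M i)"
        using emeasure_subadditive_finite[of I "\<lambda>i. i" ?M] meas I by auto
      also have "\<dots> \<le> (\<Sum>i\<in>I. ennreal (G (Sup i) - G (Inf i)))"
      proof (rule sum_mono)
        fix i assume "i \<in> I"
        with I have "i \<in> C" by auto
        then show "emeasure ?M i \<le> ennreal (G (Sup i) - G (Inf i))" using c[of i] Ioo[of "Inf i" "Sup i"] by metis
      qed
      also have "\<dots> = ennreal (\<Sum>i\<in>I. G (Sup i) - G (Inf i))" using c(2) I mono by (intro sum_ennreal) auto
      also have "\<dots> \<le> ennreal e" using s by (rule ennreal_leI)
      finally show ?thesis .
    qed
    have "emeasure ?M U \<le> ennreal e"
    proof (cases "C = {}")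
      case True then show ?thesis using C by auto
    next
      case False
      define A where "A n = (\<Union>(from_nat_into C ` {..<n}))" for n
      have rng: "from_nat_into C n \<in> C" for n using False by (rule from_nat_into)
      have "U = (\<Union>n. A n)"
      proof
        show "U \<subseteq> (\<Union>n. A n)"
        proof
          fix x assume "x \<in> U"
          then obtain c where "c \<in> C" "x \<in> c" using C by auto
          then obtain n where "c = from_nat_into C n" using from_nat_into_surj[OF C(1)] by metis
          with \<open>x \<in> c\<close> have "x \<in> A (Suc n)" by (auto simp: A_def)
          then show "x \<in> (\<Union>n. A n)" by blast
        qed
        show "(\<Union>n. A n) \<subseteq> U" using rng C by (auto simp: A_def)
      qed
      moreover have "range A \<subseteq> sets ?M"
      proof -
        have "open (A n)" for n unfolding A_def
          by (intro open_Union ballI) (use rng open_components[OF U(1)] in \<open>auto simp: C_def\<close>)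
        then show ?thesis by (auto intro: borel_open)
      qed
      moreover have "incseq A" unfolding A_def incseq_def by (fastforce)
      ultimately have "emeasure ?M U = (SUP n. emeasure ?M (A n))" by (simp add: SUP_emeasure_incseq)
      also have "\<dots> \<le> ennreal e" unfolding A_def by (intro SUP_least fin) (use rng in auto)
      finally show ?thesis .
    qed
    moreover have "emeasure ?M N \<le> emeasure ?M U" using U by (intro emeasure_mono) (auto intro: borel_open)
    ultimately show "emeasure ?M N \<le> 0 + ennreal e" by simp
  qed
qed simp

text \<open>The Stieltjes measure of \<open>G\<close> is absolutely continuous, so the Radon-Nikodym theorem provides a density.\<close>

lemma monotone_abs_cont_density:
  fixes G :: "real \<Rightarrow> real"
  assumes mono: "\<And>x y. x \<le> y \<Longrightarrow> G x \<le> G y" and cont: "continuous_on UNIV G"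
    and ac: "\<And>e. e > 0 \<Longrightarrow> \<exists>d>0. \<forall>I (u :: real set \<Rightarrow> real) v. finite I \<longrightarrow> (\<forall>i\<in>I. u i \<le> v i) \<longrightarrow>
      disjoint_family_on (\<lambda>i. {u i<..<v i}) I \<longrightarrow> (\<Sum>i\<in>I. v i - u i) < d \<longrightarrow> (\<Sum>i\<in>I. G (v i) - G (u i)) \<le> e"
  obtains g where "g \<in> borel_measurable borel" "\<And>x y. x \<le> y \<Longrightarrow> set_integrable lborel {x<..y} g"
    "\<And>x y. x \<le> y \<Longrightarrow> G y - G x = (LINT t:{x<..y}|lborel. g t)"
proof -
  let ?M = "interval_measure G"
  have rc: "continuous (at_right x) G" for x
    using cont by (auto intro: continuous_at_imp_continuous_at_within simp: continuous_on_eq_continuous_at)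
  have "absolutely_continuous lborel ?M"
    unfolding absolutely_continuous_def
  proof
    fix N assume N: "N \<in> null_sets (lborel :: real measure)"
    have "N \<inter> {-real n<..<real n} \<in> null_sets ?M" for n
    proof -
      have "N \<inter> {-real n<..<real n} \<in> null_sets lborel" using N by (intro null_set_Int2) auto
      moreover from this have "emeasure ?M (N \<inter> {-real n<..<real n}) = 0"
        by (intro monotone_abs_cont_null_sets[OF mono cont ac]) auto
      ultimately show ?thesis by (auto simp: null_sets_def)
    qed
    then have "(\<Union>n. N \<inter> {-real n<..<real n}) \<in> null_sets ?M" by (rule null_sets_UN)
    moreover have "(\<Union>n. N \<inter> {-real n<..<real n}) = N"
    proof -
      have "\<exists>n. x \<in> {-real n<..<real n}" for x
        using reals_Archimedean2[of "\<bar>x\<bar>"] by (auto simp: abs_less_iff intro: exI) (metis abs_less_iff minus_less_iff)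
      then show ?thesis by blast
    qed
    ultimately show "N \<in> null_sets ?M" by simp
  qed
  then obtain f where f [measurable]: "f \<in> borel_measurable lborel" and dens: "density lborel f = ?M"
    using sigma_finite_measure.Radon_Nikodym[OF sigma_finite_lborel, of ?M] by auto
  have fm: "f \<in> borel_measurable borel" using f by simp
  have val: "(\<integral>\<^sup>+t. f t * indicator {x<..y} t \<partial>lborel) = ennreal (G y - G x)" if "x \<le> y" for x y
  proof -
    have "(\<integral>\<^sup>+t. f t * indicator {x<..y} t \<partial>lborel) = emeasure (density lborel f) {x<..y}"
      by (simp add: emeasure_density)
    also have "\<dots> = ennreal (G y - G x)" unfolding dens using that by (intro emeasure_interval_measure_Ioc mono rc)
    finally show ?thesis .
  qed
  define g where "g t = enn2real (f t)" for t
  have g: "g \<in> borel_measurable borel" unfolding g_def[abs_def] using fm by measurable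
  have main: "set_integrable lborel {x<..y} g \<and> G y - G x = (LINT t:{x<..y}|lborel. g t)" if xy: "x \<le> y" for x y
  proof -
    have "AE t in lborel. f t * indicator {x<..y} t \<noteq> \<infinity>"
      by (rule nn_integral_PInf_AE) (use val[OF xy] in auto)
    then have "AE t in lborel. ennreal (indicator {x<..y} t *\<^sub>R g t) = f t * indicator {x<..y} t"
      by eventually_elim (auto simp: g_def indicator_def less_top)
    then have nn: "(\<integral>\<^sup>+t. ennreal (indicator {x<..y} t *\<^sub>R g t) \<partial>lborel) = ennreal (G y - G x)"
      using val[OF xy] by (subst nn_integral_cong_AE) auto
    have int: "integrable lborel (\<lambda>t. indicator {x<..y} t *\<^sub>R g t)"
      using nn g by (intro integrableI_nonneg) (auto simp: g_def)
    moreover have "(\<integral>t. indicator {x<..y} t *\<^sub>R g t \<partial>lborel) = G y - G x"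
      using nn nn_integral_eq_integral[OF int] mono[OF xy]
      by (simp add: g_def ennreal_inj integral_nonneg_AE)
    ultimately show ?thesis by (simp add: set_integrable_def set_lebesgue_integral_def)
  qed
  show thesis by (rule that[OF g]) (use main in auto)
qed

subsection \<open>Lebesgue's differentiation theorem on the line\<close>

text \<open>The points at which the density is at most \<open>r\<close> although arbitrarily short intervals around them have
  slope above \<open>s\<close>. The intervals extend to both sides of \<open>x\<close>, because then the condition for one \<open>n\<close> defines an
  open set.\<close>

definition steep_points :: "(real \<Rightarrow> real) \<Rightarrow> (real \<Rightarrow> real) \<Rightarrow> real \<Rightarrow> real \<Rightarrow> real set" where
  "steep_points F g r s = {x. g x \<le> r \<and>
     (\<forall>n::nat. \<exists>u v. u < x \<and> x < v \<and> v - u < 1 / (real n + 1) \<and> s * (v - u) < F v - F u)}"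

lemma steep_points_measurable:
  assumes [measurable]: "g \<in> borel_measurable borel"
  shows "steep_points F g r s \<in> sets borel"
proof -
  define S where "S n = (\<Union>(u, v)\<in>{(u, v). v - u < 1 / (real n + 1) \<and> s * (v - u) < F v - F u}. {u<..<v})" for n :: nat
  have "open (S n)" for n unfolding S_def by (intro open_UN) auto
  then have "(\<Inter>n. S n) \<in> sets borel" by (intro sets.countable_INT) (auto intro: borel_open)
  moreover have "{x. g x \<le> r} \<in> sets borel" by measurable
  moreover have "steep_points F g r s = {x. g x \<le> r} \<inter> (\<Inter>n. S n)"
    unfolding steep_points_def S_def by fastforce
  ultimately show ?thesis by auto
qed

text \<open>Vitali's theorem covers almost all steep points by disjoint intervals on which \<open>g - s\<close> has positive
  integral, while \<open>g - s \<le> r - s < 0\<close> on the steep points themselves. As the intervals can be taken inside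
  an open set in which the complement of the steep points carries little of the integral of \<open>|g - s|\<close>, the steep
  points have arbitrarily small measure.\<close>

lemma steep_points_null:
  fixes F g :: "real \<Rightarrow> real"
  assumes g [measurable]: "g \<in> borel_measurable borel"
    and loc: "\<And>x y. x \<le> y \<Longrightarrow> set_integrable lborel {x<..y} g"
    and F: "\<And>x y. x \<le> y \<Longrightarrow> F y - F x = (LINT t:{x<..y}|lborel. g t)"
    and rs: "r < s"
  shows "steep_points F g r s \<in> null_sets lborel"
proof -
  have bounded_case: "steep_points F g r s \<inter> {-real m<..<real m} \<in> null_sets lborel" for m :: nat
  proof -
    define B where "B = {-real m<..<real m}"
    define E where "E = steep_points F g r s \<inter> B"
    have E [measurable]: "E \<in> sets borel" using steep_points_measurable[OF g, of F r s] by (auto simp: E_def B_def)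
    have Bm [measurable]: "B \<in> sets borel" by (simp add: B_def)
    define h where "h x = g x - s" for x
    have hm [measurable]: "h \<in> borel_measurable borel" unfolding h_def by measurable
    have "set_integrable lborel {-real m<..real m} g" by (rule loc) simp
    moreover have "set_integrable lborel {-real m<..real m} (\<lambda>x. s)"
      unfolding set_integrable_def by (simp add: integrable_indicator_iff)
    ultimately have "set_integrable lborel {-real m<..real m} h"
      unfolding h_def[abs_def] by (rule set_integral_diff(1))
    then have hB: "set_integrable lborel B h" by (rule set_integrable_subset) (auto simp: B_def)
    have hA: "set_integrable lborel A h" if "A \<in> sets borel" "A \<subseteq> B" for A
      using hB that by (auto intro: set_integrable_subset)
    have finB: "emeasure lborel A < \<infinity>" if "A \<subseteq> B" for A
    proof -
      have "emeasure lborel A \<le> emeasure lborel B" using that Bm by (intro emeasure_mono) auto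
      also have "\<dots> < \<infinity>" by (simp add: B_def)
      finally show ?thesis .
    qed
    define \<nu> where "\<nu> = density lborel (\<lambda>x. ennreal (indicator B x * \<bar>h x\<bar>))"
    have \<nu>_eq: "emeasure \<nu> A = ennreal (LINT x:A|lborel. \<bar>h x\<bar>)" if A: "A \<in> sets borel" "A \<subseteq> B" for A
    proof -
      have i: "integrable lborel (\<lambda>x. indicator A x * \<bar>h x\<bar>)"
        using set_integrable_abs[OF hA[OF A]] by (simp add: set_integrable_def)
      have "emeasure \<nu> A = (\<integral>\<^sup>+x. ennreal (indicator B x * \<bar>h x\<bar>) * indicator A x \<partial>lborel)"
        unfolding \<nu>_def using A by (subst emeasure_density) auto
      also have "\<dots> = (\<integral>\<^sup>+x. ennreal (indicator A x * \<bar>h x\<bar>) \<partial>lborel)"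
        using A by (intro nn_integral_cong) (auto simp: indicator_def)
      also have "\<dots> = ennreal (\<integral>x. indicator A x * \<bar>h x\<bar> \<partial>lborel)" using i by (intro nn_integral_eq_integral) auto
      finally show ?thesis by (simp add: set_lebesgue_integral_def)
    qed
    have \<nu>_space: "emeasure \<nu> (space \<nu>) \<noteq> \<infinity>"
    proof -
      have "emeasure \<nu> (space \<nu>) = (\<integral>\<^sup>+x. ennreal (indicator B x * \<bar>h x\<bar>) \<partial>lborel)"
        unfolding \<nu>_def by (subst emeasure_density) auto
      also have "\<dots> = emeasure \<nu> B"
        unfolding \<nu>_def by (subst emeasure_density) (auto intro!: nn_integral_cong simp: indicator_def)
      also have "\<dots> \<noteq> \<infinity>" by (subst \<nu>_eq) auto
      finally show ?thesis .
    qed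
    have key: "(s - r) * measure lborel E \<le> \<eta>" if \<eta>: "\<eta> > 0" for \<eta>
    proof -
      have Efin: "emeasure \<nu> E \<noteq> \<infinity>"
      proof -
        have "E \<subseteq> B" by (simp add: E_def)
        from \<nu>_eq[OF E this] show ?thesis by simp
      qed
      have "emeasure \<nu> E < emeasure \<nu> E + ennreal \<eta>"
        using Efin \<eta> by (cases "emeasure \<nu> E") (auto simp: ennreal_plus[symmetric] ennreal_less_iff simp del: ennreal_plus)
      moreover have "emeasure \<nu> E = (INF U\<in>{U. E \<subseteq> U \<and> open U}. emeasure \<nu> U)"
        by (rule outer_regular[OF _ \<nu>_space]) (auto simp: \<nu>_def)
      ultimately obtain U0 where U0: "open U0" "E \<subseteq> U0" "emeasure \<nu> U0 < emeasure \<nu> E + ennreal \<eta>"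
        unfolding INF_less_iff by (smt (verit) INF_less_iff mem_Collect_eq)
      define U where "U = U0 \<inter> B"
      have U: "open U" "E \<subseteq> U" "U \<subseteq> B" using U0 by (auto simp: U_def E_def B_def)
      have UE: "emeasure \<nu> (U - E) \<le> ennreal \<eta>"
      proof -
        have "emeasure \<nu> (U - E) \<le> emeasure \<nu> (U0 - E)"
          using U0 by (intro emeasure_mono) (auto simp: U_def \<nu>_def)
        also have "\<dots> = emeasure \<nu> U0 - emeasure \<nu> E"
          using U0 Efin by (intro emeasure_Diff) (auto simp: \<nu>_def)
        also have "\<dots> \<le> ennreal \<eta>" using U0(3) Efin by (simp add: ennreal_minus_le_iff less_imp_le)
        finally show ?thesis .
      qed
      define K where "K = {(u, v). u < v \<and> {u..v} \<subseteq> U \<and> s * (v - u) < F v - F u}"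
      have cb: "cball ((fst i + snd i) / 2) ((snd i - fst i) / 2) = {fst i..snd i}" for i :: "real \<times> real"
        by (simp add: cball_eq_atLeastAtMost field_simps)
      obtain C where C: "countable C" "C \<subseteq> K"
        "pairwise (\<lambda>i j. disjnt (cball ((fst i + snd i) / 2) ((snd i - fst i) / 2)) (cball ((fst j + snd j) / 2) ((snd j - fst j) / 2))) C"
        "negligible (E - (\<Union>i\<in>C. cball ((fst i + snd i) / 2) ((snd i - fst i) / 2)))"
      proof (rule Vitali_covering_theorem_cballs[where K = K
        and S = E and a = "\<lambda>i. (fst i + snd i) / 2" and r = "\<lambda>i. (snd i - fst i) / 2"])
        show "0 < (snd i - fst i) / 2" if "i \<in> K" for i using that by (auto simp: K_def)
        fix x d :: real assume x: "x \<in> E" and d: "0 < d"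
        obtain e where e: "e > 0" "ball x e \<subseteq> U" using U x open_contains_ball by blast
        obtain n where n: "1 / (real n + 1) < min e d"
          using reals_Archimedean[of "min e d"] e d by (auto simp: inverse_eq_divide add.commute)
        obtain u v where uv: "u < x" "x < v" "v - u < 1 / (real n + 1)" "s * (v - u) < F v - F u"
          using x unfolding E_def steep_points_def by blast
        have "{u..v} \<subseteq> ball x e" using uv n by (auto simp: dist_real_def)
        then have "(u, v) \<in> K" using e uv by (auto simp: K_def)
        moreover have "x \<in> {u..v}" "(v - u) / 2 < d" using uv n by auto
        ultimately show "\<exists>i. i \<in> K \<and> x \<in> cball ((fst i + snd i) / 2) ((snd i - fst i) / 2) \<and> (snd i - fst i) / 2 < d"
          unfolding cb by (intro exI[of _ "(u, v)"]) auto
      qed auto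
      define J where "J i = {fst i<..snd i}" for i :: "real \<times> real"
      define W where "W = (\<Union>i\<in>C. J i)"
      have W [measurable]: "W \<in> sets borel" unfolding W_def J_def using C(1) by (intro sets.countable_UN') auto
      have JU: "J i \<subseteq> U" if "i \<in> C" for i using that C(2) by (fastforce simp: J_def K_def)
      then have WU: "W \<subseteq> U" by (auto simp: W_def)
      have djJ: "disjoint_family_on J C"
        using C(3) unfolding cb pairwise_def disjnt_def disjoint_family_on_def J_def by fastforce
      have EW: "E - W \<in> null_sets lborel"
      proof -
        have "E - W \<subseteq> (E - (\<Union>i\<in>C. {fst i..snd i})) \<union> fst ` C" by (force simp: W_def J_def)
        moreover have "negligible (fst ` C)"
          using null_sets_completionI[OF countable_imp_null_set_lborel[of "fst ` C"]] C(1)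
            by (simp add: negligible_iff_null_sets)
        ultimately have "negligible (E - W)" using C(4) unfolding cb by (meson negligible_Un negligible_subset)
        then have "E - W \<in> null_sets lebesgue" by (simp add: negligible_iff_null_sets)
        then show ?thesis by (auto simp: null_sets_completion_iff)
      qed
      have pos: "0 \<le> (LINT x:W|lborel. h x)"
      proof (cases "C = {}")
        case True then show ?thesis by (simp add: W_def set_lebesgue_integral_def)
      next
        case False
        define V where "V n = (\<Union>i\<in>from_nat_into C ` {..<n}. J i)" for n
        have rng: "from_nat_into C n \<in> C" for n using False by (rule from_nat_into)
        have Vm [measurable]: "V n \<in> sets borel" for n unfolding V_def J_def by (intro sets.finite_UN) auto
        have VW: "V n \<subseteq> W" for n using rng by (auto simp: V_def W_def)
        have VB: "V n \<subseteq> B" for n using VW WU U by blast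
        have lim: "(\<lambda>n. LINT x:V n|lborel. h x) \<longlonglongrightarrow> (LINT x:W|lborel. h x)"
          unfolding set_lebesgue_integral_def
        proof (rule integral_dominated_convergence[where w = "\<lambda>x. indicator B x *\<^sub>R \<bar>h x\<bar>"])
          show "integrable lborel (\<lambda>x. indicator B x *\<^sub>R \<bar>h x\<bar>)"
            using set_integrable_abs[OF hB] by (simp add: set_integrable_def)
          show "AE x in lborel. (\<lambda>n. indicator (V n) x *\<^sub>R h x) \<longlonglongrightarrow> indicator W x *\<^sub>R h x"
          proof (intro AE_I2 tendsto_eventually)
            fix x
            show "\<forall>\<^sub>F n in sequentially. indicator (V n) x *\<^sub>R h x = indicator W x *\<^sub>R h x"
            proof (cases "x \<in> W")
              case True
              then obtain i where "i \<in> C" "x \<in> J i" by (auto simp: W_def)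
              then obtain N where "x \<in> J (from_nat_into C N)" using from_nat_into_surj[OF C(1)] by metis
              then have "x \<in> V n" if "Suc N \<le> n" for n using that by (auto simp: V_def intro!: bexI[of _ N])
              then show ?thesis using True by (intro eventually_sequentiallyI[of "Suc N"]) auto
            next
              case False
              then have "x \<notin> V n" for n using VW by blast
              then show ?thesis using False by simp
            qed
          qed
          show "AE x in lborel. norm (indicator (V n) x *\<^sub>R h x) \<le> indicator B x *\<^sub>R \<bar>h x\<bar>" for n
            using VB[of n] by (intro AE_I2) (auto simp: indicator_def)
        qed measurable
        have "0 \<le> (LINT x:V n|lborel. h x)" for n
        proof -
          have "(LINT x:V n|lborel. h x) = (\<Sum>i\<in>from_nat_into C ` {..<n}. LINT x:J i|lborel. h x)"
            unfolding V_def
          proof (rule set_integral_finite_Union)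
            show "disjoint_family_on J (from_nat_into C ` {..<n})"
              using djJ by (rule disjoint_family_on_mono[rotated]) (use rng in auto)
            show "set_integrable lborel (J i) h" if "i \<in> from_nat_into C ` {..<n}" for i
            proof (rule hA)
              have "i \<in> C" using that rng by auto
              then show "J i \<subseteq> B" using JU U by blast
            qed (simp add: J_def)
          qed (auto simp: J_def)
          also have "\<dots> \<ge> 0"
          proof (rule sum_nonneg)
            fix i assume "i \<in> from_nat_into C ` {..<n}"
            then have i: "i \<in> K" using rng C(2) by auto
            obtain u v where uv: "i = (u, v)" by (cases i)
            have k: "u < v" "s * (v - u) < F v - F u" using i uv by (auto simp: K_def)
            have "(LINT x:{u<..v}|lborel. h x) = (LINT x:{u<..v}|lborel. g x) - (LINT x:{u<..v}|lborel. s)"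
              unfolding h_def using k loc[of u v]
              by (intro set_integral_diff(2)) (auto simp: set_integrable_def integrable_indicator_iff)
            also have "(LINT x:{u<..v}|lborel. s) = s * (v - u)" using k by (simp add: set_lebesgue_integral_def)
            finally have "(LINT x:{u<..v}|lborel. h x) = F v - F u - s * (v - u)" using F[of u v] k by simp
            with k show "0 \<le> (LINT x:J i|lborel. h x)" by (simp add: J_def uv)
          qed
          finally show ?thesis .
        qed
        then show ?thesis using lim by (intro LIMSEQ_le_const[of _ _ 0]) auto
      qed
      have m: "measure lborel (W \<inter> E) = measure lborel E"
      proof -
        have "measure lborel E = measure lborel ((W \<inter> E) \<union> (E - W))" by (rule arg_cong[of _ _ "measure lborel"]) auto
        also have "\<dots> = measure lborel (W \<inter> E)" using EW by (intro measure_Un_null_set) auto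
        finally show ?thesis ..
      qed
      have WB: "W \<inter> E \<subseteq> B" "W - E \<subseteq> B" using WU U by auto
      have "(LINT x:W|lborel. h x) = (LINT x:(W \<inter> E) \<union> (W - E)|lborel. h x)"
        by (rule arg_cong[of _ _ "\<lambda>A. set_lebesgue_integral lborel A h"]) auto
      also have "\<dots> = (LINT x:W \<inter> E|lborel. h x) + (LINT x:W - E|lborel. h x)"
        using WB by (intro set_integral_Un hA) auto
      also have "(LINT x:W \<inter> E|lborel. h x) \<le> (LINT x:W \<inter> E|lborel. r - s)"
      proof (rule set_integral_mono)
        show "set_integrable lborel (W \<inter> E) h" using WB by (intro hA) auto
        show "set_integrable lborel (W \<inter> E) (\<lambda>x. r - s)"
          using finB[OF WB(1)] unfolding set_integrable_def by (simp add: integrable_indicator_iff)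
        show "h x \<le> r - s" if "x \<in> W \<inter> E" for x using that by (simp add: h_def E_def steep_points_def)
      qed
      also have "(LINT x:W \<inter> E|lborel. r - s) = (r - s) * measure lborel E"
        by (simp add: set_lebesgue_integral_def m mult.commute)
      also have "(LINT x:W - E|lborel. h x) \<le> (LINT x:W - E|lborel. \<bar>h x\<bar>)"
        using WB by (intro set_integral_mono set_integrable_abs hA) auto
      also have "(LINT x:W - E|lborel. \<bar>h x\<bar>) \<le> \<eta>"
      proof -
        have "ennreal (LINT x:W - E|lborel. \<bar>h x\<bar>) = emeasure \<nu> (W - E)" using WB by (intro \<nu>_eq[symmetric]) auto
        also have "\<dots> \<le> emeasure \<nu> (U - E)" using WU U by (intro emeasure_mono) (auto simp: \<nu>_def)
        also have "\<dots> \<le> ennreal \<eta>" by (rule UE)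
        finally show ?thesis using \<eta> by (simp add: ennreal_le_iff)
      qed
      finally have "(LINT x:W|lborel. h x) \<le> (r - s) * measure lborel E + \<eta>" by simp
      with pos show ?thesis by (simp add: algebra_simps)
    qed
    have "(s - r) * measure lborel E \<le> 0" by (rule field_le_epsilon) (use key in auto)
    then have "measure lborel E = 0" using rs by (smt (verit) measure_nonneg mult_pos_pos)
    then have "emeasure lborel E = 0" using finB[of E] by (simp add: emeasure_eq_ennreal_measure E_def less_top)
    then show ?thesis by (auto simp: null_sets_def E_def[symmetric] B_def[symmetric])
  qed
  have "\<exists>n. x \<in> {-real n<..<real n}" for x :: real
    using reals_Archimedean2[of "\<bar>x\<bar>"] by (auto simp: abs_less_iff) (metis minus_less_iff)
  then have "steep_points F g r s = (\<Union>m::nat. steep_points F g r s \<inter> {-real m<..<real m})" by blast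
  moreover have "(\<Union>m::nat. steep_points F g r s \<inter> {-real m<..<real m}) \<in> null_sets lborel"
    by (intro null_sets_UN bounded_case)
  ultimately show ?thesis by simp
qed

text \<open>Short intervals around \<open>x\<close> have slope at most \<open>s\<close>; by continuity one end point may be moved into \<open>x\<close>, which
  turns this into a bound for difference quotients at \<open>x\<close>.\<close>

lemma not_steep_bound:
  fixes F :: "real \<Rightarrow> real"
  assumes cont: "continuous_on UNIV F" and x: "g x \<le> r" "x \<notin> steep_points F g r s"
  obtains d where "d > 0" "\<And>y. y \<noteq> x \<Longrightarrow> \<bar>y - x\<bar> < d \<Longrightarrow> (F y - F x) / (y - x) \<le> s"
proof -
  obtain n :: nat where "\<not> (\<exists>u v. u < x \<and> x < v \<and> v - u < 1 / (real n + 1) \<and> s * (v - u) < F v - F u)"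
    using x unfolding steep_points_def by blast
  then have n: "\<And>u v. u < x \<Longrightarrow> x < v \<Longrightarrow> v - u < 1 / (real n + 1) \<Longrightarrow> F v - F u \<le> s * (v - u)"
    by (meson not_less)
  define d where "d = 1 / (real n + 1)"
  have d: "d > 0" by (simp add: d_def)
  have Fx: "(F \<longlongrightarrow> F x) (at x)" using cont by (simp add: continuous_on_eq_continuous_at isCont_def)
  then have Fl: "(F \<longlongrightarrow> F x) (at_left x)" and Fr: "(F \<longlongrightarrow> F x) (at_right x)" by (simp_all add: filterlim_at_split)
  have right: "F y - F x \<le> s * (y - x)" if y: "x < y" "y - x < d" for y
  proof (rule tendsto_le)
    show "((\<lambda>u. s * (y - u)) \<longlongrightarrow> s * (y - x)) (at_left x)" by (intro tendsto_intros)
    show "((\<lambda>u. F y - F u) \<longlongrightarrow> F y - F x) (at_left x)" by (intro tendsto_intros Fl)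
    show "\<forall>\<^sub>F u in at_left x. F y - F u \<le> s * (y - u)"
      by (rule eventually_at_leftI[of "y - d"]) (use y n in \<open>auto simp: d_def\<close>)
  qed simp
  have left: "F x - F y \<le> s * (x - y)" if y: "y < x" "x - y < d" for y
  proof (rule tendsto_le)
    show "((\<lambda>v. s * (v - y)) \<longlongrightarrow> s * (x - y)) (at_right x)" by (intro tendsto_intros)
    show "((\<lambda>v. F v - F y) \<longlongrightarrow> F x - F y) (at_right x)" by (intro tendsto_intros Fr)
    show "\<forall>\<^sub>F v in at_right x. F v - F y \<le> s * (v - y)"
      by (rule eventually_at_rightI[of _ "y + d"]) (use y n in \<open>auto simp: d_def\<close>)
  qed simp
  have "(F y - F x) / (y - x) \<le> s" if y: "y \<noteq> x" "\<bar>y - x\<bar> < d" for y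
  proof (cases "x < y")
    case True then show ?thesis using right[of y] y by (simp add: divide_simps)
  next
    case False
    then have "y < x" using y by simp
    have eq: "(F y - F x) / (y - x) = (F x - F y) / (x - y)" by (metis minus_diff_eq minus_divide_divide)
    show ?thesis unfolding eq using left[of y] y \<open>y < x\<close> by (simp add: pos_divide_le_eq)
  qed
  with d show thesis by (rule that)
qed

text \<open>Outside a countable union of null sets, \<open>x\<close> is steep neither for \<open>F\<close> nor for \<open>- F\<close>, with any rational \<open>r < s\<close>. Taking
  \<open>r\<close> and \<open>s\<close> slightly above \<open>g x\<close>, respectively \<open>- g x\<close>, bounds the difference quotients from above and from below.\<close>

lemma lebesgue_differentiation:
  fixes F g :: "real \<Rightarrow> real"
  assumes g [measurable]: "g \<in> borel_measurable borel"
    and loc: "\<And>x y. x \<le> y \<Longrightarrow> set_integrable lborel {x<..y} g"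
    and F: "\<And>x y. x \<le> y \<Longrightarrow> F y - F x = (LINT t:{x<..y}|lborel. g t)"
    and cont: "continuous_on UNIV F"
  shows "AE x in lborel. (F has_real_derivative g x) (at x)"
proof -
  let ?X = "{(r, s). r \<in> \<rat> \<and> s \<in> \<rat> \<and> r < (s :: real)}"
  have "?X \<subseteq> \<rat> \<times> \<rat>" by auto
  then have ctb: "countable ?X" by (rule countable_subset) (simp add: countable_rat)
  have "AE x in lborel. x \<notin> steep_points F g r s" if "r < s" for r s
    using AE_not_in[OF steep_points_null[OF g loc F that]] by simp
  moreover have "AE x in lborel. x \<notin> steep_points (\<lambda>x. - F x) (\<lambda>x. - g x) r s" if "r < s" for r s
  proof -
    have "steep_points (\<lambda>x. - F x) (\<lambda>x. - g x) r s \<in> null_sets lborel"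
    proof (rule steep_points_null[OF _ _ _ that])
      show "set_integrable lborel {x<..y} (\<lambda>x. - g x)" if "x \<le> y" for x y
        using loc[OF that] by (simp add: set_integrable_def)
      show "- F y - - F x = (LINT t:{x<..y}|lborel. - g t)" if "x \<le> y" for x y
        using F[OF that] by (simp add: set_lebesgue_integral_def)
    qed measurable
    then show ?thesis by (rule AE_not_in)
  qed
  ultimately have "AE x in lborel. \<forall>(r, s)\<in>?X. x \<notin> steep_points F g r s \<and> x \<notin> steep_points (\<lambda>x. - F x) (\<lambda>x. - g x) r s"
    by (subst AE_ball_countable[OF ctb]) auto
  then show ?thesis
  proof eventually_elim
    case (elim x)
    have half: "\<exists>d>0. \<forall>y. y \<noteq> x \<longrightarrow> \<bar>y - x\<bar> < d \<longrightarrow> (F' y - F' x) / (y - x) < g' x + e"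
      if c: "continuous_on UNIV F'" and e: "e > 0" and ns: "\<And>r s. r \<in> \<rat> \<Longrightarrow> s \<in> \<rat> \<Longrightarrow> r < s \<Longrightarrow> x \<notin> steep_points F' g' r s"
      for F' g' :: "real \<Rightarrow> real" and e
    proof -
      obtain s where s: "s \<in> \<rat>" "g' x < s" "s < g' x + e" using Rats_dense_in_real[of "g' x" "g' x + e"] e by auto
      obtain r where r: "r \<in> \<rat>" "g' x < r" "r < s" using Rats_dense_in_real[of "g' x" s] s by auto
      obtain d where "d > 0" "\<And>y. y \<noteq> x \<Longrightarrow> \<bar>y - x\<bar> < d \<Longrightarrow> (F' y - F' x) / (y - x) \<le> s"
        using not_steep_bound[OF c less_imp_le[OF r(2)] ns[OF r(1) s(1) r(3)]] by blast
      with s show ?thesis by (intro exI[of _ d]) force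
    qed
    have "((\<lambda>y. (F y - F x) / (y - x)) \<longlongrightarrow> g x) (at x)"
    proof (rule tendstoI)
      fix e :: real assume e: "e > 0"
      obtain d1 where d1: "d1 > 0" "\<And>y. y \<noteq> x \<Longrightarrow> \<bar>y - x\<bar> < d1 \<Longrightarrow> (F y - F x) / (y - x) < g x + e"
        using half[OF cont e, of g] elim by auto
      have contm: "continuous_on UNIV (\<lambda>x. - F x)" using cont by (rule continuous_on_minus)
      obtain d2 where d2: "d2 > 0" "\<And>y. y \<noteq> x \<Longrightarrow> \<bar>y - x\<bar> < d2 \<Longrightarrow> (- F y - - F x) / (y - x) < - g x + e"
        using half[OF contm e, of "\<lambda>x. - g x"] elim by auto
      show "\<forall>\<^sub>F y in at x. dist ((F y - F x) / (y - x)) (g x) < e"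
        unfolding eventually_at
      proof (intro exI[of _ "min d1 d2"] conjI ballI impI)
        fix y assume y: "y \<noteq> x \<and> dist y x < min d1 d2"
        then have "(F y - F x) / (y - x) < g x + e" using d1(2)[of y] by (auto simp: dist_real_def)
        moreover have "- ((F y - F x) / (y - x)) < - g x + e"
        proof -
          have "- ((F y - F x) / (y - x)) = (- F y - - F x) / (y - x)" by (simp add: minus_divide_left)
          with d2(2)[of y] y show ?thesis by (auto simp: dist_real_def)
        qed
        ultimately show "dist ((F y - F x) / (y - x)) (g x) < e" by (auto simp: dist_real_def abs_less_iff)
      qed (use d1 d2 in auto)
    qed
    then show ?case by (simp add: has_field_derivative_iff)
  qed
qed

subsection \<open>The fundamental theorem for absolutely continuous functions\<close>

definition clamp_real :: "real \<Rightarrow> real \<Rightarrow> real \<Rightarrow> real" where "clamp_real a b x = max a (min b x)"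

context bounded_variation_interval
begin

lemma clamp: "a \<le> clamp_real a b x" "clamp_real a b x \<le> b" "x \<le> y \<Longrightarrow> clamp_real a b x \<le> clamp_real a b y"
  "x \<le> y \<Longrightarrow> clamp_real a b y - clamp_real a b x \<le> y - x" "a \<le> x \<Longrightarrow> x \<le> b \<Longrightarrow> clamp_real a b x = x"
  using ab by (auto simp: clamp_real_def)

text \<open>Clamping to \<open>[a, b]\<close> extends \<open>w\<close> to the line as a monotone function, to which domination by the variation
  transfers absolute continuity. The factor 2 admits the differences of the variation and the real or imaginary
  part of \<open>h\<close>.\<close>

lemma dominated_density:
  fixes w :: "real \<Rightarrow> real"
  assumes ac: "abs_cont_on a b h"
    and w: "\<And>x y. a \<le> x \<Longrightarrow> x \<le> y \<Longrightarrow> y \<le> b \<Longrightarrow> 0 \<le> w y - w x \<and> w y - w x \<le> 2 * (variation h a y - variation h a x)"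
  obtains g where "g \<in> borel_measurable borel" "\<And>x y. x \<le> y \<Longrightarrow> set_integrable lborel {x<..y} g"
    "\<And>x y. x \<le> y \<Longrightarrow> w (clamp_real a b y) - w (clamp_real a b x) = (LINT t:{x<..y}|lborel. g t)"
    "AE x in lborel. ((\<lambda>x. w (clamp_real a b x)) has_real_derivative g x) (at x)"
proof -
  define G where "G x = w (clamp_real a b x)" for x
  have mono: "G x \<le> G y" if "x \<le> y" for x y
    using w[of "clamp_real a b x" "clamp_real a b y"] clamp that by (simp add: G_def)
  have acG: "\<exists>d>0. \<forall>I (u :: real set \<Rightarrow> real) v. finite I \<longrightarrow> (\<forall>i\<in>I. u i \<le> v i) \<longrightarrow>
      disjoint_family_on (\<lambda>i. {u i<..<v i}) I \<longrightarrow> (\<Sum>i\<in>I. v i - u i) < d \<longrightarrow> (\<Sum>i\<in>I. G (v i) - G (u i)) \<le> e" if e: "e > 0" for e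
  proof -
    obtain d where d: "d > 0" "\<And>I (u :: real set \<Rightarrow> real) v. interval_family I u v a b \<Longrightarrow> (\<Sum>i\<in>I. v i - u i) < d
      \<Longrightarrow> (\<Sum>i\<in>I. variation h a (v i) - variation h a (u i)) \<le> e / 2"
      using variation_abs_cont[OF ac half_gt_zero[OF e], where 'i = "real set"] by auto
    show ?thesis
    proof (intro exI[of _ d] conjI allI impI d(1))
      fix I and u v :: "real set \<Rightarrow> real"
      assume I: "finite I" "\<forall>i\<in>I. u i \<le> v i" "disjoint_family_on (\<lambda>i. {u i<..<v i}) I" "(\<Sum>i\<in>I. v i - u i) < d"
      have fam: "interval_family I (\<lambda>i. clamp_real a b (u i)) (\<lambda>i. clamp_real a b (v i)) a b"
        unfolding interval_family_def disjoint_family_on_def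
      proof (intro conjI ballI impI)
        fix i j assume ij: "i \<in> I" "j \<in> I" "i \<noteq> j"
        have "{clamp_real a b (u i)<..<clamp_real a b (v i)} \<subseteq> {u i<..<v i}" for i
          by (auto simp: clamp_real_def min_def max_def split: if_splits)
        then have "{clamp_real a b (u i)<..<clamp_real a b (v i)} \<inter> {clamp_real a b (u j)<..<clamp_real a b (v j)} \<subseteq> {u i<..<v i} \<inter> {u j<..<v j}" by blast
        then show "{clamp_real a b (u i)<..<clamp_real a b (v i)} \<inter> {clamp_real a b (u j)<..<clamp_real a b (v j)} = {}"
          using I(3) ij unfolding disjoint_family_on_def by blast
      qed (use I clamp in auto)
      have "(\<Sum>i\<in>I. clamp_real a b (v i) - clamp_real a b (u i)) \<le> (\<Sum>i\<in>I. v i - u i)"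
        using I clamp by (intro sum_mono) auto
      then have "(\<Sum>i\<in>I. variation h a (clamp_real a b (v i)) - variation h a (clamp_real a b (u i))) \<le> e / 2"
        using I by (intro d(2) fam) auto
      moreover have "(\<Sum>i\<in>I. G (v i) - G (u i)) \<le> (\<Sum>i\<in>I. 2 * (variation h a (clamp_real a b (v i)) - variation h a (clamp_real a b (u i))))"
        unfolding G_def using I clamp w by (intro sum_mono) auto
      ultimately show "(\<Sum>i\<in>I. G (v i) - G (u i)) \<le> e" unfolding sum_distrib_left[symmetric] by linarith
    qed
  qed
  have cont: "continuous_on UNIV G"
    unfolding continuous_on_iff
  proof (intro ballI allI impI)
    fix x e :: real assume e: "e > 0"
    obtain d where d: "d > 0" "\<And>I (u :: real set \<Rightarrow> real) v. finite I \<Longrightarrow> (\<forall>i\<in>I. u i \<le> v i) \<Longrightarrow>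
      disjoint_family_on (\<lambda>i. {u i<..<v i}) I \<Longrightarrow> (\<Sum>i\<in>I. v i - u i) < d \<Longrightarrow> (\<Sum>i\<in>I. G (v i) - G (u i)) \<le> e / 2"
      using acG[OF half_gt_zero[OF e]] by auto
    show "\<exists>d>0. \<forall>x'\<in>UNIV. dist x' x < d \<longrightarrow> dist (G x') (G x) < e"
    proof (intro exI[of _ d] conjI ballI impI d(1))
      fix y assume y: "dist y x < d"
      have "G (max x y) - G (min x y) \<le> e / 2"
        using d(2)[of "{{}}" "\<lambda>_. min x y" "\<lambda>_. max x y"] y
        by (auto simp: disjoint_family_on_def dist_real_def max_def min_def split: if_splits)
      then show "dist (G y) (G x) < e"
        using e mono[of x y] mono[of y x] by (auto simp: dist_real_def max_def min_def split: if_splits)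
    qed
  qed
  obtain g where g: "g \<in> borel_measurable borel" "\<And>x y. x \<le> y \<Longrightarrow> set_integrable lborel {x<..y} g"
    "\<And>x y. x \<le> y \<Longrightarrow> G y - G x = (LINT t:{x<..y}|lborel. g t)"
    using monotone_abs_cont_density[OF mono cont acG] by blast
  have "AE x in lborel. (G has_real_derivative g x) (at x)" by (rule lebesgue_differentiation[OF g cont])
  with g show thesis using that[of g] unfolding G_def by blast
qed

text \<open>With \<open>V\<close> the variation of \<open>h\<close> over \<open>[a, x]\<close>, the functions \<open>V\<close>, \<open>V - Re h\<close> and \<open>V - Im h\<close> are monotone with dominated
  increments, hence integrals of densities that are their derivatives almost everywhere; \<open>h\<close> is a combination of the
  three.\<close>

lemma abs_cont_integral_local:
  assumes ac: "abs_cont_on a b h" and m: "(\<lambda>x. vector_derivative h (at x)) \<in> borel_measurable lebesgue"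
  shows "set_integrable lebesgue {a<..b} (\<lambda>x. vector_derivative h (at x))"
    "h b - h a = (LINT t:{a<..b}|lebesgue. vector_derivative h (at t))"
proof -
  let ?V = "variation h a" and ?c = "clamp_real a b"
  note inc = variation_increment
  have V: "0 \<le> ?V y - ?V x \<and> ?V y - ?V x \<le> 2 * (?V y - ?V x)" if "a \<le> x" "x \<le> y" "y \<le> b" for x y
  proof -
    have "0 \<le> ?V y - ?V x"
      using inc[OF that] norm_ge_zero[of "h y - h x"] by (meson diff_ge_0_iff_ge le_add_same_cancel1 order_trans)
    then show ?thesis by simp
  qed
  have dom: "0 \<le> (?V y - d y) - (?V x - d x) \<and> (?V y - d y) - (?V x - d x) \<le> 2 * (?V y - ?V x)"
    if "a \<le> x" "x \<le> y" "y \<le> b" and d: "\<bar>d y - d x\<bar> \<le> cmod (h y - h x)" for x y and d :: "real \<Rightarrow> real"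
  proof -
    have "\<bar>d y - d x\<bar> \<le> ?V y - ?V x"
      using inc[OF that(1-3)] d by (simp add: le_diff_eq add.commute order_trans[OF add_left_mono])
    then show ?thesis by (auto simp: abs_le_iff)
  qed
  have R: "0 \<le> (?V y - Re (h y)) - (?V x - Re (h x)) \<and> (?V y - Re (h y)) - (?V x - Re (h x)) \<le> 2 * (?V y - ?V x)"
    if "a \<le> x" "x \<le> y" "y \<le> b" for x y
    using dom[OF that, of "\<lambda>x. Re (h x)"] abs_Re_le_cmod[of "h y - h x"] by simp
  have I: "0 \<le> (?V y - Im (h y)) - (?V x - Im (h x)) \<and> (?V y - Im (h y)) - (?V x - Im (h x)) \<le> 2 * (?V y - ?V x)"
    if "a \<le> x" "x \<le> y" "y \<le> b" for x y
    using dom[OF that, of "\<lambda>x. Im (h x)"] abs_Im_le_cmod[of "h y - h x"] by simp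
  obtain g0 where g0 [measurable]: "g0 \<in> borel_measurable borel"
    and g0': "\<And>x y. x \<le> y \<Longrightarrow> set_integrable lborel {x<..y} g0"
    "\<And>x y. x \<le> y \<Longrightarrow> ?V (?c y) - ?V (?c x) = (LINT t:{x<..y}|lborel. g0 t)"
    "AE x in lborel. ((\<lambda>x. ?V (?c x)) has_real_derivative g0 x) (at x)"
    using dominated_density[OF ac V] by blast
  obtain g1 where g1 [measurable]: "g1 \<in> borel_measurable borel"
    and g1': "\<And>x y. x \<le> y \<Longrightarrow> set_integrable lborel {x<..y} g1"
    "\<And>x y. x \<le> y \<Longrightarrow> (?V (?c y) - Re (h (?c y))) - (?V (?c x) - Re (h (?c x))) = (LINT t:{x<..y}|lborel. g1 t)"
    "AE x in lborel. ((\<lambda>x. ?V (?c x) - Re (h (?c x))) has_real_derivative g1 x) (at x)"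
    using dominated_density[OF ac R] by blast
  obtain g2 where g2 [measurable]: "g2 \<in> borel_measurable borel"
    and g2': "\<And>x y. x \<le> y \<Longrightarrow> set_integrable lborel {x<..y} g2"
    "\<And>x y. x \<le> y \<Longrightarrow> (?V (?c y) - Im (h (?c y))) - (?V (?c x) - Im (h (?c x))) = (LINT t:{x<..y}|lborel. g2 t)"
    "AE x in lborel. ((\<lambda>x. ?V (?c x) - Im (h (?c x))) has_real_derivative g2 x) (at x)"
    using dominated_density[OF ac I] by blast
  define \<gamma> where "\<gamma> x = complex_of_real (g0 x - g1 x) + \<i> * complex_of_real (g0 x - g2 x)" for x
  have \<gamma>m [measurable]: "\<gamma> \<in> borel_measurable borel" unfolding \<gamma>_def by measurable
  let ?I = "\<lambda>g t. indicator {a<..b} t *\<^sub>R g t"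
  have int: "integrable lborel (?I g0)" "integrable lborel (?I g1)" "integrable lborel (?I g2)"
    using g0'(1)[OF ab] g1'(1)[OF ab] g2'(1)[OF ab] by (auto simp: set_integrable_def)
  have eq: "?I \<gamma> = (\<lambda>t. of_real (?I g0 t - ?I g1 t) + \<i> * of_real (?I g0 t - ?I g2 t))"
    by (auto simp: \<gamma>_def indicator_def)
  have i1: "integrable lborel (\<lambda>t. complex_of_real (?I g0 t - ?I g1 t))"
    by (intro integrable_of_real Bochner_Integration.integrable_diff int)
  have i2: "integrable lborel (\<lambda>t. \<i> * complex_of_real (?I g0 t - ?I g2 t))"
    by (intro integrable_mult_right integrable_of_real Bochner_Integration.integrable_diff int)
  have int\<gamma>: "integrable lborel (?I \<gamma>)" unfolding eq by (rule Bochner_Integration.integrable_add[OF i1 i2])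
  have "(\<integral>t. ?I \<gamma> t \<partial>lborel) = of_real ((\<integral>t. ?I g0 t \<partial>lborel) - (\<integral>t. ?I g1 t \<partial>lborel)) + \<i> * of_real ((\<integral>t. ?I g0 t \<partial>lborel) - (\<integral>t. ?I g2 t \<partial>lborel))"
    unfolding eq Bochner_Integration.integral_add[OF i1 i2] integral_mult_right_zero integral_complex_of_real
    by (simp only: Bochner_Integration.integral_diff[OF int(1) int(2)] Bochner_Integration.integral_diff[OF int(1) int(3)])
  also have "(\<integral>t. ?I g0 t \<partial>lborel) = ?V b - ?V a"
    using g0'(2)[OF ab] clamp(5)[of a] clamp(5)[of b] ab by (simp add: set_lebesgue_integral_def)
  also have "(\<integral>t. ?I g1 t \<partial>lborel) = (?V b - Re (h b)) - (?V a - Re (h a))"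
    using g1'(2)[OF ab] clamp(5)[of a] clamp(5)[of b] ab by (simp add: set_lebesgue_integral_def)
  also have "(\<integral>t. ?I g2 t \<partial>lborel) = (?V b - Im (h b)) - (?V a - Im (h a))"
    using g2'(2)[OF ab] clamp(5)[of a] clamp(5)[of b] ab by (simp add: set_lebesgue_integral_def)
  finally have val: "(\<integral>t. ?I \<gamma> t \<partial>lborel) = h b - h a" by (simp add: complex_eq_iff)
  have "AE x in lborel. a < x \<and> x < b \<longrightarrow> vector_derivative h (at x) = \<gamma> x"
    using g0'(3) g1'(3) g2'(3)
  proof eventually_elim
    case (elim x)
    show ?case
    proof
      assume x: "a < x \<and> x < b"
      have dr: "((\<lambda>x. Re (h (?c x))) has_real_derivative g0 x - g1 x) (at x)"
        using DERIV_diff[OF elim(1) elim(2)] by simp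
      have di: "((\<lambda>x. Im (h (?c x))) has_real_derivative g0 x - g2 x) (at x)"
        using DERIV_diff[OF elim(1) elim(3)] by simp
      have "((\<lambda>x. of_real (Re (h (?c x))) + \<i> * of_real (Im (h (?c x)))) has_vector_derivative \<gamma> x) (at x)"
        unfolding \<gamma>_def
          by (intro has_vector_derivative_add has_vector_derivative_mult_right has_vector_derivative_of_real dr di)
      then have "((\<lambda>x. h (?c x)) has_vector_derivative \<gamma> x) (at x)" by (simp flip: complex_eq)
      then have "(h has_vector_derivative \<gamma> x) (at x)"
        by (rule has_vector_derivative_transform_within_open[of _ _ _ "{a<..<b}"]) (use x clamp(5) in auto)
      then show "vector_derivative h (at x) = \<gamma> x" by (rule vector_derivative_at)
    qed
  qed
  moreover have "AE x in lborel. x \<noteq> b" by (rule AE_lborel_singleton)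
  ultimately have "AE x in lborel. ?I \<gamma> x = ?I (\<lambda>x. vector_derivative h (at x)) x"
    by eventually_elim (auto simp: indicator_def)
  then have ae: "AE x in lebesgue. ?I \<gamma> x = ?I (\<lambda>x. vector_derivative h (at x)) x" by (rule AE_completion)
  have m1: "?I \<gamma> \<in> borel_measurable lborel" by measurable
  have m2: "?I (\<lambda>x. vector_derivative h (at x)) \<in> borel_measurable lebesgue"
    using m by (intro borel_measurable_scaleR borel_measurable_indicator) auto
  have "integrable lebesgue (?I \<gamma>)" using int\<gamma> by (subst integrable_completion[OF m1])
  with ae show "set_integrable lebesgue {a<..b} (\<lambda>x. vector_derivative h (at x))"
    unfolding set_integrable_def using m2 measurable_completion[OF m1] by (subst integrable_cong_AE[of _ _ "?I \<gamma>"]) auto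
  have "(LINT t:{a<..b}|lebesgue. vector_derivative h (at t)) = (\<integral>t. ?I \<gamma> t \<partial>lebesgue)"
    unfolding set_lebesgue_integral_def using ae m2 measurable_completion[OF m1] by (intro integral_cong_AE) auto
  also have "\<dots> = h b - h a" using val by (subst integral_completion[OF m1])
  finally show "h b - h a = (LINT t:{a<..b}|lebesgue. vector_derivative h (at t))" ..
qed

end

text \<open>On short intervals the variation is at most 1, so the local version applies; the property is additive in
  intervals, and bisection passes to long ones.\<close>

theorem abs_cont_primitive_of_derivative:
  fixes h :: "real \<Rightarrow> complex"
  assumes ac: "\<And>a b. abs_cont_on a b h" and m: "(\<lambda>x. vector_derivative h (at x)) \<in> borel_measurable lebesgue"
  shows "primitive_of (\<lambda>x. vector_derivative h (at x)) h"
proof -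
  let ?D = "\<lambda>x. vector_derivative h (at x)"
  define Q where "Q a b \<longleftrightarrow> (a \<le> b \<longrightarrow> set_integrable lebesgue {a<..b} ?D \<and> h b - h a = (LINT t:{a<..b}|lebesgue. ?D t))"
    for a b
  have "Q x y" if xy: "x \<le> y" for x y
    using xy
  proof (induction rule: Bolzano)
    case (trans a b c)
    then have ab: "set_integrable lebesgue {a<..b} ?D" "h b - h a = (LINT t:{a<..b}|lebesgue. ?D t)"
      and bc: "set_integrable lebesgue {b<..c} ?D" "h c - h b = (LINT t:{b<..c}|lebesgue. ?D t)"
      by (auto simp: Q_def)
    have "{a<..c} = {a<..b} \<union> {b<..c}" using trans by auto
    then have "set_integrable lebesgue {a<..c} ?D" "(LINT t:{a<..c}|lebesgue. ?D t) = (h b - h a) + (h c - h b)"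
      using set_integrable_Un[OF ab(1) bc(1)] set_integral_Un[OF _ ab(1) bc(1)] ab(2) bc(2) by auto
    then show ?case by (simp add: Q_def)
  next
    case (local z)
    obtain d where d: "d > 0" "\<And>I (u :: nat \<Rightarrow> real) v. interval_family I u v (z - 1) (z + 1) \<Longrightarrow> (\<Sum>i\<in>I. v i - u i) < d
      \<Longrightarrow> (\<Sum>i\<in>I. cmod (h (v i) - h (u i))) < 1"
      using abs_cont_on_family[OF ac[of "z - 1" "z + 1"] zero_less_one, where 'i = nat] by auto
    show ?case
    proof (intro exI[of _ "min d 1"] conjI allI impI)
      fix a b assume ab: "a \<le> z \<and> z \<le> b \<and> b - a < min d 1"
      have "bdd_above (variation_sums h a b)"
      proof (rule bdd_aboveI)
        fix s assume "s \<in> variation_sums h a b"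
        then obtain I :: "nat set"
          and u v where s: "s = (\<Sum>i\<in>I. cmod (h (v i) - h (u i)))" and F: "interval_family I u v a b"
          unfolding variation_sums_def by blast
        have "(\<Sum>i\<in>I. v i - u i) \<le> b - a" using ab by (intro interval_family_length[OF F]) auto
        moreover have "interval_family I u v (z - 1) (z + 1)" using ab by (intro interval_family_mono[OF F]) auto
        ultimately show "s \<le> 1" unfolding s using d(2)[of I u v] ab by auto
      qed
      then interpret bounded_variation_interval h a b using ab by unfold_locales auto
      show "Q a b" unfolding Q_def using abs_cont_integral_local[OF ac m] by blast
    qed (use d in auto)
  qed
  then show ?thesis unfolding primitive_of_def Q_def by blast
qed

section \<open>Jackson and Bernstein type estimates\<close>

subsection \<open>Primitives and infima\<close>

lemma primitive_of_continuous:
  fixes G g :: "real \<Rightarrow> complex"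
  assumes G: "\<And>x. (G has_vector_derivative g x) (at x)" and g: "continuous_on UNIV g"
  shows "primitive_of g G"
  unfolding primitive_of_def
proof (intro allI impI)
  fix x y :: real assume xy: "x \<le> y"
  have gm [measurable]: "g \<in> borel_measurable borel" using g by (rule borel_measurable_continuous_onI)
  have cont: "continuous_on {x..y} g" using g by (rule continuous_on_subset) simp
  have int: "integrable lborel (\<lambda>t. indicator {x..y} t *\<^sub>R g t)"
    using borel_integrable_atLeastAtMost'[OF cont] by (simp add: set_integrable_def)
  have val: "(\<integral>t. indicator {x..y} t *\<^sub>R g t \<partial>lborel) = G y - G x"
    using xy cont by (intro integral_FTC_atLeastAtMost) (auto intro: has_vector_derivative_at_within G)
  have ae: "AE t in lborel. indicator {x..y} t *\<^sub>R g t = indicator {x<..y} t *\<^sub>R g t"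
    using AE_lborel_singleton[of x] by eventually_elim (auto simp: indicator_def)
  have m: "(\<lambda>t. indicator {x<..y} t *\<^sub>R g t) \<in> borel_measurable lborel" by measurable
  have "integrable lborel (\<lambda>t. indicator {x<..y} t *\<^sub>R g t)"
    using int integrable_cong_AE[OF _ m ae] by auto
  moreover have "(\<integral>t. indicator {x<..y} t *\<^sub>R g t \<partial>lborel) = G y - G x"
    using val integral_cong_AE[OF _ m ae] int by auto
  ultimately show "set_integrable lebesgue {x<..y} g \<and> G y - G x = (LINT t:{x<..y}|lebesgue. g t)"
    unfolding set_integrable_def set_lebesgue_integral_def
    by (simp add: integrable_completion[OF m] integral_completion[OF m])
qed

lemma primitive_of_diff:
  assumes "primitive_of F' F" "primitive_of G' G"
  shows "primitive_of (\<lambda>x. F' x - G' x) (\<lambda>x. F x - G x)"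
  unfolding primitive_of_def
proof (intro allI impI)
  fix x y :: real assume "x \<le> y"
  then have F: "set_integrable lebesgue {x<..y} F'" "F y - F x = (LINT t:{x<..y}|lebesgue. F' t)"
    and G: "set_integrable lebesgue {x<..y} G'" "G y - G x = (LINT t:{x<..y}|lebesgue. G' t)"
    using assms unfolding primitive_of_def by auto
  show "set_integrable lebesgue {x<..y} (\<lambda>x. F' x - G' x) \<and> F y - G y - (F x - G x) = (LINT t:{x<..y}|lebesgue. F' t - G' t)"
    using set_integral_diff[OF F(1) G(1)] F(2) G(2) by (simp add: algebra_simps)
qed

text \<open>Passes from an estimate for every competitor to one for the best approximation.\<close>

lemma le_cmult_INF_add:
  fixes x a :: ennreal and y :: "'i \<Rightarrow> ennreal"
  assumes c: "c > 0" and I: "I \<noteq> {}" and le: "\<And>i. i \<in> I \<Longrightarrow> x \<le> ennreal c * (a + y i)"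
  shows "x \<le> ennreal c * (a + (INF i\<in>I. y i))"
proof (rule ennreal_le_epsilon)
  fix e :: real assume fin: "ennreal c * (a + (INF i\<in>I. y i)) < top" and e: "e > 0"
  from fin c have "(INF i\<in>I. y i) < top" by (auto simp: ennreal_mult_eq_top_iff less_top[symmetric])
  then have "(INF i\<in>I. y i) < (INF i\<in>I. y i) + ennreal (e / c)"
    using e c by (cases "INF i\<in>I. y i") (auto simp: ennreal_plus[symmetric] ennreal_less_iff simp del: ennreal_plus)
  then obtain i where i: "i \<in> I" "y i < (INF i\<in>I. y i) + ennreal (e / c)" unfolding INF_less_iff by blast
  have "x \<le> ennreal c * (a + y i)" by (rule le[OF i(1)])
  also have "\<dots> \<le> ennreal c * (a + ((INF i\<in>I. y i) + ennreal (e / c)))"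
    using i(2) by (intro mult_left_mono add_left_mono) auto
  also have "\<dots> = ennreal c * (a + (INF i\<in>I. y i)) + ennreal c * ennreal (e / c)" by (simp add: distrib_left add.assoc)
  also have "ennreal c * ennreal (e / c) = ennreal e" using c e by (simp add: ennreal_mult[symmetric])
  finally show "x \<le> ennreal c * (a + (INF i\<in>I. y i)) + ennreal e" .
qed

lemma entire_real_measurable:
  assumes "q holomorphic_on UNIV" shows "(\<lambda>t::real. q (of_real t)) \<in> borel_measurable lebesgue"
  using measurable_compose[OF borel_measurable_lebesgue_ident holomorphic_on_UNIV_measurable[OF assms]] by simp

lemma linear_growth_integrable:
  fixes f :: "real \<Rightarrow> complex"
  assumes [measurable]: "f \<in> borel_measurable lebesgue" and le: "\<And>t. cmod (f t) \<le> B * (1 + \<bar>t\<bar>)" and n: "3 \<le> n"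
  shows "integrable lebesgue (\<lambda>t. cmod (f t) / (1 + \<bar>t\<bar>) ^ n)"
proof -
  have B: "B \<ge> 0" using order_trans[OF norm_ge_zero le[of 0]] by simp
  have meas: "(\<lambda>t::real. (1 + \<bar>t\<bar>) ^ n) \<in> borel_measurable lebesgue"
  proof -
    have "(\<lambda>t::real. (1 + \<bar>t\<bar>) ^ n) \<in> borel_measurable lborel" by simp
    then show ?thesis by (rule measurable_completion)
  qed
  show ?thesis
  proof (rule Bochner_Integration.integrable_bound)
    show "integrable lebesgue (\<lambda>t::real. B * (1 / (1 + t\<^sup>2)))" by (intro integrable_mult_right integrable_square_weight)
    have "cmod (f t) / (1 + \<bar>t\<bar>) ^ n \<le> B * (1 / (1 + t\<^sup>2))" for t
    proof -
      obtain m where m: "n = Suc m" "2 \<le> m" using n by (cases n) auto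
      have "cmod (f t) / (1 + \<bar>t\<bar>) ^ n \<le> (B * (1 + \<bar>t\<bar>)) / (1 + \<bar>t\<bar>) ^ n" by (intro divide_right_mono le) auto
      also have "\<dots> = B * (1 / (1 + \<bar>t\<bar>) ^ m)"
      proof -
        have "1 + \<bar>t\<bar> \<noteq> 0" using abs_ge_zero[of t] by linarith
        then show ?thesis by (simp add: m)
      qed
      also have "\<dots> \<le> B * (1 / (1 + t\<^sup>2))" using B m by (intro mult_left_mono square_weight_dominates) auto
      finally show ?thesis .
    qed
    then show "AE t in lebesgue. norm (cmod (f t) / (1 + \<bar>t\<bar>) ^ n) \<le> norm (B * (1 / (1 + t\<^sup>2)))"
      using B by (intro AE_I2) (simp add: abs_mult)
  qed (use meas in measurable)
qed

context log_exponent
begin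

subsection \<open>The variable exponent space\<close>

lemma Lvar_measurable: "h \<in> Lvar p \<Longrightarrow> h \<in> borel_measurable lebesgue"
  by (simp add: Lvar_def)

lemma LvarI: "h \<in> borel_measurable lebesgue \<Longrightarrow> Lnorm p h < \<infinity> \<Longrightarrow> h \<in> Lvar p"
  using Lnorm_finite_iff[OF p_ge p_measurable] by blast

lemma Lnorm_finite: "h \<in> Lvar p \<Longrightarrow> Lnorm p h < \<infinity>"
  using Lnorm_finite_iff[OF p_ge p_measurable Lvar_measurable] by blast

lemma p_nonneg: "0 \<le> p x" using p_ge[of x] by linarith

lemma Lnorm_triangle': "f \<in> borel_measurable lebesgue \<Longrightarrow> g \<in> borel_measurable lebesgue \<Longrightarrow>
   Lnorm p (\<lambda>x. f x + g x) \<le> Lnorm p f + Lnorm p g"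
  by (rule Lnorm_triangle[OF p_ge p_measurable])

lemma Lnorm_minus: "Lnorm p (\<lambda>x. - f x) = Lnorm p f"
  by (intro antisym Lnorm_mono p_nonneg) auto

lemma Lnorm_triangle_diff: "f \<in> borel_measurable lebesgue \<Longrightarrow> g \<in> borel_measurable lebesgue \<Longrightarrow>
   Lnorm p (\<lambda>x. f x - g x) \<le> Lnorm p f + Lnorm p g"
  using Lnorm_triangle'[of f "\<lambda>x. - g x"] Lnorm_minus[of g] by simp

lemma Lvar_diff: "f \<in> Lvar p \<Longrightarrow> g \<in> Lvar p \<Longrightarrow> (\<lambda>x. f x - g x) \<in> Lvar p"
  using Lnorm_triangle_diff[of f g] Lnorm_finite[of f] Lnorm_finite[of g] Lvar_measurable[of f] Lvar_measurable[of g]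
  by (intro LvarI) (auto intro: le_less_trans)

lemma Lvar_zero: "(\<lambda>x. 0) \<in> Lvar p"
  unfolding Lvar_def modular_def by (auto intro!: exI[of _ 1])

lemma Lvar_conv:
  assumes "\<tau> > 0" "A > 0" "K \<in> borel_measurable borel" "\<And>w. cmod (K w) \<le> A * poisson_kernel \<tau> w" "h \<in> Lvar p"
  shows "conv K h \<in> Lvar p"
proof (rule LvarI)
  show "conv K h \<in> borel_measurable lebesgue" using assms by (intro measurable_conv Lvar_measurable)
  have "Lnorm p (conv K h) \<le> ennreal (conv_norm_bound * A) * Lnorm p h"
    using assms by (intro Lnorm_conv_le[of \<tau>] Lvar_measurable)
  also have "\<dots> < \<infinity>" using Lnorm_finite[OF assms(5)] by (simp add: ennreal_mult_less_top)
  finally show "Lnorm p (conv K h) < \<infinity>" .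
qed

lemma Lvar_weight_integrable:
  assumes h: "h \<in> Lvar p" and n: "2 \<le> n"
  shows "integrable lebesgue (\<lambda>t. cmod (h t) / (1 + \<bar>t\<bar>) ^ n)"
proof -
  note [measurable] = Lvar_measurable[OF h]
  have meas: "(\<lambda>t::real. (1 + \<bar>t\<bar>) ^ n) \<in> borel_measurable lebesgue"
  proof -
    have "(\<lambda>t::real. (1 + \<bar>t\<bar>) ^ n) \<in> borel_measurable lborel" by simp
    then show ?thesis by (rule measurable_completion)
  qed
  show ?thesis
  proof (rule Bochner_Integration.integrable_bound)
    show "integrable lebesgue (\<lambda>t. pi * (poisson_kernel 1 (0 - t) * cmod (h t)))"
      using poisson_conv_integrable[OF _ h, of 1 0] by (intro integrable_mult_right) simp
    have "cmod (h t) / (1 + \<bar>t\<bar>) ^ n \<le> pi * (poisson_kernel 1 (0 - t) * cmod (h t))" for t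
      using mult_right_mono[OF square_weight_dominates[OF n, of t], of "cmod (h t)"] by (simp add: poisson_kernel_def)
    then show "AE t in lebesgue. norm (cmod (h t) / (1 + \<bar>t\<bar>) ^ n) \<le> norm (pi * (poisson_kernel 1 (0 - t) * cmod (h t)))"
      by (intro AE_I2) (simp add: abs_mult poisson_kernel_nonneg)
  qed (use meas in measurable)
qed

text \<open>From \<open>a \<le> 1 + a\<^bsup>q\<^esup>\<close>: up to scaling, the integral of \<open>|h|\<close> over an interval is at most the length plus
  the modular.\<close>

lemma Lvar_local_integral:
  assumes h: "h \<in> Lvar p"
  obtains B where "B > 0" "\<And>x y. x \<le> y \<Longrightarrow> set_integrable lebesgue {x<..y} h"
    "\<And>x y. x \<le> y \<Longrightarrow> cmod (LINT t:{x<..y}|lebesgue. h t) \<le> B * (1 + (y - x))"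
proof -
  obtain \<eta> where \<eta>: "\<eta> > 0" "modular p (\<lambda>y. h y / of_real \<eta>) < 1" "h \<in> borel_measurable lebesgue"
    using h by (rule LvarE)
  note [measurable] = \<eta>(3)
  define m where "m t = cmod (h t / of_real \<eta>) powr p t" for t
  have mm [measurable]: "m \<in> borel_measurable lebesgue" unfolding m_def by measurable
  have nn: "(\<integral>\<^sup>+t. ennreal (m t) \<partial>lebesgue) < 1" using \<eta>(2) by (simp add: modular_def m_def)
  have m0: "0 \<le> m t" for t by (simp add: m_def)
  have int_m: "integrable lebesgue m" using nn m0 by (intro integrableI_nonneg) (auto intro: less_trans)
  have I_m: "(\<integral>t. m t \<partial>lebesgue) \<le> 1" using nn nn_integral_eq_integral[OF int_m] m0 by (simp add: ennreal_less_one_iff)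
  have le: "cmod (h t) \<le> \<eta> + \<eta> * m t" for t
  proof -
    have "cmod (h t / of_real \<eta>) \<le> 1 + m t"
      using le_add_powr[of "cmod (h t / of_real \<eta>)" 1 "p t"] p_ge by (simp add: m_def)
    then show ?thesis using \<eta>(1) by (simp add: norm_divide divide_simps algebra_simps)
  qed
  have main: "set_integrable lebesgue {x<..y} h \<and> cmod (LINT t:{x<..y}|lebesgue. h t) \<le> \<eta> * (1 + (y - x))"
    if xy: "x \<le> y" for x y
  proof -
    have i1: "integrable lebesgue (\<lambda>t. \<eta> * indicator {x<..y} t)"
      using xy by (intro integrable_mult_right) (simp add: integrable_indicator_iff)
    then have i2: "integrable lebesgue (\<lambda>t. \<eta> * indicator {x<..y} t + \<eta> * m t)" using int_m by auto
    have b: "cmod (indicator {x<..y} t *\<^sub>R h t) \<le> \<eta> * indicator {x<..y} t + \<eta> * m t" for t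
      using le[of t] m0[of t] \<eta>(1) by (auto simp: indicator_def)
    have i: "integrable lebesgue (\<lambda>t. indicator {x<..y} t *\<^sub>R h t)"
    proof (rule Bochner_Integration.integrable_bound[OF i2])
      show "AE t in lebesgue. norm (indicator {x<..y} t *\<^sub>R h t) \<le> norm (\<eta> * indicator {x<..y} t + \<eta> * m t)"
        by (intro AE_I2 order_trans[OF b]) simp
    qed (intro borel_measurable_scaleR borel_measurable_indicator \<eta>(3), auto)
    have "cmod (\<integral>t. indicator {x<..y} t *\<^sub>R h t \<partial>lebesgue) \<le> (\<integral>t. cmod (indicator {x<..y} t *\<^sub>R h t) \<partial>lebesgue)"
      by (rule integral_norm_bound)
    also have "\<dots> \<le> (\<integral>t. \<eta> * indicator {x<..y} t + \<eta> * m t \<partial>lebesgue)"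
      by (rule integral_mono[OF integrable_norm[OF i] i2 b])
    also have "\<dots> = \<eta> * (y - x) + \<eta> * (\<integral>t. m t \<partial>lebesgue)" using i1 int_m xy by simp
    also have "\<dots> \<le> \<eta> * (y - x) + \<eta> * 1" using I_m \<eta>(1) by (intro add_left_mono mult_left_mono) auto
    finally show ?thesis using i by (simp add: set_integrable_def set_lebesgue_integral_def algebra_simps)
  qed
  show thesis by (rule that[OF \<eta>(1)]) (use main in auto)
qed

subsection \<open>Primitives of the approximating functions\<close>

text \<open>Membership in the space by itself yields no pointwise bound for \<open>g\<close> on the line, but it does bound the primitive \<open>Q\<close>
  linearly there. Hence the Phragmen-Lindelof argument is applied to \<open>Q\<close>, and Cauchy's estimate returns to
  \<open>g = Q'\<close>.\<close>

lemma Gvar_primitive: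
  assumes \<sigma>: "\<sigma> > 0" and g: "g \<in> Gvar \<sigma> p"
  obtains Q B where "exp_type_le \<sigma> Q" "primitive_of (\<lambda>x. g (of_real x)) (\<lambda>x. Q (of_real x))"
    "\<And>x::real. cmod (Q (of_real x)) \<le> B * (1 + \<bar>x\<bar>)"
    "\<And>z. cmod (g z) \<le> B * (1 + cmod z) * exp (6 * \<sigma> * \<bar>Im z\<bar>)"
proof -
  have hol: "g holomorphic_on UNIV" and growth: "\<And>e. e > 0 \<Longrightarrow> \<exists>A. \<forall>z. cmod (g z) \<le> A * exp ((\<sigma> + e) * cmod z)"
    and gL: "(\<lambda>x. g (of_real x)) \<in> Lvar p"
    using g by (auto simp: Gvar_def exp_type_le_def)
  obtain P0 where P0: "\<And>z. (P0 has_field_derivative g z) (at z)"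
    using holomorphic_convex_primitive'[of UNIV g] hol by auto
  define Q where "Q z = P0 z - P0 0" for z
  have dP: "(Q has_field_derivative g z) (at z)" for z
    unfolding Q_def using P0[of z] by (auto intro!: derivative_eq_intros)
  have holP: "Q holomorphic_on UNIV"
    using dP by (auto simp: holomorphic_on_def field_differentiable_def intro: has_field_derivative_at_within)
  have derivP: "deriv Q = g" using dP by (auto intro: DERIV_imp_deriv)
  have Pbd: "cmod (Q z) \<le> cmod z * (A * exp (b * cmod z))"
    if A: "\<And>z. cmod (g z) \<le> A * exp (b * cmod z)" and b: "0 \<le> b" for A b z
  proof -
    have A0: "A \<ge> 0" using order_trans[OF norm_ge_zero A[of 0]] by simp
    have "cmod (Q z - Q 0) \<le> (A * exp (b * cmod z)) * cmod (z - 0)"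
    proof (rule field_differentiable_bound[of "closed_segment 0 z" Q g])
      fix w assume "w \<in> closed_segment 0 z"
      then have w: "cmod w \<le> cmod z" using segment_bound1[of w 0 z] by simp
      show "(Q has_field_derivative g w) (at w within closed_segment 0 z)"
        by (rule has_field_derivative_at_within[OF dP])
      have "A * exp (b * cmod w) \<le> A * exp (b * cmod z)"
        using w A0 b by (intro mult_left_mono) (auto intro: mult_left_mono)
      with A[of w] show "cmod (g w) \<le> A * exp (b * cmod z)" by linarith
    qed auto
    then show ?thesis by (simp add: Q_def mult.commute)
  qed
  have Pexp: "\<exists>A. \<forall>z. cmod (Q z) \<le> A * exp ((\<sigma> + e) * cmod z)" if e: "e > 0" for e
  proof -
    obtain A where A: "\<And>z. cmod (g z) \<le> A * exp ((\<sigma> + e / 2) * cmod z)" using growth[of "e / 2"] e by auto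
    have A0: "A \<ge> 0" using order_trans[OF norm_ge_zero A[of 0]] by simp
    have "cmod (Q z) \<le> (A * max 1 (1 / (e / 2))) * exp ((\<sigma> + e) * cmod z)" for z
    proof -
      have "cmod z \<le> max 1 (1 / (e / 2)) * exp (e / 2 * cmod z)" using one_plus_le_exp[of "cmod z" "e / 2"] e by simp
      then have "cmod z * (A * exp ((\<sigma> + e / 2) * cmod z)) \<le> (max 1 (1 / (e / 2)) * exp (e / 2 * cmod z)) * (A * exp ((\<sigma> + e / 2) * cmod z))"
        using A0 by (intro mult_right_mono) auto
      also have "\<dots> = (A * max 1 (1 / (e / 2))) * (exp (e / 2 * cmod z) * exp ((\<sigma> + e / 2) * cmod z))"
        by (simp only: mult_ac)
      also have "exp (e / 2 * cmod z) * exp ((\<sigma> + e / 2) * cmod z) = exp ((\<sigma> + e) * cmod z)"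
        by (simp add: exp_add[symmetric] distrib_right)
      finally show ?thesis using Pbd[OF A, of z] \<sigma> e by simp
    qed
    then show ?thesis by blast
  qed
  have type: "exp_type_le \<sigma> Q" using holP Pexp by (simp add: exp_type_le_def)
  have vd: "((\<lambda>x. Q (of_real x)) has_vector_derivative g (of_real x)) (at x)" for x
    using has_vector_derivative_of_entire[OF holP, of x] derivP by simp
  have prim: "primitive_of (\<lambda>x. g (of_real x)) (\<lambda>x. Q (of_real x))"
    by (intro primitive_of_continuous vd continuous_on_compose2[OF holomorphic_on_imp_continuous_on[OF hol]] continuous_intros) auto
  obtain B0 where B0: "B0 > 0" "\<And>x y. x \<le> y \<Longrightarrow> set_integrable lebesgue {x<..y} (\<lambda>t. g (of_real t))"
    "\<And>x y. x \<le> y \<Longrightarrow> cmod (LINT t:{x<..y}|lebesgue. g (of_real t)) \<le> B0 * (1 + (y - x))"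
    by (rule Lvar_local_integral[OF gL]) blast
  have Preal: "cmod (Q (of_real x)) \<le> B0 * (1 + \<bar>x\<bar>)" for x
  proof -
    have P00: "Q (of_real 0) = 0" by (simp add: Q_def)
    show ?thesis
    proof (cases "0 \<le> x")
      case True
      then have "Q (of_real x) - Q (of_real 0) = (LINT t:{0<..x}|lebesgue. g (of_real t))"
        using prim unfolding primitive_of_def by blast
      with B0(3)[OF True] True P00 show ?thesis by simp
    next
      case False
      then have "Q (of_real 0) - Q (of_real x) = (LINT t:{x<..0}|lebesgue. g (of_real t))"
        using prim unfolding primitive_of_def by (meson linorder_not_le less_imp_le)
      then have "cmod (Q (of_real x)) = cmod (LINT t:{x<..0}|lebesgue. g (of_real t))"
        using P00 by (metis diff_0 norm_minus_cancel)
      with B0(3)[of x 0] False show ?thesis by simp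
    qed
  qed
  \<comment> \<open>The definition of the type leaves an arbitrary \<open>\<epsilon>\<close>, here \<open>\<epsilon> = \<sigma>\<close>; the Phragmen-Lindelof bound triples \<open>2 \<sigma>\<close> to \<open>6 \<sigma>\<close>.\<close>
  obtain A where A: "\<And>z. cmod (Q z) \<le> A * exp ((\<sigma> + \<sigma>) * cmod z)" using Pexp[OF \<sigma>] by auto
  define B where "B = 2 * max A B0 * exp (3 * (\<sigma> + \<sigma>))"
  have "cmod (Q z) \<le> max A B0 * (1 + cmod z) * exp (3 * (\<sigma> + \<sigma>) * \<bar>Im z\<bar>)" for z
    using \<sigma> by (intro plane_growth[OF holP _ A Preal]) auto
  then have gB: "cmod (g z) \<le> B * (1 + cmod z) * exp (6 * \<sigma> * \<bar>Im z\<bar>)" for z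
    using deriv_growth[OF holP, of "3 * (\<sigma> + \<sigma>)" "max A B0" z] \<sigma> B0(1) unfolding derivP B_def
    by (simp add: max.coboundedI2)
  have "B0 \<le> B"
  proof -
    have "1 * 1 \<le> 2 * exp (3 * (\<sigma> + \<sigma>))" using \<sigma> by (intro mult_mono) auto
    then have "max A B0 * 1 \<le> max A B0 * (2 * exp (3 * (\<sigma> + \<sigma>)))" using B0 by (intro mult_left_mono) auto
    then show ?thesis by (simp add: B_def mult_ac)
  qed
  then have "cmod (Q (of_real x)) \<le> B * (1 + \<bar>x\<bar>)" for x
    by (intro order_trans[OF Preal] mult_right_mono) auto
  with type prim gB show thesis using that by blast
qed

lemma Gvar_growth:
  assumes \<sigma>: "\<sigma> > 0" and g: "g \<in> Gvar \<sigma> p"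
  shows "\<exists>B. \<forall>z. cmod (g z) \<le> B * (1 + cmod z) * exp (6 * \<sigma> * \<bar>Im z\<bar>)"
  by (rule Gvar_primitive[OF \<sigma> g]) blast

lemma Gvar_nonempty: "Gvar \<sigma> p \<noteq> {}"
proof -
  have "(\<lambda>z. 0) \<in> Gvar \<sigma> p" using Lvar_zero by (auto simp: Gvar_def exp_type_le_def intro!: exI[of _ 1])
  then show ?thesis by blast
qed

subsection \<open>The two estimates\<close>

text \<open>The bound depends on the kernel alone, not on the exponent or the scale; choosing it once keeps the constants
  below free of \<open>\<sigma>\<close>.\<close>

definition kernel_bound :: real where
  "kernel_bound = (SOME A. A > 0 \<and>
    (\<forall>l t. l > 0 \<longrightarrow> cmod (scaled_kernel l (of_real t)) \<le> A * poisson_kernel (1 / l) t) \<and>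
    (\<forall>l t. l > 0 \<longrightarrow> cmod (deriv (scaled_kernel l) (of_real t)) \<le> (A * l) * poisson_kernel (1 / l) t) \<and>
    (\<forall>l t. l > 0 \<longrightarrow> cmod (tail_kernel (\<lambda>t. scaled_kernel l (of_real t)) t) \<le> (A / l) * poisson_kernel (1 / l) t))"

lemma kernel_bound:
  "kernel_bound > 0"
  "l > 0 \<Longrightarrow> cmod (scaled_kernel l (of_real t)) \<le> kernel_bound * poisson_kernel (1 / l) t"
  "l > 0 \<Longrightarrow> cmod (deriv (scaled_kernel l) (of_real t)) \<le> (kernel_bound * l) * poisson_kernel (1 / l) t"
  "l > 0 \<Longrightarrow> cmod (tail_kernel (\<lambda>t. scaled_kernel l (of_real t)) t) \<le> (kernel_bound / l) * poisson_kernel (1 / l) t"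
proof -
  have "\<exists>A. A > 0 \<and>
    (\<forall>l t. l > 0 \<longrightarrow> cmod (scaled_kernel l (of_real t)) \<le> A * poisson_kernel (1 / l) t) \<and>
    (\<forall>l t. l > 0 \<longrightarrow> cmod (deriv (scaled_kernel l) (of_real t)) \<le> (A * l) * poisson_kernel (1 / l) t) \<and>
    (\<forall>l t. l > 0 \<longrightarrow> cmod (tail_kernel (\<lambda>t. scaled_kernel l (of_real t)) t) \<le> (A / l) * poisson_kernel (1 / l) t)"
    using scaled_kernel_poisson_bounds by metis
  from someI_ex[OF this, folded kernel_bound_def]
  show "kernel_bound > 0"
  "l > 0 \<Longrightarrow> cmod (scaled_kernel l (of_real t)) \<le> kernel_bound * poisson_kernel (1 / l) t"
  "l > 0 \<Longrightarrow> cmod (deriv (scaled_kernel l) (of_real t)) \<le> (kernel_bound * l) * poisson_kernel (1 / l) t"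
  "l > 0 \<Longrightarrow> cmod (tail_kernel (\<lambda>t. scaled_kernel l (of_real t)) t) \<le> (kernel_bound / l) * poisson_kernel (1 / l) t"
    by auto
qed

definition jackson_const :: real where "jackson_const = 12 * conv_norm_bound * kernel_bound"

lemma jackson_const_pos: "jackson_const > 0"
  using conv_norm_bound_pos kernel_bound(1) by (simp add: jackson_const_def)

lemma scaled_kernel_decay_real:
  assumes "l > 0" obtains C where "C > 0" "\<And>z. cmod (scaled_kernel l z) \<le> C * exp (12 * l * \<bar>Im z\<bar>) / (1 + cmod z) ^ 4"
    "\<And>t. cmod (scaled_kernel l (of_real t)) \<le> C / (1 + \<bar>t\<bar>) ^ 4"
    "\<And>t. cmod (deriv (scaled_kernel l) (of_real t)) \<le> (C * exp (12 * l) * 2 ^ 4) / (1 + \<bar>t\<bar>) ^ 4"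
proof -
  obtain C where C: "C > 0" "\<And>z. cmod (scaled_kernel l z) \<le> C * exp (12 * l * \<bar>Im z\<bar>) / (1 + cmod z) ^ 4"
    using scaled_kernel_decay[OF assms] by blast
  have "cmod (scaled_kernel l (of_real t)) \<le> C / (1 + \<bar>t\<bar>) ^ 4" for t using C(2)[of "of_real t"] by simp
  moreover have "cmod (deriv (scaled_kernel l) (of_real t)) \<le> (C * exp (12 * l) * 2 ^ 4) / (1 + \<bar>t\<bar>) ^ 4" for t
    using deriv_decay[OF scaled_kernel_holomorphic _ _ C(2), of "of_real t"] C(1) assms by simp
  ultimately show thesis using that C by blast
qed

text \<open>For \<open>v\<close> of type \<open>\<sigma>\<close> with primitive \<open>Q\<close> and \<open>D = F - Q\<close>, the function \<open>u = Q + K * D\<close> is of type \<open>\<sigma>\<close>, and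
  \<open>F - u = D - K * D\<close> is the convolution of \<open>F' - v\<close> with the tail integral of \<open>K\<close>, whose size is \<open>1 / \<sigma>\<close>. It follows also
  that \<open>u\<close> belongs to the space, although \<open>Q\<close> and \<open>K * D\<close> separately may not.\<close>

lemma jackson_step:
  assumes \<sigma>: "\<sigma> > 0" and F: "F \<in> Lvar p" and F': "F' \<in> Lvar p" and prim: "primitive_of F' F"
  shows "best_approx \<sigma> p F \<le> ennreal (jackson_const / \<sigma>) * best_approx \<sigma> p F'"
proof -
  have "best_approx \<sigma> p F \<le> ennreal (jackson_const / \<sigma>) * (0 + Lnorm p (\<lambda>x. F' x - v (of_real x)))"
    if v: "v \<in> Gvar \<sigma> p" for v
  proof -
    obtain Q B where Q: "exp_type_le \<sigma> Q" "primitive_of (\<lambda>x. v (of_real x)) (\<lambda>x. Q (of_real x))"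
      "\<And>x::real. cmod (Q (of_real x)) \<le> B * (1 + \<bar>x\<bar>)"
      "\<And>z. cmod (v z) \<le> B * (1 + cmod z) * exp (6 * \<sigma> * \<bar>Im z\<bar>)"
      by (rule Gvar_primitive[OF \<sigma> v]) blast
    have vL: "(\<lambda>x. v (of_real x)) \<in> Lvar p" using v by (simp add: Gvar_def)
    have holP: "Q holomorphic_on UNIV" using Q(1) by (simp add: exp_type_le_def)
    \<comment> \<open>The kernel has exponential type \<open>12 l\<close>, and the approximant must have type \<open>\<sigma>\<close>.\<close>
    define l where "l = \<sigma> / 12"
    have l: "l > 0" using \<sigma> by (simp add: l_def)
    define D where "D x = F x - Q (of_real x)" for x
    define D' where "D' x = F' x - v (of_real x)" for x
    have prD: "primitive_of D' D" unfolding D_def D'_def by (rule primitive_of_diff[OF prim Q(2)])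
    have D'L: "D' \<in> Lvar p" unfolding D'_def by (rule Lvar_diff[OF F' vL])
    have Dm: "D \<in> borel_measurable lebesgue"
      unfolding D_def using Lvar_measurable[OF F] entire_real_measurable[OF holP] by (rule borel_measurable_diff)
    have int_D: "integrable lebesgue (\<lambda>t. cmod (D t) / (1 + \<bar>t\<bar>) ^ 4)"
    proof (rule Bochner_Integration.integrable_bound)
      show "integrable lebesgue (\<lambda>t. cmod (F t) / (1 + \<bar>t\<bar>) ^ 4 + cmod (Q (of_real t)) / (1 + \<bar>t\<bar>) ^ 4)"
        by (intro Bochner_Integration.integrable_add Lvar_weight_integrable F linear_growth_integrable[OF entire_real_measurable[OF holP] Q(3)]) auto
      have "cmod (D t) / (1 + \<bar>t\<bar>) ^ 4 \<le> cmod (F t) / (1 + \<bar>t\<bar>) ^ 4 + cmod (Q (of_real t)) / (1 + \<bar>t\<bar>) ^ 4" for t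
        unfolding D_def add_divide_distrib[symmetric] by (intro divide_right_mono norm_triangle_ineq4) auto
      then show "AE t in lebesgue. norm (cmod (D t) / (1 + \<bar>t\<bar>) ^ 4) \<le> norm (cmod (F t) / (1 + \<bar>t\<bar>) ^ 4 + cmod (Q (of_real t)) / (1 + \<bar>t\<bar>) ^ 4)"
        by (intro AE_I2) simp
      have "(\<lambda>t::real. (1 + \<bar>t\<bar>) ^ 4) \<in> borel_measurable lebesgue" by (rule measurable_completion) simp
      then show "(\<lambda>t. cmod (D t) / (1 + \<bar>t\<bar>) ^ 4) \<in> borel_measurable lebesgue" using Dm by measurable
    qed
    obtain C where C: "C > 0" "\<And>z. cmod (scaled_kernel l z) \<le> C * exp (12 * l * \<bar>Im z\<bar>) / (1 + cmod z) ^ 4"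
      "\<And>t. cmod (scaled_kernel l (of_real t)) \<le> C / (1 + \<bar>t\<bar>) ^ 4"
      "\<And>t. cmod (deriv (scaled_kernel l) (of_real t)) \<le> (C * exp (12 * l) * 2 ^ 4) / (1 + \<bar>t\<bar>) ^ 4"
      by (rule scaled_kernel_decay_real[OF l]) blast
    let ?K = "\<lambda>t. scaled_kernel l (of_real t)"
    have parts: "D x - conv ?K D x = conv (tail_kernel ?K) D' x" for x
      using conv_by_parts[OF prD scaled_kernel_real_measurable(1) C(3) Dm Lvar_measurable[OF D'L] int_D
          Lvar_weight_integrable[OF D'L], of x] by (simp add: scaled_kernel_integral[OF l])
    define u where "u z = Q z + cconv (scaled_kernel l) D z" for z
    have "exp_type_le (12 * l) (cconv (scaled_kernel l) D)"
      using C(1) l by (intro cconv_exp_type[OF scaled_kernel_holomorphic _ _ C(2) Dm int_D]) auto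
    then have utype: "exp_type_le \<sigma> u" unfolding u_def l_def using Q(1) by (intro exp_type_le_add) auto
    have Fu: "F x - u (of_real x) = conv (tail_kernel ?K) D' x" for x
      using parts[of x] by (simp add: u_def cconv_of_real D_def[of x] diff_diff_eq)
    have tK: "kernel_bound / l > 0" using kernel_bound(1) l by simp
    have cL: "conv (tail_kernel ?K) D' \<in> Lvar p"
      using l kernel_bound(4)[OF l]
        by (intro Lvar_conv[of "1 / l" "kernel_bound / l"] tail_kernel_measurable tK D'L) auto
    have "(\<lambda>x. u (of_real x)) = (\<lambda>x. F x - conv (tail_kernel ?K) D' x)"
      using Fu by (auto simp: fun_eq_iff algebra_simps)
    then have "u \<in> Gvar \<sigma> p" using utype Lvar_diff[OF F cL] by (simp add: Gvar_def)
    then have "best_approx \<sigma> p F \<le> Lnorm p (\<lambda>x. F x - u (of_real x))" unfolding best_approx_def by (rule INF_lower)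
    also have "\<dots> = Lnorm p (conv (tail_kernel ?K) D')" unfolding Fu ..
    also have "\<dots> \<le> ennreal (conv_norm_bound * (kernel_bound / l)) * Lnorm p D'"
      using l kernel_bound(4)[OF l]
        by (intro Lnorm_conv_le[of "1 / l"] tail_kernel_measurable tK Lvar_measurable D'L) auto
    also have "conv_norm_bound * (kernel_bound / l) = jackson_const / \<sigma>" using \<sigma> by (simp add: jackson_const_def l_def)
    finally show ?thesis by (simp add: D'_def)
  qed
  then have "best_approx \<sigma> p F \<le> ennreal (jackson_const / \<sigma>) * (0 + (INF v\<in>Gvar \<sigma> p. Lnorm p (\<lambda>x. F' x - v (of_real x))))"
    using jackson_const_pos \<sigma> by (intro le_cmult_INF_add Gvar_nonempty) auto
  then show ?thesis by (simp add: best_approx_def)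
qed

definition bernstein_const :: real where "bernstein_const = 1 + conv_norm_bound * kernel_bound"

lemma bernstein_const_pos: "bernstein_const > 0"
  using conv_norm_bound_pos kernel_bound(1) by (simp add: bernstein_const_def add_pos_pos)

text \<open>Let \<open>v\<close> be of type \<open>\<sigma>\<close>. The kernel reproduces \<open>u' - v = (F' - v) - (F' - u')\<close>, and convolution of the last term with \<open>K\<close> equals
  convolution of \<open>F - u\<close> with \<open>K'\<close>, of size \<open>\<sigma>\<close>. So \<open>F' - u'\<close> is bounded without any knowledge of \<open>u'\<close> in the norm.\<close>

lemma derivative_step:
  assumes \<sigma>: "\<sigma> > 0" and F: "F \<in> Lvar p" and F': "F' \<in> Lvar p" and prim: "primitive_of F' F" and u: "u \<in> Gvar \<sigma> p"
  shows "Lnorm p (\<lambda>x. F' x - deriv u (of_real x))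
    \<le> ennreal bernstein_const * (ennreal \<sigma> * Lnorm p (\<lambda>x. F x - u (of_real x)) + best_approx \<sigma> p F')"
proof -
  have uL: "(\<lambda>x. u (of_real x)) \<in> Lvar p" and holu: "u holomorphic_on UNIV"
    using u by (auto simp: Gvar_def exp_type_le_def)
  have hold: "deriv u holomorphic_on UNIV" by (intro holomorphic_intros holu) auto
  obtain B where Bu: "\<And>z. cmod (u z) \<le> B * (1 + cmod z) * exp (6 * \<sigma> * \<bar>Im z\<bar>)"
    using Gvar_growth[OF \<sigma> u] by auto
  have B: "B \<ge> 0" using order_trans[OF norm_ge_zero Bu[of 0]] by simp
  define B' where "B' = 2 * B * exp (6 * \<sigma>)"
  have Bd: "cmod (deriv u z) \<le> B' * (1 + cmod z) * exp (6 * \<sigma> * \<bar>Im z\<bar>)" for z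
    unfolding B'_def using deriv_growth[OF holu _ B Bu] \<sigma> by simp
  have Bdr: "cmod (deriv u (of_real t)) \<le> B' * (1 + \<bar>t\<bar>)" for t using Bd[of "of_real t"] by simp
  define E where "E x = F x - u (of_real x)" for x
  define E' where "E' x = F' x - deriv u (of_real x)" for x
  have EL: "E \<in> Lvar p" unfolding E_def by (rule Lvar_diff[OF F uL])
  have dm: "(\<lambda>x. deriv u (of_real x)) \<in> borel_measurable lebesgue" by (rule entire_real_measurable[OF hold])
  have E'm: "E' \<in> borel_measurable lebesgue"
    unfolding E'_def using Lvar_measurable[OF F'] dm by (rule borel_measurable_diff)
  have "primitive_of (\<lambda>x. deriv u (of_real x)) (\<lambda>x. u (of_real x))"
    by (intro primitive_of_continuous has_vector_derivative_of_entire[OF holu]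
      continuous_on_compose2[OF holomorphic_on_imp_continuous_on[OF hold]] continuous_intros) auto
  then have prE: "primitive_of E' E" unfolding E_def E'_def by (rule primitive_of_diff[OF prim])
  have int_d: "integrable lebesgue (\<lambda>t. cmod (deriv u (of_real t)) / (1 + \<bar>t\<bar>) ^ n)" if "3 \<le> n" for n
    by (rule linear_growth_integrable[OF dm Bdr that])
  have int_E': "integrable lebesgue (\<lambda>t. cmod (E' t) / (1 + \<bar>t\<bar>) ^ n)" if n: "3 \<le> n" for n
  proof (rule Bochner_Integration.integrable_bound)
    show "integrable lebesgue (\<lambda>t. cmod (F' t) / (1 + \<bar>t\<bar>) ^ n + cmod (deriv u (of_real t)) / (1 + \<bar>t\<bar>) ^ n)"
      using n by (intro Bochner_Integration.integrable_add Lvar_weight_integrable F' int_d) auto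
    have "cmod (E' t) / (1 + \<bar>t\<bar>) ^ n \<le> cmod (F' t) / (1 + \<bar>t\<bar>) ^ n + cmod (deriv u (of_real t)) / (1 + \<bar>t\<bar>) ^ n" for t
      unfolding E'_def add_divide_distrib[symmetric] by (intro divide_right_mono norm_triangle_ineq4) auto
    then show "AE t in lebesgue. norm (cmod (E' t) / (1 + \<bar>t\<bar>) ^ n) \<le> norm (cmod (F' t) / (1 + \<bar>t\<bar>) ^ n + cmod (deriv u (of_real t)) / (1 + \<bar>t\<bar>) ^ n)"
      by (intro AE_I2) simp
    have "(\<lambda>t::real. (1 + \<bar>t\<bar>) ^ n) \<in> borel_measurable lebesgue" by (rule measurable_completion) simp
    then show "(\<lambda>t. cmod (E' t) / (1 + \<bar>t\<bar>) ^ n) \<in> borel_measurable lebesgue" using E'm by measurable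
  qed
  obtain C where C: "C > 0" "\<And>z. cmod (scaled_kernel \<sigma> z) \<le> C * exp (12 * \<sigma> * \<bar>Im z\<bar>) / (1 + cmod z) ^ 4"
    "\<And>t. cmod (scaled_kernel \<sigma> (of_real t)) \<le> C / (1 + \<bar>t\<bar>) ^ 4"
    "\<And>t. cmod (deriv (scaled_kernel \<sigma>) (of_real t)) \<le> (C * exp (12 * \<sigma>) * 2 ^ 4) / (1 + \<bar>t\<bar>) ^ 4"
    by (rule scaled_kernel_decay_real[OF \<sigma>]) blast
  \<comment> \<open>The scale is \<open>\<sigma>\<close>, since the bound for \<open>u\<close> has the exponent \<open>6 \<sigma> |Im z|\<close>.\<close>
  let ?K = "\<lambda>t. scaled_kernel \<sigma> (of_real t)" and ?K' = "\<lambda>t. deriv (scaled_kernel \<sigma>) (of_real t)"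
  have conv_int: "integrable lebesgue (\<lambda>t. ?K (x - t) * h t)"
    if "h \<in> borel_measurable lebesgue" "integrable lebesgue (\<lambda>t. cmod (h t) / (1 + \<bar>t\<bar>) ^ 4)" for h x
    using cconv_integrable(1)[OF scaled_kernel_holomorphic _ C(2) that, of "of_real x"] C(1) by simp
  have parts: "conv ?K E' x = conv ?K' E x" for x
  proof -
    have "0 * E x - conv ?K' E x = conv (tail_kernel ?K') E' x"
      using conv_by_parts[OF prE scaled_kernel_real_measurable(2) C(4) Lvar_measurable[OF EL] E'm
          Lvar_weight_integrable[OF EL] int_E', of x] tail_kernel_deriv(2)[OF scaled_kernel_holomorphic C(3) C(4)]
            by simp
    also have "tail_kernel ?K' = (\<lambda>w. - ?K w)"
      by (rule ext) (rule tail_kernel_deriv(1)[OF scaled_kernel_holomorphic C(3) C(4)])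
    also have "conv (\<lambda>w. - ?K w) E' x = - conv ?K E' x" by (simp add: conv_def)
    finally show ?thesis by simp
  qed
  have L: "1 / \<sigma> > 0" using \<sigma> by simp
  have main: "Lnorm p E' \<le> ennreal bernstein_const * (ennreal \<sigma> * Lnorm p E + Lnorm p (\<lambda>x. F' x - v (of_real x)))"
    if v: "v \<in> Gvar \<sigma> p" for v
  proof -
    have vL: "(\<lambda>x. v (of_real x)) \<in> Lvar p" and holv: "v holomorphic_on UNIV"
      using v by (auto simp: Gvar_def exp_type_le_def)
    obtain Bv where Bv: "\<And>z. cmod (v z) \<le> Bv * (1 + cmod z) * exp (6 * \<sigma> * \<bar>Im z\<bar>)"
      using Gvar_growth[OF \<sigma> v] by auto
    define H where "H x = F' x - v (of_real x)" for x
    have HL: "H \<in> Lvar p" unfolding H_def by (rule Lvar_diff[OF F' vL])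
    define w where "w z = deriv u z - v z" for z
    have holw: "w holomorphic_on UNIV" unfolding w_def[abs_def] by (rule holomorphic_on_diff[OF hold holv])
    have wb: "cmod (w z) \<le> (B' + Bv) * (1 + cmod z) * exp (6 * \<sigma> * \<bar>Im z\<bar>)" for z
      unfolding w_def distrib_right by (intro order_trans[OF norm_triangle_ineq4] add_mono Bd Bv)
    have w: "w (of_real x) = conv ?K H x - conv ?K' E x" for x
    proof -
      have "w (of_real x) = conv ?K (\<lambda>t. w (of_real t)) x"
        by (rule scaled_kernel_reproduces[OF \<sigma> holw wb, symmetric])
      also have "\<dots> = (\<integral>t. ?K (x - t) * H t - ?K (x - t) * E' t \<partial>lebesgue)"
        unfolding conv_def by (intro Bochner_Integration.integral_cong) (auto simp: w_def H_def E'_def algebra_simps)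
      also have "\<dots> = conv ?K H x - conv ?K E' x"
        unfolding conv_def by (intro Bochner_Integration.integral_diff conv_int Lvar_measurable[OF HL] E'm Lvar_weight_integrable[OF HL] int_E') auto
      finally show ?thesis by (simp add: parts)
    qed
    have m1: "conv ?K H \<in> borel_measurable lebesgue" "conv ?K' E \<in> borel_measurable lebesgue"
      by (intro measurable_conv scaled_kernel_real_measurable Lvar_measurable HL EL)+
    have K: "Lnorm p (conv ?K H) \<le> ennreal (conv_norm_bound * kernel_bound) * Lnorm p H"
      using kernel_bound(2)[OF \<sigma>]
        by (intro Lnorm_conv_le[OF L] kernel_bound(1) scaled_kernel_real_measurable Lvar_measurable HL) auto
    have K': "Lnorm p (conv ?K' E) \<le> ennreal (conv_norm_bound * (kernel_bound * \<sigma>)) * Lnorm p E"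
      using kernel_bound(3)[OF \<sigma>] kernel_bound(1) \<sigma>
        by (intro Lnorm_conv_le[OF L] scaled_kernel_real_measurable Lvar_measurable EL) auto
    have "E' = (\<lambda>x. (H x - conv ?K H x) + conv ?K' E x)"
      using w by (auto simp: fun_eq_iff E'_def H_def w_def algebra_simps)
    then have "Lnorm p E' = Lnorm p (\<lambda>x. (H x - conv ?K H x) + conv ?K' E x)" by simp
    also have "\<dots> \<le> Lnorm p (\<lambda>x. H x - conv ?K H x) + Lnorm p (conv ?K' E)"
      using Lvar_measurable[OF HL] m1 by (intro Lnorm_triangle' borel_measurable_diff)
    also have "Lnorm p (\<lambda>x. H x - conv ?K H x) \<le> Lnorm p H + Lnorm p (conv ?K H)"
      by (intro Lnorm_triangle_diff Lvar_measurable[OF HL] m1)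
    also have "Lnorm p H + Lnorm p (conv ?K H) + Lnorm p (conv ?K' E)
       \<le> (ennreal 1 * Lnorm p H + ennreal (conv_norm_bound * kernel_bound) * Lnorm p H) + ennreal bernstein_const * (ennreal \<sigma> * Lnorm p E)"
    proof (intro add_mono)
      have "ennreal (conv_norm_bound * (kernel_bound * \<sigma>)) \<le> ennreal bernstein_const * ennreal \<sigma>"
        using \<sigma> bernstein_const_pos
          by (subst ennreal_mult[symmetric]) (auto intro!: ennreal_leI simp: bernstein_const_def algebra_simps)
      then have "ennreal (conv_norm_bound * (kernel_bound * \<sigma>)) * Lnorm p E \<le> ennreal bernstein_const * ennreal \<sigma> * Lnorm p E"
        by (rule mult_right_mono) simp
      with K' show "Lnorm p (conv ?K' E) \<le> ennreal bernstein_const * (ennreal \<sigma> * Lnorm p E)" by (simp add: mult.assoc)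
    qed (use K in auto)
    also have "ennreal 1 * Lnorm p H + ennreal (conv_norm_bound * kernel_bound) * Lnorm p H = ennreal bernstein_const * Lnorm p H"
      unfolding distrib_right[symmetric] bernstein_const_def using conv_norm_bound_pos kernel_bound(1)
      by (subst ennreal_plus[symmetric]) auto
    also have "ennreal bernstein_const * Lnorm p H + ennreal bernstein_const * (ennreal \<sigma> * Lnorm p E)
      = ennreal bernstein_const * (ennreal \<sigma> * Lnorm p E + Lnorm p H)" by (simp add: distrib_left add.commute)
    finally show ?thesis by (simp add: H_def[abs_def])
  qed
  have "Lnorm p E' \<le> ennreal bernstein_const * (ennreal \<sigma> * Lnorm p E + (INF v\<in>Gvar \<sigma> p. Lnorm p (\<lambda>x. F' x - v (of_real x))))"
    using bernstein_const_pos main by (intro le_cmult_INF_add Gvar_nonempty)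
  then show ?thesis by (simp add: best_approx_def E_def[abs_def] E'_def[abs_def])
qed

lemma best_approx_finite:
  assumes "F \<in> Lvar p" shows "best_approx \<sigma> p F < \<infinity>"
proof -
  obtain g where g: "g \<in> Gvar \<sigma> p" using Gvar_nonempty by blast
  then have gL: "(\<lambda>x. g (of_real x)) \<in> Lvar p" by (simp add: Gvar_def)
  have "best_approx \<sigma> p F \<le> Lnorm p (\<lambda>x. F x - g (of_real x))" unfolding best_approx_def by (rule INF_lower[OF g])
  also have "\<dots> < \<infinity>" by (rule Lnorm_finite[OF Lvar_diff[OF assms gL]])
  finally show ?thesis .
qed

text \<open>Bernstein's inequality is the case \<open>F = 0\<close> of the preceding estimate.\<close>

lemma Gvar_deriv:
  assumes \<sigma>: "\<sigma> > 0" and u: "u \<in> Gvar \<sigma> p" shows "deriv u \<in> Gvar \<sigma> p"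
proof -
  have uL: "(\<lambda>x. u (of_real x)) \<in> Lvar p" and type: "exp_type_le \<sigma> u" using u by (auto simp: Gvar_def)
  have hold: "deriv u holomorphic_on UNIV" using type by (intro holomorphic_intros) (auto simp: exp_type_le_def)
  have prim: "primitive_of (\<lambda>x. 0) (\<lambda>x. 0)"
    by (auto simp: primitive_of_def set_integrable_def set_lebesgue_integral_def)
  have "Lnorm p (\<lambda>x. 0 - deriv u (of_real x)) \<le> ennreal bernstein_const * (ennreal \<sigma> * Lnorm p (\<lambda>x. 0 - u (of_real x)) + best_approx \<sigma> p (\<lambda>x. 0))"
    by (rule derivative_step[OF \<sigma> Lvar_zero Lvar_zero prim u])
  also have "\<dots> < \<infinity>" using Lnorm_finite[OF Lvar_diff[OF Lvar_zero uL]] best_approx_finite[OF Lvar_zero, of \<sigma>]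
    by (simp add: ennreal_mult_less_top)
  finally have "Lnorm p (\<lambda>x. deriv u (of_real x)) < \<infinity>" using Lnorm_minus[of "\<lambda>x. deriv u (of_real x)"] by simp
  then have "(\<lambda>x. deriv u (of_real x)) \<in> Lvar p" by (intro LvarI entire_real_measurable[OF hold])
  then show ?thesis using exp_type_le_deriv[OF type] \<sigma> by (simp add: Gvar_def)
qed

end

section \<open>Intermediate derivatives\<close>

definition unit_diff :: "(real \<Rightarrow> complex) \<Rightarrow> real \<Rightarrow> complex" where
  "unit_diff f x = f (x + 1) - f x"

text \<open>By the mean value inequality, one difference of the \<open>(n-1)\<close>-st derivative inherits the bound for the \<open>n\<close>-th derivative; the
  \<open>n\<close>-fold difference is thus a mean of the \<open>n\<close>-th derivative over \<open>[a, a + n]\<close>.\<close>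

lemma unit_diff_estimate:
  fixes g :: "nat \<Rightarrow> real \<Rightarrow> complex"
  assumes "\<And>j x. j < n \<Longrightarrow> (g j has_vector_derivative g (Suc j) x) (at x)"
    and "\<And>z. a \<le> z \<Longrightarrow> z \<le> a + real n \<Longrightarrow> cmod (g n z - c) \<le> T"
  shows "cmod ((unit_diff ^^ n) (g 0) a - c) \<le> T"
  using assms
proof (induction n arbitrary: g)
  case 0
  then show ?case by simp
next
  case (Suc m)
  define g' where "g' j = unit_diff (g j)" for j
  have "cmod ((unit_diff ^^ m) (g' 0) a - c) \<le> T"
  proof (rule Suc.IH)
    fix j x assume j: "j < m"
    have "((\<lambda>x. x + 1) has_vector_derivative (1::real)) (at x)"
      by (auto intro!: derivative_eq_intros)
    then have "((\<lambda>x. g j (x + 1)) has_vector_derivative g (Suc j) (x + 1)) (at x)"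
      using vector_diff_chain_at[of "\<lambda>x. x + 1" 1 x "g j" "g (Suc j) (x + 1)"] Suc.prems(1)[of j "x + 1"] j
      by (simp add: o_def)
    then show "(g' j has_vector_derivative g' (Suc j) x) (at x)"
      unfolding g'_def unit_diff_def[abs_def] using Suc.prems(1)[of j x] j by (intro has_vector_derivative_diff) auto
  next
    fix z assume z: "a \<le> z" "z \<le> a + real m"
    define \<phi> where "\<phi> x = g m x - x *\<^sub>R c" for x
    have d: "(\<phi> has_vector_derivative g (Suc m) x - c) (at x)" for x
      unfolding \<phi>_def using Suc.prems(1)[of m x] by (auto intro!: derivative_eq_intros)
    have "\<exists>x\<in>{z<..<z + 1}. norm (\<phi> (z + 1) - \<phi> z) \<le> norm ((z + 1 - z) *\<^sub>R (g (Suc m) x - c))"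
    proof (rule mvt_general)
      show "continuous_on {z..z + 1} \<phi>"
        using d by (intro continuous_at_imp_continuous_on) (auto intro: has_vector_derivative_continuous)
      show "(\<phi> has_derivative (\<lambda>h. h *\<^sub>R (g (Suc m) x - c))) (at x)" for x
        using d[of x] by (simp add: has_vector_derivative_def)
    qed simp
    then obtain x where x: "z < x" "x < z + 1" "norm (\<phi> (z + 1) - \<phi> z) \<le> cmod (g (Suc m) x - c)" by auto
    have "\<phi> (z + 1) - \<phi> z = g' m z - c" by (simp add: \<phi>_def g'_def unit_diff_def algebra_simps)
    moreover have "cmod (g (Suc m) x - c) \<le> T" using x z by (intro Suc.prems(2)) auto
    ultimately show "cmod (g' m z - c) \<le> T" using x(3) by simp
  qed
  then show ?case unfolding funpow_Suc_right by (simp add: g'_def)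
qed

lemma unit_diff_measurable:
  "f \<in> borel_measurable borel \<Longrightarrow> (unit_diff ^^ n) f \<in> borel_measurable borel"
proof (induction n arbitrary: f)
  case (Suc n)
  note [measurable] = Suc.prems
  have "unit_diff f \<in> borel_measurable borel" unfolding unit_diff_def[abs_def] by measurable
  from Suc.IH[OF this] show ?case by (simp add: funpow_Suc_right del: funpow.simps)
qed simp

text \<open>Each difference at most doubles the integral and lengthens the window by 1.\<close>

lemma nn_integral_unit_diff:
  assumes "f \<in> borel_measurable borel"
  shows "(\<integral>\<^sup>+y. ennreal (cmod ((unit_diff ^^ n) f y)) * indicator {x..x + m} y \<partial>lborel)
    \<le> 2 ^ n * (\<integral>\<^sup>+y. ennreal (cmod (f y)) * indicator {x..x + m + real n} y \<partial>lborel)"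
  using assms
proof (induction n arbitrary: f)
  case 0
  then show ?case by simp
next
  case (Suc n)
  note [measurable] = Suc.prems
  have dm [measurable]: "unit_diff f \<in> borel_measurable borel" unfolding unit_diff_def[abs_def] by measurable
  define I where "I = (\<integral>\<^sup>+y. ennreal (cmod (f y)) * indicator {x..x + m + real (Suc n)} y \<partial>lborel)"
  have "(\<integral>\<^sup>+y. ennreal (cmod ((unit_diff ^^ Suc n) f y)) * indicator {x..x + m} y \<partial>lborel)
    = (\<integral>\<^sup>+y. ennreal (cmod ((unit_diff ^^ n) (unit_diff f) y)) * indicator {x..x + m} y \<partial>lborel)"
    by (simp add: funpow_Suc_right del: funpow.simps)
  also have "\<dots> \<le> 2 ^ n * (\<integral>\<^sup>+y. ennreal (cmod (unit_diff f y)) * indicator {x..x + m + real n} y \<partial>lborel)"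
    by (rule Suc.IH[OF dm])
  also have "(\<integral>\<^sup>+y. ennreal (cmod (unit_diff f y)) * indicator {x..x + m + real n} y \<partial>lborel)
     \<le> (\<integral>\<^sup>+y. ennreal (cmod (f (1 + 1 * y))) * indicator {x + 1..x + m + real (Suc n)} (1 + 1 * y)
        + ennreal (cmod (f y)) * indicator {x..x + m + real (Suc n)} y \<partial>lborel)"
  proof (rule nn_integral_mono)
    fix y
    have "cmod (unit_diff f y) \<le> cmod (f (1 + 1 * y)) + cmod (f y)"
      using norm_triangle_ineq4[of "f (y + 1)" "f y"] by (simp add: unit_diff_def add.commute)
    then have "ennreal (cmod (unit_diff f y)) \<le> ennreal (cmod (f (1 + 1 * y)) + cmod (f y))" by (rule ennreal_leI)
    also have "\<dots> = ennreal (cmod (f (1 + 1 * y))) + ennreal (cmod (f y))" by (rule ennreal_plus) auto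
    finally have "ennreal (cmod (unit_diff f y)) \<le> ennreal (cmod (f (1 + 1 * y))) + ennreal (cmod (f y))" .
    then show "ennreal (cmod (unit_diff f y)) * indicator {x..x + m + real n} y
       \<le> ennreal (cmod (f (1 + 1 * y))) * indicator {x + 1..x + m + real (Suc n)} (1 + 1 * y)
        + ennreal (cmod (f y)) * indicator {x..x + m + real (Suc n)} y"
      by (auto simp: indicator_def)
  qed
  also have "\<dots> = (\<integral>\<^sup>+y. ennreal (cmod (f (1 + 1 * y))) * indicator {x + 1..x + m + real (Suc n)} (1 + 1 * y) \<partial>lborel) + I"
    unfolding I_def by (intro nn_integral_add) measurable
  also have "(\<integral>\<^sup>+y. ennreal (cmod (f (1 + 1 * y))) * indicator {x + 1..x + m + real (Suc n)} (1 + 1 * y) \<partial>lborel)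
      = (\<integral>\<^sup>+y. ennreal (cmod (f y)) * indicator {x + 1..x + m + real (Suc n)} y \<partial>lborel)"
    by (subst nn_integral_real_affine[where c = 1 and t = 1]) auto
  also have "\<dots> \<le> I" unfolding I_def by (intro nn_integral_mono) (auto simp: indicator_def)
  finally have "(\<integral>\<^sup>+y. ennreal (cmod ((unit_diff ^^ Suc n) f y)) * indicator {x..x + m} y \<partial>lborel) \<le> 2 ^ n * (I + I)"
    by (simp add: mult_left_mono add_right_mono)
  also have "2 ^ n * (I + I) = 2 ^ Suc n * I" by (simp add: mult_2[symmetric] mult_ac)
  finally show ?case unfolding I_def .
qed

lemma abs_cont_continuous:
  assumes ac: "\<And>a b. abs_cont_on a b h"
  shows "continuous_on UNIV h"
  unfolding continuous_on_iff
proof (intro ballI allI impI)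
  fix x e :: real assume e: "e > 0"
  obtain d where d: "d > 0" "\<And>I (u :: nat \<Rightarrow> real) v. interval_family I u v (x - 1) (x + 1) \<Longrightarrow> (\<Sum>i\<in>I. v i - u i) < d
      \<Longrightarrow> (\<Sum>i\<in>I. cmod (h (v i) - h (u i))) < e"
    using abs_cont_on_family[OF ac[of "x - 1" "x + 1"] e, where 'i = nat] by auto
  show "\<exists>d>0. \<forall>x'\<in>UNIV. dist x' x < d \<longrightarrow> dist (h x') (h x) < e"
  proof (intro exI[of _ "min d 1"] conjI ballI impI)
    fix y assume y: "dist y x < min d 1"
    have "interval_family {0::nat} (\<lambda>_. min x y) (\<lambda>_. max x y) (x - 1) (x + 1)"
      using y by (auto simp: interval_family_def disjoint_family_on_def dist_real_def)
    from d(2)[OF this] y have "cmod (h (max x y) - h (min x y)) < e"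
      by (auto simp: dist_real_def max_def min_def split: if_splits)
    then show "dist (h y) (h x) < e"
      by (auto simp: dist_norm max_def min_def norm_minus_commute split: if_splits)
  qed (use d in auto)
qed

context log_exponent
begin

text \<open>The average is the convolution with the indicator function of \<open>[-L, 0]\<close>, which is below a multiple of the Poisson
  kernel of width 1.\<close>

lemma window_average:
  fixes L :: real
  assumes h: "h \<in> Lvar p" and L: "0 \<le> L"
  shows "(\<lambda>x. complex_of_real (\<integral>t. indicator {x..x + L} t * cmod (h t) \<partial>lebesgue)) \<in> Lvar p"
    and "integrable lebesgue (\<lambda>t. indicator {x..x + L} t * cmod (h t))"
proof -
  define K where "K w = complex_of_real (indicator {- L..0} w)" for w :: real
  define h' where "h' t = complex_of_real (cmod (h t))" for t
  have h'L: "h' \<in> Lvar p"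
  proof (rule LvarI)
    show "h' \<in> borel_measurable lebesgue" unfolding h'_def using Lvar_measurable[OF h] by measurable
    have "Lnorm p h' \<le> Lnorm p h" by (intro Lnorm_mono p_nonneg) (simp add: h'_def)
    also have "\<dots> < \<infinity>" by (rule Lnorm_finite[OF h])
    finally show "Lnorm p h' < \<infinity>" .
  qed
  have "conv K h' \<in> Lvar p"
  proof (rule Lvar_conv[where \<tau> = 1 and A = "pi * (1 + L\<^sup>2)"])
    show "K \<in> borel_measurable borel" unfolding K_def by measurable
    fix w :: real
    show "cmod (K w) \<le> pi * (1 + L\<^sup>2) * poisson_kernel 1 w"
    proof (cases "w \<in> {- L..0}")
      case True
      then have "w\<^sup>2 \<le> L\<^sup>2" using L by (intro abs_le_square_iff[THEN iffD1]) auto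
      moreover have "0 < 1 + w\<^sup>2" by (simp add: add_pos_nonneg)
      ultimately show ?thesis using True by (simp add: K_def poisson_kernel_def)
    next
      case False
      then show ?thesis by (simp add: K_def poisson_kernel_nonneg)
    qed
  qed (use h'L in \<open>auto simp: add_pos_nonneg\<close>)
  moreover have eq: "conv K h' x = complex_of_real (\<integral>t. indicator {x..x + L} t * cmod (h t) \<partial>lebesgue)" for x
  proof -
    have "K (x - t) * h' t = complex_of_real (indicator {x..x + L} t * cmod (h t))" for t
      by (auto simp: K_def h'_def indicator_def)
    then show ?thesis unfolding conv_def by (simp only: integral_complex_of_real)
  qed
  ultimately show "(\<lambda>x. complex_of_real (\<integral>t. indicator {x..x + L} t * cmod (h t) \<partial>lebesgue)) \<in> Lvar p"
    using ext[of "conv K h'", OF eq] by metis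
  obtain B where "\<And>x y. x \<le> y \<Longrightarrow> set_integrable lebesgue {x<..y} h" by (rule Lvar_local_integral[OF h]) blast
  then have "set_integrable lebesgue {x - 1<..x + L} h" using L by simp
  then have "set_integrable lebesgue {x..x + L} h" by (rule set_integrable_subset) auto
  then show "integrable lebesgue (\<lambda>t. indicator {x..x + L} t * cmod (h t))"
    using set_integrable_norm[of lebesgue "{x..x + L}" h] by (simp add: set_integrable_def)
qed

text \<open>On \<open>[x, x + n + 1]\<close> the \<open>n\<close>-th derivative differs from its value at \<open>x\<close> by at most the integral \<open>T x\<close> of \<open>|d (n+1)|\<close>, hence
  so does the \<open>n\<close>-fold difference of \<open>d 0\<close> at every \<open>y\<close> in \<open>[x, x + 1]\<close>. Averaging over these \<open>y\<close> bounds \<open>|d n x|\<close> by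
  \<open>T x + 2\<^sup>n S x\<close>, where \<open>S x\<close> is the integral of \<open>|d 0|\<close>; both window averages belong to the space.\<close>

lemma intermediate_derivative_in_Lvar:
  fixes d :: "nat \<Rightarrow> real \<Rightarrow> complex"
  assumes ch: "\<And>j x. j < n \<Longrightarrow> (d j has_vector_derivative d (Suc j) x) (at x)"
    and prim: "primitive_of (d (Suc n)) (d n)" and cont: "continuous_on UNIV (d 0)" "continuous_on UNIV (d n)"
    and d0: "d 0 \<in> Lvar p" and dn: "d (Suc n) \<in> Lvar p"
  shows "d n \<in> Lvar p"
proof -
  define L where "L = 1 + real n"
  have L: "0 \<le> L" by (simp add: L_def)
  define S where "S x = (\<integral>t. indicator {x..x + L} t * cmod (d 0 t) \<partial>lebesgue)" for x
  define T where "T x = (\<integral>t. indicator {x..x + L} t * cmod (d (Suc n) t) \<partial>lebesgue)" for x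
  have SL: "(\<lambda>x. complex_of_real (S x)) \<in> Lvar p" and TL: "(\<lambda>x. complex_of_real (T x)) \<in> Lvar p"
    using window_average(1)[OF d0 L] window_average(1)[OF dn L] unfolding S_def T_def by auto
  have ST0: "0 \<le> S x" "0 \<le> T x" for x unfolding S_def T_def by (auto intro!: integral_nonneg_AE)
  have d0m [measurable]: "d 0 \<in> borel_measurable borel" using cont(1) by (rule borel_measurable_continuous_onI)
  have key: "cmod (d n x) \<le> T x + 2 ^ n * S x" for x
  proof -
    have osc: "cmod (d n z - d n x) \<le> T x" if z: "x \<le> z" "z \<le> x + L" for z
    proof -
      have i: "integrable lebesgue (\<lambda>t. indicator {x<..z} t *\<^sub>R d (Suc n) t)"
        and v: "d n z - d n x = (\<integral>t. indicator {x<..z} t *\<^sub>R d (Suc n) t \<partial>lebesgue)"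
        using prim z unfolding primitive_of_def set_integrable_def set_lebesgue_integral_def by auto
      have "cmod (d n z - d n x) \<le> (\<integral>t. cmod (indicator {x<..z} t *\<^sub>R d (Suc n) t) \<partial>lebesgue)"
        unfolding v by (rule integral_norm_bound)
      also have "\<dots> \<le> T x" unfolding T_def
        by (rule integral_mono[OF integrable_norm[OF i] window_average(2)[OF dn L]]) (use z in \<open>auto simp: indicator_def\<close>)
      finally show ?thesis .
    qed
    have pt: "cmod (d n x) \<le> T x + cmod ((unit_diff ^^ n) (d 0) y)" if y: "x \<le> y" "y \<le> x + 1" for y
    proof -
      have "cmod ((unit_diff ^^ n) (d 0) y - d n x) \<le> T x"
        using y by (intro unit_diff_estimate[of n d] ch osc) (auto simp: L_def)
      then show ?thesis using norm_triangle_ineq2[of "d n x" "(unit_diff ^^ n) (d 0) y"]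
        by (simp add: norm_minus_commute)
    qed
    have um [measurable]: "(unit_diff ^^ n) (d 0) \<in> borel_measurable borel" by (rule unit_diff_measurable) simp
    have "ennreal (cmod (d n x)) = (\<integral>\<^sup>+y. ennreal (cmod (d n x)) * indicator {x..x + 1} y \<partial>lborel)"
      by (subst nn_integral_cmult_indicator) auto
    also have "\<dots> \<le> (\<integral>\<^sup>+y. ennreal (T x) * indicator {x..x + 1} y + ennreal (cmod ((unit_diff ^^ n) (d 0) y)) * indicator {x..x + 1} y \<partial>lborel)"
    proof (rule nn_integral_mono)
      fix y
      show "ennreal (cmod (d n x)) * indicator {x..x + 1} y \<le> ennreal (T x) * indicator {x..x + 1} y + ennreal (cmod ((unit_diff ^^ n) (d 0) y)) * indicator {x..x + 1} y"
        using pt[of y] ST0(2)[of x]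
          by (auto simp: indicator_def ennreal_plus[symmetric] ennreal_leI simp del: ennreal_plus)
    qed
    also have "\<dots> = (\<integral>\<^sup>+y. ennreal (T x) * indicator {x..x + 1} y \<partial>lborel) + (\<integral>\<^sup>+y. ennreal (cmod ((unit_diff ^^ n) (d 0) y)) * indicator {x..x + 1} y \<partial>lborel)"
      by (intro nn_integral_add) measurable
    also have "(\<integral>\<^sup>+y. ennreal (T x) * indicator {x..x + 1} y \<partial>lborel) = ennreal (T x)"
      by (subst nn_integral_cmult_indicator) auto
    also have "(\<integral>\<^sup>+y. ennreal (cmod ((unit_diff ^^ n) (d 0) y)) * indicator {x..x + 1} y \<partial>lborel)
       \<le> 2 ^ n * (\<integral>\<^sup>+y. ennreal (cmod (d 0 y)) * indicator {x..x + 1 + real n} y \<partial>lborel)"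
      by (rule nn_integral_unit_diff) simp
    also have "(\<integral>\<^sup>+y. ennreal (cmod (d 0 y)) * indicator {x..x + 1 + real n} y \<partial>lborel) = ennreal (S x)"
    proof -
      have "(\<integral>\<^sup>+y. ennreal (cmod (d 0 y)) * indicator {x..x + 1 + real n} y \<partial>lborel) = (\<integral>\<^sup>+y. ennreal (indicator {x..x + L} y * cmod (d 0 y)) \<partial>lborel)"
        by (intro nn_integral_cong) (auto simp: indicator_def L_def add.assoc)
      also have "\<dots> = (\<integral>\<^sup>+y. ennreal (indicator {x..x + L} y * cmod (d 0 y)) \<partial>lebesgue)"
        by (rule nn_integral_completion[symmetric]) measurable
      also have "\<dots> = ennreal (S x)" unfolding S_def
        by (rule nn_integral_eq_integral[OF window_average(2)[OF d0 L]]) simp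
      finally show ?thesis .
    qed
    finally have "ennreal (cmod (d n x)) \<le> ennreal (T x) + 2 ^ n * ennreal (S x)" by (simp add: add_left_mono)
    also have "\<dots> = ennreal (T x + 2 ^ n * S x)"
    proof -
      have "(2::ennreal) ^ n = ennreal (2 ^ n)" by (simp add: ennreal_power[symmetric])
      then show ?thesis using ST0[of x] by (simp add: ennreal_mult ennreal_plus)
    qed
    finally show ?thesis using ST0[of x] by (subst (asm) ennreal_le_iff) auto
  qed
  show ?thesis
  proof (rule LvarI)
    show "d n \<in> borel_measurable lebesgue"
      using measurable_completion[of "d n" lborel borel] borel_measurable_continuous_onI[OF cont(2)] by simp
    have "Lnorm p (d n) \<le> Lnorm p (\<lambda>x. complex_of_real (T x) + complex_of_real (2 ^ n) * complex_of_real (S x))"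
    proof (rule Lnorm_mono[OF p_nonneg])
      fix x
      have "complex_of_real (T x) + complex_of_real (2 ^ n) * complex_of_real (S x) = complex_of_real (T x + 2 ^ n * S x)" by simp
      then have "cmod (complex_of_real (T x) + complex_of_real (2 ^ n) * complex_of_real (S x)) = T x + 2 ^ n * S x"
        using ST0[of x] by (simp only: norm_of_real) simp
      then show "cmod (d n x) \<le> cmod (complex_of_real (T x) + complex_of_real (2 ^ n) * complex_of_real (S x))"
        using key[of x] by simp
    qed
    also have "\<dots> \<le> Lnorm p (\<lambda>x. complex_of_real (T x)) + Lnorm p (\<lambda>x. complex_of_real (2 ^ n) * complex_of_real (S x))"
      by (intro Lnorm_triangle' borel_measurable_times borel_measurable_const Lvar_measurable SL TL)
    also have "\<dots> \<le> Lnorm p (\<lambda>x. complex_of_real (T x)) + ennreal (2 ^ n) * Lnorm p (\<lambda>x. complex_of_real (S x))"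
      by (intro add_left_mono Lnorm_mono_scale p_nonneg) (auto simp: norm_mult norm_power)
    also have "\<dots> < \<infinity>" using Lnorm_finite[OF SL] Lnorm_finite[OF TL] by (simp add: ennreal_mult_less_top)
    finally show "Lnorm p (d n) < \<infinity>" .
  qed
qed

text \<open>Only the derivatives of order 0 and \<open>r\<close> are in the space by definition; the others follow downwards from order \<open>r\<close>,
  each from its successor and from order 0.\<close>

lemma Wvar_derivatives:
  assumes f: "f \<in> Wvar r p" and r: "1 \<le> r"
  shows "j < r \<Longrightarrow> primitive_of (rderiv (Suc j) f) (rderiv j f)" "j \<le> r \<Longrightarrow> rderiv j f \<in> Lvar p"
proof -
  have Suc: "rderiv (Suc j) f = (\<lambda>x. vector_derivative (rderiv j f) (at x))" for j
    by (simp add: rderiv_def)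
  have fL: "rderiv 0 f \<in> Lvar p" and top: "rderiv r f \<in> Lvar p" and ac: "\<And>a b. abs_cont_on a b (rderiv (r - 1) f)"
    and diff: "\<And>j x. Suc j < r \<Longrightarrow> rderiv j f differentiable (at x)"
    using f by (auto simp: Wvar_def rderiv_def)
  have vd: "(rderiv j f has_vector_derivative rderiv (Suc j) f x) (at x)" if "Suc j < r" for j x
    using diff[OF that, of x] unfolding Suc by (simp add: vector_derivative_works)
  have cont: "continuous_on UNIV (rderiv j f)" if "j < r" for j
  proof (cases "Suc j < r")
    case True
    then show ?thesis using vd[OF True]
      by (intro continuous_at_imp_continuous_on) (auto intro: has_vector_derivative_continuous)
  next
    case False
    then have "j = r - 1" using that by simp
    then show ?thesis using abs_cont_continuous[OF ac] by simp
  qed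
  have prim: "primitive_of (rderiv (Suc j) f) (rderiv j f)" if "j < r" for j
  proof (cases "Suc j < r")
    case True
    then show ?thesis by (intro primitive_of_continuous vd cont)
  next
    case False
    then have j: "j = r - 1" "Suc j = r" using that by auto
    have "(\<lambda>x. vector_derivative (rderiv (r - 1) f) (at x)) = rderiv r f" using Suc[of "r - 1"] j by simp
    then show ?thesis using abs_cont_primitive_of_derivative[OF ac] Lvar_measurable[OF top] j by simp
  qed
  then show "j < r \<Longrightarrow> primitive_of (rderiv (Suc j) f) (rderiv j f)" .
  have down: "\<forall>i\<le>m. rderiv i f \<in> Lvar p" if "m \<le> r" "rderiv m f \<in> Lvar p" for m
    using that
  proof (induction m)
    case 0
    then show ?case by simp
  next
    case (Suc n)
    have "rderiv n f \<in> Lvar p"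
    proof (rule intermediate_derivative_in_Lvar[where d = "\<lambda>j. rderiv j f"])
      show "(rderiv j f has_vector_derivative rderiv (Suc j) f x) (at x)" if "j < n" for j x
        using that Suc.prems by (intro vd) auto
    qed (use Suc.prems fL r in \<open>auto intro!: prim cont\<close>)
    with Suc show ?case by (auto simp: le_Suc_eq)
  qed
  show "j \<le> r \<Longrightarrow> rderiv j f \<in> Lvar p" using down[OF order_refl top] by blast
qed

section \<open>Simultaneous approximation\<close>

lemma best_approx_iterated:
  assumes \<sigma>: "\<sigma> > 0" and f: "f \<in> Wvar r p" and r: "1 \<le> r" and j: "j \<le> r"
  shows "best_approx \<sigma> p (rderiv j f) \<le> ennreal ((jackson_const / \<sigma>) ^ (r - j)) * best_approx \<sigma> p (rderiv r f)"
  using j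
proof (induction rule: inc_induct)
  case base
  then show ?case by simp
next
  case (step m)
  have pos: "0 \<le> jackson_const / \<sigma>" using \<sigma> jackson_const_pos by simp
  have "best_approx \<sigma> p (rderiv m f) \<le> ennreal (jackson_const / \<sigma>) * best_approx \<sigma> p (rderiv (Suc m) f)"
    using step Wvar_derivatives[OF f r] by (intro jackson_step[OF \<sigma>]) auto
  also have "\<dots> \<le> ennreal (jackson_const / \<sigma>) * (ennreal ((jackson_const / \<sigma>) ^ (r - Suc m)) * best_approx \<sigma> p (rderiv r f))"
    using step.IH by (intro mult_left_mono) auto
  also have "\<dots> = ennreal (jackson_const / \<sigma> * (jackson_const / \<sigma>) ^ (r - Suc m)) * best_approx \<sigma> p (rderiv r f)"
    by (subst ennreal_mult[OF pos zero_le_power[OF pos]]) (rule mult.assoc[symmetric])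
  also have "jackson_const / \<sigma> * (jackson_const / \<sigma>) ^ (r - Suc m) = (jackson_const / \<sigma>) ^ (r - m)"
    using step.hyps by (simp add: Suc_diff_Suc flip: power_Suc)
  finally show ?case .
qed

text \<open>The recursion is that of the induction over the order of the derivative.\<close>

fun approx_const :: "nat \<Rightarrow> nat \<Rightarrow> real" where
  "approx_const r 0 = jackson_const ^ r"
| "approx_const r (Suc k) = bernstein_const * (approx_const r k + jackson_const ^ (r - Suc k))"

lemma approx_const_pos: "approx_const r k > 0"
  by (induction k) (use jackson_const_pos bernstein_const_pos in \<open>auto intro!: mult_pos_pos add_pos_pos\<close>)

text \<open>Order 0 is the Jackson estimate, iterated \<open>r\<close> times. From order \<open>k\<close> to \<open>k + 1\<close> the derivative step costs a factor \<open>\<sigma>\<close>, and the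
  best approximation of the next derivative is again estimated by iterated Jackson steps; both terms are of order
  \<open>\<sigma>\<close> to the power \<open>k + 1 - r\<close>.\<close>

lemma simultaneous_approximation:
  assumes \<sigma>: "\<sigma> > 0" and f: "f \<in> Wvar r p" and r: "1 \<le> r" and g: "g \<in> Gvar \<sigma> p"
    and best: "best_approx \<sigma> p f = Lnorm p (\<lambda>x. f x - g (of_real x))" and k: "k \<le> r"
  shows "Lnorm p (\<lambda>x. rderiv k f x - (deriv ^^ k) g (of_real x))
    \<le> ennreal (approx_const r k / \<sigma> ^ (r - k)) * best_approx \<sigma> p (rderiv r f)"
  using k
proof (induction k)
  case 0
  have "Lnorm p (\<lambda>x. rderiv 0 f x - (deriv ^^ 0) g (of_real x)) = best_approx \<sigma> p (rderiv 0 f)"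
    using best by (simp add: rderiv_def)
  also have "\<dots> \<le> ennreal ((jackson_const / \<sigma>) ^ (r - 0)) * best_approx \<sigma> p (rderiv r f)"
    by (rule best_approx_iterated[OF \<sigma> f r]) simp
  finally show ?case by (simp add: power_divide)
next
  case (Suc k)
  define B where "B = best_approx \<sigma> p (rderiv r f)"
  define M where "M = approx_const r k"
  define J where "J = jackson_const ^ (r - Suc k)"
  define s where "s = \<sigma> ^ (r - Suc k)"
  have pos: "0 \<le> M" "0 \<le> J" "0 < s" "0 \<le> bernstein_const"
    using approx_const_pos[of r k] jackson_const_pos \<sigma> bernstein_const_pos by (auto simp: M_def J_def s_def)
  have s: "\<sigma> ^ (r - k) = \<sigma> * s" using Suc.prems by (simp add: s_def Suc_diff_Suc flip: power_Suc)
  have gk: "(deriv ^^ k) g \<in> Gvar \<sigma> p" by (induction k) (use g Gvar_deriv[OF \<sigma>] in auto)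
  have "Lnorm p (\<lambda>x. rderiv (Suc k) f x - (deriv ^^ Suc k) g (of_real x))
    \<le> ennreal bernstein_const * (ennreal \<sigma> * Lnorm p (\<lambda>x. rderiv k f x - (deriv ^^ k) g (of_real x)) + best_approx \<sigma> p (rderiv (Suc k) f))"
    using derivative_step[OF \<sigma> _ _ _ gk, of "rderiv k f" "rderiv (Suc k) f"] Wvar_derivatives[OF f r] Suc.prems by simp
  also have "\<dots> \<le> ennreal bernstein_const * (ennreal \<sigma> * (ennreal (M / (\<sigma> * s)) * B) + ennreal (J / s) * B)"
  proof (intro mult_left_mono add_mono)
    show "Lnorm p (\<lambda>x. rderiv k f x - (deriv ^^ k) g (of_real x)) \<le> ennreal (M / (\<sigma> * s)) * B"
      using Suc.IH Suc.prems by (simp add: M_def B_def s)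
    show "best_approx \<sigma> p (rderiv (Suc k) f) \<le> ennreal (J / s) * B"
      using best_approx_iterated[OF \<sigma> f r Suc.prems] by (simp add: J_def s_def B_def power_divide)
  qed auto
  also have "ennreal \<sigma> * (ennreal (M / (\<sigma> * s)) * B) = ennreal (M / s) * B"
    using pos \<sigma> by (simp add: ennreal_mult[symmetric] flip: mult.assoc)
  also have "ennreal bernstein_const * (ennreal (M / s) * B + ennreal (J / s) * B) = ennreal (bernstein_const * (M + J) / s) * B"
    using pos by (simp add: distrib_right[symmetric] ennreal_plus[symmetric] ennreal_mult[symmetric] add_divide_distrib[symmetric]
        del: ennreal_plus flip: mult.assoc)
  finally show ?case by (simp add: M_def J_def s_def B_def)
qed

end

theorem theorem5p12:
  fixes r k :: nat and p :: "real \<Rightarrow> real"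
  assumes "r \<ge> 1" and "p \<in> log_exponents" and "k \<le> r"
  shows "\<exists>C::real. C > 0 \<and>
    (\<forall>\<sigma>::real. \<sigma> > 0 \<longrightarrow> (\<forall>f \<in> Wvar r p. \<forall>g \<in> Gvar \<sigma> p.
       best_approx \<sigma> p f = Lnorm p (\<lambda>x. f x - g (of_real x)) \<longrightarrow>
       Lnorm p (\<lambda>x. rderiv k f x - (deriv ^^ k) g (of_real x))
         \<le> ennreal (C / \<sigma> ^ (r - k)) * best_approx \<sigma> p (rderiv r f)))"
proof -
  obtain c1 c2 c3 P where "log_exponent p c1 c2 c3 P"
    using assms(2) by (rule log_exponents_locale)
  then interpret log_exponent p c1 c2 c3 P .
  show ?thesis
    using approx_const_pos[of r k] simultaneous_approximation[OF _ _ assms(1) _ _ assms(3)] by blast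
qed

end
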